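(* Let $\Omega\subset\mathbb{R}^N$ be a bounded domain and $\alpha>0$. In the low contrast regime, i.e. for contrast parameter $\varepsilon>0$ sufficiently small, the following holds: there is a constant $C>0$, independent of the measurable set $B\subseteq\Omega$, such that $$\bigl|\lambda_\varepsilon(B)-(\lambda_0+\varepsilon\lambda_1(B)+\varepsilon^2\lambda_2(B))\bigr|\le 2\,C\,\varepsilon^3\sqrt{\frac{\lambda_0}{\alpha}}$$ for all sufficiently small $\varepsilon>0$. (The constant $C$ does not depend on $\varepsilon$ either.)
   Context: Two materials of conductivities $\alpha$ and $\beta=\alpha(1+\varepsilon)$ fill $\Omega$, the second one occupying $B$; the low contrast regime means that $\varepsilon>0$ is small. $\chi_B$ is the characteristic function of $B$. $\lambda_\varepsilon(B)$ is the smallest eigenvalue of $-\mathrm{div}(\alpha(1+\varepsilon\chi_B)\nabla\,\cdot\,)$ on $H^1_0(\Omega)$. $\lambda_0$ is the first eigenvalue of $-\alpha\Delta$ on $H^1_0(\Omega)$, and $u_0$ is the associated positive eigenfunction with $\int_\Omega u_0^2=1$. The numbers $\lambda_1(B),\lambda_2(B)$ are the coefficients of $\varepsilon$ and $\varepsilon^2$ in the analytic expansion of $\lambda_\varepsilon(B)$ at $\varepsilon=0$; explicitly $$\lambda_1(B)=\int_B\alpha|\nabla u_0|^2,\qquad \lambda_2(B)=\int_B\alpha\nabla u_0\cdot\nabla u_1,$$ where $u_1=u_1(B)\in H^1_0(\Omega)$ is the unique weak solution of $-\alpha\Delta u_1-\lambda_0u_1=\mathrm{div}(\alpha\chi_B\nabla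 u_0)+\lambda_1(B)u_0$ in $\Omega$ with $\int_\Omega u_0u_1=0$. *)

theory Defs
  imports "HOL-Analysis.Analysis"
begin

subsection \<open>Test functions\<close>

primrec Ck :: "nat \<Rightarrow> ('a::euclidean_space \<Rightarrow> real) \<Rightarrow> bool" where
  "Ck 0 f \<longleftrightarrow> continuous_on UNIV f"
| "Ck (Suc k) f \<longleftrightarrow> (\<forall>x. f differentiable (at x)) \<and>
     (\<forall>b\<in>Basis. Ck k (\<lambda>x. frechet_derivative f (at x) b))"

definition test_functions :: "'a::euclidean_space set \<Rightarrow> ('a \<Rightarrow> real) set" where
  "test_functions \<Omega> =
     {\<phi>. (\<forall>k. Ck k \<phi>) \<and> compact (closure {x. \<phi> x \<noteq> 0}) \<and> closure {x. \<phi> x \<noteq> 0} \<subseteq> \<Omega>}"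

definition grad :: "('a::euclidean_space \<Rightarrow> real) \<Rightarrow> 'a \<Rightarrow> 'a" where
  "grad f x = (\<Sum>b\<in>Basis. frechet_derivative f (at x) b *\<^sub>R b)"

subsection \<open>Sobolev spaces\<close>

text \<open>Functions on an open set \<open>\<Omega>\<close> are represented by functions on the whole space of which only
  the values on \<open>\<Omega>\<close> matter. Elements of the function spaces below are functions, not classes
  modulo equality almost everywhere.\<close>

definition L2 :: "'a::euclidean_space set \<Rightarrow> ('a \<Rightarrow> 'b::euclidean_space) set" where
  "L2 \<Omega> = {f \<in> borel_measurable (lebesgue_on \<Omega>). integrable (lebesgue_on \<Omega>) (\<lambda>x. (norm (f x))\<^sup>2)}"

definition has_weak_gradient ::
    "'a::euclidean_space set \<Rightarrow> ('a \<Rightarrow> real) \<Rightarrow> ('a \<Rightarrow> 'a) \<Rightarrow> bool" where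
  "has_weak_gradient \<Omega> u G \<longleftrightarrow>
     (\<forall>\<phi>\<in>test_functions \<Omega>.
        (LINT x|lebesgue_on \<Omega>. u x *\<^sub>R grad \<phi> x) = - (LINT x|lebesgue_on \<Omega>. \<phi> x *\<^sub>R G x))"

definition H1 :: "'a::euclidean_space set \<Rightarrow> ('a \<Rightarrow> real) set" where
  "H1 \<Omega> = {u \<in> L2 \<Omega>. \<exists>G\<in>L2 \<Omega>. has_weak_gradient \<Omega> u G}"

text \<open>The weak gradient is determined only up to a null set; any representative may be chosen,
  since it is used under integrals only.\<close>

definition wgrad :: "'a::euclidean_space set \<Rightarrow> ('a \<Rightarrow> real) \<Rightarrow> 'a \<Rightarrow> 'a" where
  "wgrad \<Omega> u = (SOME G. G \<in> L2 \<Omega> \<and> has_weak_gradient \<Omega> u G)"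

definition H1_norm :: "'a::euclidean_space set \<Rightarrow> ('a \<Rightarrow> real) \<Rightarrow> real" where
  "H1_norm \<Omega> u =
     sqrt ((LINT x|lebesgue_on \<Omega>. (u x)\<^sup>2) + (LINT x|lebesgue_on \<Omega>. (norm (wgrad \<Omega> u x))\<^sup>2))"

definition H10 :: "'a::euclidean_space set \<Rightarrow> ('a \<Rightarrow> real) set" where
  "H10 \<Omega> = {u \<in> H1 \<Omega>. \<exists>\<phi>::nat \<Rightarrow> 'a \<Rightarrow> real.
     (\<forall>n. \<phi> n \<in> test_functions \<Omega>) \<and> (\<lambda>n. H1_norm \<Omega> (\<lambda>x. u x - \<phi> n x)) \<longlonglongrightarrow> 0}"

subsection \<open>Eigenvalues of \<open>- div (a \<nabla> \<cdot>)\<close> on \<open>H10 \<Omega>\<close>\<close>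

definition eigenfunction ::
    "'a::euclidean_space set \<Rightarrow> ('a \<Rightarrow> real) \<Rightarrow> real \<Rightarrow> ('a \<Rightarrow> real) \<Rightarrow> bool" where
  "eigenfunction \<Omega> a \<mu> u \<longleftrightarrow>
     u \<in> H10 \<Omega> \<and> \<not> (AE x in lebesgue_on \<Omega>. u x = 0) \<and>
     (\<forall>v\<in>H10 \<Omega>. (LINT x|lebesgue_on \<Omega>. a x * (wgrad \<Omega> u x \<bullet> wgrad \<Omega> v x))
                = \<mu> * (LINT x|lebesgue_on \<Omega>. u x * v x))"

definition first_eigenvalue :: "'a::euclidean_space set \<Rightarrow> ('a \<Rightarrow> real) \<Rightarrow> real" where
  "first_eigenvalue \<Omega> a = (LEAST \<mu>. \<exists>u. eigenfunction \<Omega> a \<mu> u)"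

subsection \<open>The two-phase conductor and its expansion coefficients\<close>

definition lambda_eps :: "'a::euclidean_space set \<Rightarrow> real \<Rightarrow> real \<Rightarrow> 'a set \<Rightarrow> real" where
  "lambda_eps \<Omega> \<alpha> \<epsilon> B = first_eigenvalue \<Omega> (\<lambda>x. \<alpha> * (1 + \<epsilon> * indicator B x))"

definition lambda0 :: "'a::euclidean_space set \<Rightarrow> real \<Rightarrow> real" where
  "lambda0 \<Omega> \<alpha> = first_eigenvalue \<Omega> (\<lambda>x. \<alpha>)"

definition is_u0 :: "'a::euclidean_space set \<Rightarrow> real \<Rightarrow> ('a \<Rightarrow> real) \<Rightarrow> bool" where
  "is_u0 \<Omega> \<alpha> u0 \<longleftrightarrow>
     eigenfunction \<Omega> (\<lambda>x. \<alpha>) (lambda0 \<Omega> \<alpha>) u0 \<and>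
     (AE x in lebesgue_on \<Omega>. u0 x > 0) \<and> (LINT x|lebesgue_on \<Omega>. (u0 x)\<^sup>2) = 1"

definition lambda1 ::
    "'a::euclidean_space set \<Rightarrow> real \<Rightarrow> ('a \<Rightarrow> real) \<Rightarrow> 'a set \<Rightarrow> real" where
  "lambda1 \<Omega> \<alpha> u0 B = (LINT x|lebesgue_on B. \<alpha> * (norm (wgrad \<Omega> u0 x))\<^sup>2)"

text \<open>Weak form of \<open>- \<alpha> \<Delta> u1 - \<lambda>\<^sub>0 u1 = div (\<alpha> \<chi>\<^sub>B \<nabla>u0) + \<lambda>\<^sub>1(B) u0\<close> in \<open>\<Omega>\<close>, \<open>u1 = 0\<close> on the boundary;
  the divergence on the right produces the minus sign.\<close>

definition is_u1 ::
    "'a::euclidean_space set \<Rightarrow> real \<Rightarrow> ('a \<Rightarrow> real) \<Rightarrow> 'a set \<Rightarrow> ('a \<Rightarrow> real) \<Rightarrow> bool" where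
  "is_u1 \<Omega> \<alpha> u0 B u1 \<longleftrightarrow>
     u1 \<in> H10 \<Omega> \<and>
     (\<forall>v\<in>H10 \<Omega>.
        (LINT x|lebesgue_on \<Omega>. \<alpha> * (wgrad \<Omega> u1 x \<bullet> wgrad \<Omega> v x))
          - lambda0 \<Omega> \<alpha> * (LINT x|lebesgue_on \<Omega>. u1 x * v x)
        = - (LINT x|lebesgue_on \<Omega>. \<alpha> * indicator B x * (wgrad \<Omega> u0 x \<bullet> wgrad \<Omega> v x))
          + lambda1 \<Omega> \<alpha> u0 B * (LINT x|lebesgue_on \<Omega>. u0 x * v x)) \<and>
     (LINT x|lebesgue_on \<Omega>. u0 x * u1 x) = 0"

definition lambda2 ::
    "'a::euclidean_space set \<Rightarrow> real \<Rightarrow> ('a \<Rightarrow> real) \<Rightarrow> ('a \<Rightarrow> real) \<Rightarrow> 'a set \<Rightarrow> real" where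
  "lambda2 \<Omega> \<alpha> u0 u1 B = (LINT x|lebesgue_on B. \<alpha> * (wgrad \<Omega> u0 x \<bullet> wgrad \<Omega> u1 x))"

end

theory Submission
  imports Defs "HOL-Computational_Algebra.Polynomial" "HOL-Complex_Analysis.Great_Picard"
    "HOL-Library.Diagonal_Subsequence"
begin

text \<open>
  With \<open>u1\<close> the first-order corrector, \<open>\<psi> = u0 + \<epsilon> u1\<close> is an approximate eigenfunction: its Rayleigh
  quotient agrees with the second-order expansion up to \<open>O(\<epsilon>\<^sup>3)\<close>, which bounds the eigenvalue from above.
  For the bound from below, write any function as \<open>t \<psi> + w\<close> with \<open>w\<close> orthogonal to \<open>u0\<close>. The residual of
  \<open>\<psi>\<close> vanishes to first order in \<open>\<epsilon>\<close>, so the cross term is \<open>O(\<epsilon>\<^sup>2)\<close> and is absorbed by the quadratic term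
  in \<open>w\<close>, which is coercive because of the spectral gap above \<open>\<lambda>\<^sub>0\<close>. All constants depend only on \<open>\<lambda>\<^sub>0\<close> and
  the gap, hence not on \<open>B\<close>.

  The first eigenvalue is attained as the minimum of the Rayleigh quotient by Rellich compactness, and the
  gap follows by compactness from the simplicity of \<open>\<lambda>\<^sub>0\<close>: if an eigenfunction orthogonal to \<open>u0\<close> existed,
  its positive part would be a nonnegative superharmonic function, hence zero or positive almost
  everywhere. This strong maximum principle is obtained from the monotonicity in the scale of the means
  against radial bumps, without any regularity theory.\<close>

subsection \<open>Expansion of a simple lowest eigenvalue\<close>

text \<open>Uniformity in B rests on one inequality: the form \<open>b\<close> carried by B
  satisfies 0 \<le> b \<le> D, with D the Dirichlet form, because the weight
  \<open>\<alpha> * indicator B x\<close> lies between 0 and \<alpha>. It gives b(u0,u0) \<le>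
  \<lambda>0, and the corrector equation tested with u1 itself then bounds the energy of u1 through
  the spectral gap. So the expansion becomes a statement about three abstract symmetric forms.

  The obstacle is the analysis behind these forms. \<open>first_eigenvalue\<close> is a LEAST over
  the reals, which says something only once the minimum of the Rayleigh quotient is attained. One
  estimate, that translating a function by z changes it in L2 by at most |z| times the norm of its
  gradient, yields the Poincare inequality, Rellich compactness and the decisive step of the maximum
  principle alike. Weak gradients are picked by a choice operator, hence identities between them
  hold only almost everywhere.

  The factor sqrt(\<lambda>0 / \<alpha>) enters by normalisation: C is the constant of the estimate
  divided by twice this positive number, which depends on neither B nor \<epsilon>.\<close>

lemma discriminant_le:
  fixes a b c :: real
  assumes "\<And>t. 0 \<le> a + 2 * t * b + t\<^sup>2 * c"
  shows "b\<^sup>2 \<le> a * c"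
proof (cases "c = 0")
  case True
  \<comment> \<open>With c = 0 the quadratic is affine; for nonzero slope the chosen t would give it
    the value -1.\<close>
  have "b = 0"
  proof (rule ccontr)
    assume "b \<noteq> 0"
    have "0 \<le> a + 2 * (- (a + 1) / (2 * b)) * b"
      using assms[of "- (a + 1) / (2 * b)"] True by simp
    with \<open>b \<noteq> 0\<close> show False by (simp add: field_simps)
  qed
  with True show ?thesis by simp
next
  case False
  have a: "0 \<le> a" using assms[of 0] by simp
  have "c > 0"
  proof (rule ccontr)
    assume "\<not> c > 0"
    with False have c: "c < 0" by simp
    \<comment> \<open>A negative leading coefficient wins for large t: t \<ge> 1 together with t *
      |c| > 2 * |b| + a + 1 already makes the value negative.\<close>
    define t where "t = (2 * \<bar>b\<bar> + a + 1) / \<bar>c\<bar> + 1"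
    have "0 \<le> (2 * \<bar>b\<bar> + a + 1) / \<bar>c\<bar>" using a by (intro divide_nonneg_nonneg) auto
    then have t: "t \<ge> 1" by (simp add: t_def)
    have "t * \<bar>c\<bar> = 2 * \<bar>b\<bar> + a + 1 + \<bar>c\<bar>" using c by (simp add: t_def field_simps)
    then have "t * (t * \<bar>c\<bar>) = t * (2 * \<bar>b\<bar> + a + 1 + \<bar>c\<bar>)" by simp
    moreover have "0 \<le> t * \<bar>c\<bar>" using t by simp
    ultimately have "t * (t * \<bar>c\<bar>) \<ge> t * (2 * \<bar>b\<bar>) + t * (a + 1)"
      by (simp add: algebra_simps)
    moreover have "t * (a + 1) \<ge> a + 1" using t a by (simp add: mult_le_cancel_right1)
    moreover have "t * b \<le> t * \<bar>b\<bar>" using t by (simp add: mult_left_mono)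
    ultimately have "a + 2 * t * b + t\<^sup>2 * c < 0"
      using c by (simp add: power2_eq_square algebra_simps)
    with assms[of t] show False by simp
  qed
  have "0 \<le> a - b\<^sup>2 / c"
    using assms[of "- b / c"] \<open>c > 0\<close> by (simp add: power2_eq_square field_simps)
  with \<open>c > 0\<close> show ?thesis by (simp add: field_simps)
qed

text \<open>Nonnegativity is left out of the locale and assumed lemma by lemma, because the forms of
  interest are differences such as energy minus a multiple of the mass. Closure under u + c v is the
  one structural property of V that the computations use.\<close>

locale sym_form =
  fixes V :: "('a \<Rightarrow> real) set" and F :: "('a \<Rightarrow> real) \<Rightarrow> ('a \<Rightarrow> real) \<Rightarrow> real"
  assumes lin: "u \<in> V \<Longrightarrow> v \<in> V \<Longrightarrow> (\<lambda>x. u x + c * v x) \<in> V"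
    and sym: "u \<in> V \<Longrightarrow> v \<in> V \<Longrightarrow> F u v = F v u"
    and add_left: "u \<in> V \<Longrightarrow> v \<in> V \<Longrightarrow> w \<in> V \<Longrightarrow> F (\<lambda>x. u x + c * v x) w = F u w + c * F v w"
begin

lemma add_right:
  "u \<in> V \<Longrightarrow> v \<in> V \<Longrightarrow> w \<in> V \<Longrightarrow> F w (\<lambda>x. u x + c * v x) = F w u + c * F w v"
  using sym[OF _ lin, of w u v c] add_left[of u v w c] sym[of u w] sym[of v w] by simp

lemma add_both:
  "u \<in> V \<Longrightarrow> v \<in> V \<Longrightarrow>
    F (\<lambda>x. u x + c * v x) (\<lambda>x. u x + c * v x) = F u u + 2 * c * F u v + c\<^sup>2 * F v v"
  by (simp add: add_left add_right lin sym[of v u] algebra_simps power2_eq_square)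

lemma cauchy_schwarz:
  assumes "\<And>v. v \<in> V \<Longrightarrow> 0 \<le> F v v" "u \<in> V" "v \<in> V"
  shows "(F u v)\<^sup>2 \<le> F u u * F v v"
proof (rule discriminant_le)
  fix t
  show "0 \<le> F u u + 2 * t * F u v + t\<^sup>2 * F v v"
    using assms(1)[OF lin[OF assms(2,3), of t]] add_both[OF assms(2,3), of t] by simp
qed

lemma cauchy_schwarz_sqrt:
  assumes "\<And>v. v \<in> V \<Longrightarrow> 0 \<le> F v v" "u \<in> V" "v \<in> V"
  shows "\<bar>F u v\<bar> \<le> sqrt (F u u) * sqrt (F v v)"
  using real_sqrt_le_mono[OF cauchy_schwarz[OF assms]] by (simp add: real_sqrt_mult)

text \<open>Cauchy-Schwarz for a semidefinite form: F(u,u) = 0 puts u into the kernel of F. For F =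
  energy - \<mu> * mass this is the Euler-Lagrange equation of a minimiser, obtained without
  differentiating the Rayleigh quotient.\<close>

lemma minimizer_stationary:
  assumes "\<And>v. v \<in> V \<Longrightarrow> 0 \<le> F v v" "u \<in> V" "F u u = 0" "v \<in> V"
  shows "F u v = 0"
  using cauchy_schwarz[of u v] assms by auto

end

lemma sym_form_plus:
  assumes "sym_form V F" "sym_form V G"
  shows "sym_form V (\<lambda>u v. F u v + c * G u v)"
proof -
  interpret F: sym_form V F by fact
  interpret G: sym_form V G by fact
  show ?thesis
  proof
    show "(\<lambda>x. u x + c * v x) \<in> V" if "u \<in> V" "v \<in> V" for u v c
      using that by (rule F.lin)
    show "F u v + c * G u v = F v u + c * G v u" if "u \<in> V" "v \<in> V" for u v
      using that by (simp add: F.sym G.sym)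
    show "F (\<lambda>x. u x + d * v x) w + c * G (\<lambda>x. u x + d * v x) w
        = F u w + c * G u w + d * (F v w + c * G v w)"
      if "u \<in> V" "v \<in> V" "w \<in> V" for u v w d
      using that by (simp add: F.add_left G.add_left algebra_simps)
  qed
qed

text \<open>An a priori bound for D(u1,u1). With kappa = 1 - \<nu> / \<gamma>, the gap gives kappa *
  D(u1,u1) \<le> - b(u0,u1), while Cauchy-Schwarz and b \<le> D give b(u0,u1)^2 \<le> \<nu> *
  D(u1,u1).\<close>

definition corrector_bound :: "real \<Rightarrow> real \<Rightarrow> real" where
  "corrector_bound \<nu> \<gamma> = \<nu> / (1 - \<nu> / \<gamma>)\<^sup>2"

definition upper_const :: "real \<Rightarrow> real \<Rightarrow> real" where
  "upper_const \<nu> \<gamma> = corrector_bound \<nu> \<gamma> + corrector_bound \<nu> \<gamma> * corrector_bound \<nu> \<gamma> / \<gamma>"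

text \<open>The residual of the approximate eigenfunction, as a functional on functions w orthogonal
  to u0, is at most \<epsilon>^2 times this number times sqrt(D(w,w)). The summand 1 stems from
  b(u1,w), the other one from the mass term.\<close>

definition residual_bound :: "real \<Rightarrow> real \<Rightarrow> real" where
  "residual_bound \<nu> \<gamma> = sqrt (corrector_bound \<nu> \<gamma>) * (1 + (\<nu> + corrector_bound \<nu> \<gamma>) / \<gamma>)"

text \<open>The first summand pays for the negative part of the shifted form at the approximate
  eigenfunction, the second for the cross term after completing the square.\<close>

definition lower_const :: "real \<Rightarrow> real \<Rightarrow> real" where
  "lower_const \<nu> \<gamma> =
     corrector_bound \<nu> \<gamma> * \<nu> / \<gamma> + 2 * (residual_bound \<nu> \<gamma>)\<^sup>2 / (1 - \<nu> / \<gamma>)"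

text \<open>The second entry of the minimum gives \<epsilon> * b(u0,u0) \<le> (\<gamma> - \<nu>) /
  2, so that the truncated expansion stays below the midpoint of \<nu> and \<gamma> and half of the
  gap is left. The entry 1 lets \<epsilon>^4 be absorbed into \<epsilon>^3.\<close>

definition contrast_bound :: "real \<Rightarrow> real \<Rightarrow> real" where
  "contrast_bound \<nu> \<gamma> = min 1 ((\<gamma> - \<nu>) / (2 * \<nu>))"

lemma corrector_bound_pos: "0 < \<nu> \<Longrightarrow> \<nu> < \<gamma> \<Longrightarrow> 0 < corrector_bound \<nu> \<gamma>"
  by (simp add: corrector_bound_def)

lemma upper_const_pos: "0 < \<nu> \<Longrightarrow> \<nu> < \<gamma> \<Longrightarrow> 0 < upper_const \<nu> \<gamma>"
  by (simp add: upper_const_def corrector_bound_pos add_pos_pos)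

lemma lower_const_nonneg: "0 < \<nu> \<Longrightarrow> \<nu> < \<gamma> \<Longrightarrow> 0 \<le> lower_const \<nu> \<gamma>"
  using corrector_bound_pos[of \<nu> \<gamma>] by (simp add: lower_const_def)

lemma contrast_bound_pos: "0 < \<nu> \<Longrightarrow> \<nu> < \<gamma> \<Longrightarrow> 0 < contrast_bound \<nu> \<gamma>"
  by (simp add: contrast_bound_def)

text \<open>The form of the perturbed problem is shifted by the truncated expansion, so that the
  error to be bounded is the minimum of a single Rayleigh quotient. The upper bound tests
  \<open>le\<close> with the approximate eigenfunction; the lower bound decomposes the minimiser
  supplied by \<open>ex\<close>. Both constants are functions of \<open>\<nu>0\<close> and \<gamma>
  alone.\<close>

lemma simple_eigenvalue_expansion:
  fixes \<nu>0 \<gamma> \<epsilon> \<mu> :: real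
  assumes \<nu>0: "0 < \<nu>0" "\<nu>0 < \<gamma>"
    and fD: "sym_form V D" and fb: "sym_form V b" and fm: "sym_form V m"
    and m0: "\<And>v. v \<in> V \<Longrightarrow> 0 \<le> m v v" and b0: "\<And>v. v \<in> V \<Longrightarrow> 0 \<le> b v v"
    and bD: "\<And>v. v \<in> V \<Longrightarrow> b v v \<le> D v v"
    and u0: "u0 \<in> V" "m u0 u0 = 1" and eq0: "\<And>v. v \<in> V \<Longrightarrow> D u0 v = \<nu>0 * m u0 v"
    and gap: "\<And>w. w \<in> V \<Longrightarrow> m w u0 = 0 \<Longrightarrow> \<gamma> * m w w \<le> D w w"
    and u1: "u1 \<in> V" "m u0 u1 = 0"
    and eq1: "\<And>v. v \<in> V \<Longrightarrow> D u1 v - \<nu>0 * m u1 v = - b u0 v + b u0 u0 * m u0 v"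
    and \<epsilon>: "0 < \<epsilon>" "\<epsilon> < contrast_bound \<nu>0 \<gamma>"
    and le: "\<And>v. v \<in> V \<Longrightarrow> \<mu> * m v v \<le> D v v + \<epsilon> * b v v"
    and ex: "\<exists>v\<in>V. m v v > 0 \<and> D v v + \<epsilon> * b v v = \<mu> * m v v"
  shows "\<bar>\<mu> - (\<nu>0 + \<epsilon> * b u0 u0 + \<epsilon>\<^sup>2 * b u0 u1)\<bar> \<le> (upper_const \<nu>0 \<gamma> + lower_const \<nu>0 \<gamma>) * \<epsilon> ^ 3"
proof -
  define \<kappa> where "\<kappa> = 1 - \<nu>0 / \<gamma>"
  define K where "K = corrector_bound \<nu>0 \<gamma>"
  define S where "S = residual_bound \<nu>0 \<gamma>"
  define C1 where "C1 = upper_const \<nu>0 \<gamma>"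
  define C2 where "C2 = lower_const \<nu>0 \<gamma>"
  have \<gamma>: "\<gamma> > 0" using \<nu>0 by simp
  have \<kappa>: "\<kappa> > 0" using \<nu>0 \<gamma> by (simp add: \<kappa>_def)
  have K: "K > 0" using \<nu>0 by (simp add: K_def corrector_bound_pos)
  have K_eq: "K = \<nu>0 / \<kappa>\<^sup>2" by (simp add: K_def \<kappa>_def corrector_bound_def)
  have S_eq: "S = sqrt K * (1 + (\<nu>0 + K) / \<gamma>)" by (simp add: S_def K_def residual_bound_def)
  have C1: "C1 > 0" using \<nu>0 by (simp add: C1_def upper_const_pos)
  have C1_eq: "C1 = K + K * K / \<gamma>" by (simp add: C1_def K_def upper_const_def)
  have C2: "C2 \<ge> 0" using \<nu>0 by (simp add: C2_def lower_const_nonneg)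
  have C2_eq: "C2 = K * \<nu>0 / \<gamma> + 2 * S\<^sup>2 / \<kappa>" by (simp add: C2_def K_def S_def \<kappa>_def lower_const_def)
  interpret D: sym_form V D by fact
  interpret b: sym_form V b by fact
  interpret m: sym_form V m by fact
  have D0: "\<And>v. v \<in> V \<Longrightarrow> 0 \<le> D v v" using b0 bD order_trans by blast
  define \<nu>1 where "\<nu>1 = b u0 u0"
  define \<nu>2 where "\<nu>2 = b u0 u1"
  define \<Lambda> where "\<Lambda> = \<nu>0 + \<epsilon> * \<nu>1 + \<epsilon>\<^sup>2 * \<nu>2"
  define n where "n = m u1 u1"
  define d1 where "d1 = D u1 u1"
  define \<beta> where "\<beta> = b u1 u1"
  have mu10: "m u1 u0 = 0" using u0 u1 m.sym by auto
  have n0: "n \<ge> 0" and \<beta>0: "\<beta> \<ge> 0" and \<beta>d: "\<beta> \<le> d1" and d0: "d1 \<ge> 0"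
    and gn: "\<gamma> * n \<le> d1"
    using m0 b0 bD D0 gap u1 mu10 by (auto simp: n_def \<beta>_def d1_def)
  have l1: "\<nu>1 \<ge> 0" "\<nu>1 \<le> \<nu>0" using b0 bD[OF u0(1)] eq0[OF u0(1)] u0 by (auto simp: \<nu>1_def)
  \<comment> \<open>The corrector equation tested with u1; the last term drops because u1 is
    orthogonal to u0.\<close>
  have l2: "\<nu>2 = - (d1 - \<nu>0 * n)"
    using eq1[OF u1(1)] u1 by (simp add: \<nu>2_def d1_def n_def)
  have "\<nu>0 * n = (\<nu>0 / \<gamma>) * (\<gamma> * n)" using \<gamma> by simp
  also have "\<dots> \<le> (\<nu>0 / \<gamma>) * d1" using gn \<nu>0 by (intro mult_left_mono) auto
  finally have \<kappa>d: "\<kappa> * d1 \<le> - \<nu>2" by (simp add: l2 \<kappa>_def algebra_simps)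
  have l2neg: "\<nu>2 \<le> 0" using \<kappa>d \<kappa> d0 by (smt (verit) mult_nonneg_nonneg)
  have "\<nu>2\<^sup>2 \<le> \<nu>1 * \<beta>" unfolding \<nu>2_def \<nu>1_def \<beta>_def
    using b.cauchy_schwarz[OF b0] u0 u1 by auto
  also have "\<dots> \<le> \<nu>0 * d1" using l1 \<beta>0 \<beta>d \<nu>0 by (intro mult_mono) auto
  finally have "\<nu>2\<^sup>2 \<le> \<nu>0 * d1" .
  moreover have "(\<kappa> * d1)\<^sup>2 \<le> \<nu>2\<^sup>2"
    using \<kappa>d \<kappa> d0 power_mono[of "\<kappa> * d1" "- \<nu>2" 2] by simp
  ultimately have "\<kappa>\<^sup>2 * d1 * d1 \<le> \<nu>0 * d1" by (simp add: power2_eq_square algebra_simps)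
  then have "\<kappa>\<^sup>2 * d1 \<le> \<nu>0" using d0 \<nu>0(1) by (cases "d1 = 0") auto
  then have d1K: "d1 \<le> K" using \<kappa> by (simp add: K_eq field_simps)
  have nK: "n \<le> K / \<gamma>" using gn d1K \<gamma> by (simp add: field_simps)
  have l2K: "- \<nu>2 \<le> K" using l2 d1K n0 \<nu>0(1) by (smt (verit) mult_nonneg_nonneg)
  have e1: "\<epsilon> \<le> 1" using \<epsilon> by (simp add: contrast_bound_def)
  \<comment> \<open>The second-order coefficient is nonpositive, so only the first-order term can
    push the expansion towards \<gamma>.\<close>
  have \<Lambda>le: "\<Lambda> \<le> (\<gamma> + \<nu>0) / 2"
  proof -
    have "\<epsilon> * \<nu>1 \<le> (\<gamma> - \<nu>0) / (2 * \<nu>0) * \<nu>0"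
      using \<epsilon> l1 \<nu>0 by (intro mult_mono) (auto simp: contrast_bound_def)
    also have "\<dots> = (\<gamma> - \<nu>0) / 2" using \<nu>0 by (simp add: field_simps)
    finally have "\<epsilon> * \<nu>1 \<le> (\<gamma> - \<nu>0) / 2" .
    moreover have "\<epsilon>\<^sup>2 * \<nu>2 \<le> 0" using l2neg by (intro mult_nonneg_nonpos) auto
    ultimately show ?thesis unfolding \<Lambda>_def by argo
  qed
  define \<psi> where "\<psi> = (\<lambda>x. u0 x + \<epsilon> * u1 x)"
  have \<psi>: "\<psi> \<in> V" using D.lin u0 u1 by (simp add: \<psi>_def)
  \<comment> \<open>In terms of this form the claim is a two-sided bound for the minimum of Q(v,v) /
    m(v,v), which equals \<mu> - \<Lambda>.\<close>
  define Q where "Q = (\<lambda>u v. (D u v + \<epsilon> * b u v) + (- \<Lambda>) * m u v)"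
  interpret Q: sym_form V Q
    unfolding Q_def by (rule sym_form_plus[OF sym_form_plus[OF fD fb] fm])
  have m\<psi>: "m \<psi> \<psi> = 1 + \<epsilon>\<^sup>2 * n"
    unfolding \<psi>_def using u0 u1 by (simp add: m.add_both n_def)
  have D\<psi>: "D \<psi> \<psi> = \<nu>0 + \<epsilon>\<^sup>2 * d1"
    unfolding \<psi>_def using u0 u1 eq0[OF u0(1)] eq0[OF u1(1)] by (simp add: D.add_both d1_def)
  have b\<psi>: "b \<psi> \<psi> = \<nu>1 + 2 * \<epsilon> * \<nu>2 + \<epsilon>\<^sup>2 * \<beta>"
    unfolding \<psi>_def using u0 u1 by (simp add: b.add_both \<nu>1_def \<nu>2_def \<beta>_def)
  \<comment> \<open>Orders 0 and 1 cancel by the choice of \<Lambda>. The coefficient of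
    \<epsilon>^2 is d1 + 2 * \<nu>2 - \<nu>2 - \<nu>0 * n, which vanishes by
    \<open>l2\<close>.\<close>
  have Q\<psi>: "Q \<psi> \<psi> = \<epsilon> ^ 3 * (\<beta> - n * \<nu>1 - \<epsilon> * \<nu>2 * n)"
    unfolding Q_def m\<psi> D\<psi> b\<psi> \<Lambda>_def l2 by (simp add: algebra_simps power2_eq_square power3_eq_cube)
  have upper: "\<mu> - \<Lambda> \<le> C1 * \<epsilon> ^ 3"
  proof -
    have "(\<mu> - \<Lambda>) * (1 + \<epsilon>\<^sup>2 * n) \<le> Q \<psi> \<psi>"
      using le[OF \<psi>] m\<psi> by (simp add: Q_def algebra_simps)
    also have "\<dots> \<le> \<epsilon> ^ 3 * C1"
    proof -
      have "\<epsilon> * (- \<nu>2) * n \<le> 1 * K * (K / \<gamma>)"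
        using \<epsilon> e1 l2K l2neg n0 nK K \<gamma> by (intro mult_mono) auto
      moreover have "\<beta> \<le> K" using \<beta>d d1K by simp
      moreover have "n * \<nu>1 \<ge> 0" using n0 l1 by simp
      ultimately have "\<beta> - n * \<nu>1 - \<epsilon> * \<nu>2 * n \<le> C1" by (simp add: C1_eq)
      then show ?thesis unfolding Q\<psi> using \<epsilon> by (intro mult_left_mono) auto
    qed
    finally have *: "(\<mu> - \<Lambda>) * (1 + \<epsilon>\<^sup>2 * n) \<le> \<epsilon> ^ 3 * C1" .
    show ?thesis
    \<comment> \<open>The factor m(\<psi>,\<psi>) \<ge> 1 may be dropped only where \<mu> -
      \<Lambda> is positive; otherwise there is nothing to show.\<close>
    proof (cases "\<mu> - \<Lambda> \<le> 0")
      case True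
      moreover have "0 \<le> C1 * \<epsilon> ^ 3" using C1 \<epsilon> by simp
      ultimately show ?thesis by linarith
    next
      case False
      then have "(\<mu> - \<Lambda>) * 1 \<le> (\<mu> - \<Lambda>) * (1 + \<epsilon>\<^sup>2 * n)"
        using n0 by (intro mult_left_mono) auto
      with * show ?thesis by (simp add: mult.commute)
    qed
  qed
  have lower: "- (C2 * \<epsilon> ^ 3) \<le> \<mu> - \<Lambda>"
  proof -
    obtain v where v: "v \<in> V" "m v v > 0" "D v v + \<epsilon> * b v v = \<mu> * m v v" using ex by blast
    \<comment> \<open>Since m(\<psi>,u0) = 1, this coefficient makes v - t \<psi> orthogonal to u0,
      although it is \<psi> and not u0 that is subtracted. The gap then applies to the
      remainder.\<close>
    define t where "t = m v u0"
    define w where "w = (\<lambda>x. v x + (- t) * \<psi> x)"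
    have w: "w \<in> V" unfolding w_def using D.lin v \<psi> by blast
    have m\<psi>0: "m \<psi> u0 = 1"
      unfolding \<psi>_def using u0 u1 mu10 by (simp add: m.add_left)
    have mw: "m w u0 = 0" unfolding w_def m.add_left[OF v(1) \<psi> u0(1)] by (simp add: t_def m\<psi>0)
    have mw': "m u0 w = 0" using mw m.sym w u0 by simp
    have veq: "v = (\<lambda>x. w x + t * \<psi> x)" by (simp add: w_def)
    define d where "d = sqrt (D w w)"
    have dd: "d\<^sup>2 = D w w" "d \<ge> 0" using D0[OF w] by (auto simp: d_def)
    have mwd: "\<gamma> * m w w \<le> D w w" using gap w mw by blast
    \<comment> \<open>\<Lambda> lies below the midpoint of the gap, so half of the relative gap
      survives as coercivity with respect to the Dirichlet form.\<close>
    have Qw: "\<kappa> / 2 * d\<^sup>2 \<le> Q w w"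
    proof -
      have "\<Lambda> * m w w \<le> (\<gamma> + \<nu>0) / 2 * m w w" using \<Lambda>le m0[OF w] by (rule mult_right_mono)
      also have "\<dots> = (\<gamma> + \<nu>0) / (2 * \<gamma>) * (\<gamma> * m w w)" using \<gamma> by simp
      also have "\<dots> \<le> (\<gamma> + \<nu>0) / (2 * \<gamma>) * d\<^sup>2"
        using mwd dd \<nu>0 \<gamma> by (intro mult_left_mono) auto
      also have "\<dots> = (1 - \<kappa> / 2) * d\<^sup>2" using \<gamma> by (simp add: \<kappa>_def field_simps)
      finally have "\<Lambda> * m w w \<le> (1 - \<kappa> / 2) * d\<^sup>2" .
      moreover have "0 \<le> \<epsilon> * b w w" using b0[OF w] \<epsilon> by simp
      ultimately show ?thesis using dd by (simp add: Q_def algebra_simps)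
    qed
    \<comment> \<open>The equations of u0 and u1 remove the terms of order 0 and 1; the mass of u0
      against w is zero. What remains is the second-order residual.\<close>
    have R: "Q w \<psi> = \<epsilon>\<^sup>2 * (b u1 w - (\<nu>1 + \<epsilon> * \<nu>2) * m u1 w)"
    proof -
      have "Q w \<psi> = Q \<psi> w" using Q.sym w \<psi> by blast
      moreover have "D \<psi> w = \<epsilon> * (\<nu>0 * m u1 w - b u0 w)"
        unfolding \<psi>_def using u0 u1 w eq0[OF w] eq1[OF w] mw' by (simp add: D.add_left)
      moreover have "b \<psi> w = b u0 w + \<epsilon> * b u1 w" "m \<psi> w = \<epsilon> * m u1 w"
        unfolding \<psi>_def using u0 u1 w mw' by (simp_all add: b.add_left m.add_left)
      ultimately show ?thesis
        by (simp add: Q_def \<Lambda>_def algebra_simps power2_eq_square)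
    qed
    have Rle: "\<bar>Q w \<psi>\<bar> \<le> \<epsilon>\<^sup>2 * (S * d)"
    proof -
      have "\<bar>b u1 w\<bar> \<le> sqrt \<beta> * sqrt (b w w)"
        unfolding \<beta>_def using b.cauchy_schwarz_sqrt[OF b0] u1 w by auto
      also have "\<dots> \<le> sqrt K * d"
        unfolding d_def using \<beta>d d1K bD[OF w] b0[OF w] K by (intro mult_mono) auto
      finally have 1: "\<bar>b u1 w\<bar> \<le> sqrt K * d" .
      have "\<bar>m u1 w\<bar> \<le> sqrt n * sqrt (m w w)"
        unfolding n_def using m.cauchy_schwarz_sqrt[OF m0] u1 w by auto
      also have "\<dots> \<le> sqrt (K / \<gamma>) * sqrt (D w w / \<gamma>)"
        using nK mwd \<gamma> m0[OF w] K by (intro mult_mono) (auto simp: field_simps)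
      also have "\<dots> = sqrt K * d / \<gamma>" using \<gamma> by (simp add: d_def real_sqrt_divide)
      finally have 2: "\<bar>m u1 w\<bar> \<le> sqrt K * d / \<gamma>" .
      have "\<bar>\<nu>1 + \<epsilon> * \<nu>2\<bar> \<le> \<nu>1 + \<epsilon> * (- \<nu>2)"
        using l1 l2neg \<epsilon> by (auto simp: abs_le_iff mult_nonneg_nonpos)
      also have "\<dots> \<le> \<nu>0 + 1 * K" using l1 l2K e1 \<epsilon> K l2neg
        by (intro add_mono mult_mono) auto
      finally have 3: "\<bar>\<nu>1 + \<epsilon> * \<nu>2\<bar> \<le> \<nu>0 + K" by simp
      have "\<bar>(\<nu>1 + \<epsilon> * \<nu>2) * m u1 w\<bar> \<le> (\<nu>0 + K) * (sqrt K * d / \<gamma>)"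
        unfolding abs_mult using 2 3 \<nu>0(1) K by (intro mult_mono) auto
      with 1 have "\<bar>b u1 w - (\<nu>1 + \<epsilon> * \<nu>2) * m u1 w\<bar>
          \<le> sqrt K * d + (\<nu>0 + K) * (sqrt K * d / \<gamma>)"
        by linarith
      also have "\<dots> = S * d" by (simp add: S_eq algebra_simps)
      finally show ?thesis unfolding R by (simp add: abs_mult mult_left_mono)
    qed
    have Qv: "Q v v = Q w w + 2 * t * Q w \<psi> + t\<^sup>2 * Q \<psi> \<psi>"
      by (subst (1 2) veq) (rule Q.add_both[OF w \<psi>])
    have "- (\<epsilon> ^ 3 * (K * \<nu>0 / \<gamma>)) \<le> Q \<psi> \<psi>"
    proof -
      have "n * \<nu>1 \<le> K / \<gamma> * \<nu>0" using nK l1 n0 K \<gamma> by (intro mult_mono) auto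
      moreover have "\<epsilon> * \<nu>2 * n \<le> 0" using \<epsilon> l2neg n0
        by (simp add: mult_nonneg_nonpos mult_nonpos_nonneg)
      ultimately have "- (K * \<nu>0 / \<gamma>) \<le> \<beta> - n * \<nu>1 - \<epsilon> * \<nu>2 * n" using \<beta>0 by simp
      then have "\<epsilon> ^ 3 * - (K * \<nu>0 / \<gamma>) \<le> Q \<psi> \<psi>"
        unfolding Q\<psi> using \<epsilon> by (intro mult_left_mono) auto
      then show ?thesis by simp
    qed
    then have i1: "- (t\<^sup>2 * (\<epsilon> ^ 3 * (K * \<nu>0 / \<gamma>))) \<le> t\<^sup>2 * Q \<psi> \<psi>"
      using mult_left_mono[of "- (\<epsilon> ^ 3 * (K * \<nu>0 / \<gamma>))" "Q \<psi> \<psi>" "t\<^sup>2"] by simp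
    have i2: "- (2 * (\<bar>t\<bar> * (\<epsilon>\<^sup>2 * (S * d)))) \<le> 2 * t * Q w \<psi>"
    proof -
      have "\<bar>t * Q w \<psi>\<bar> \<le> \<bar>t\<bar> * (\<epsilon>\<^sup>2 * (S * d))" unfolding abs_mult
        using Rle by (intro mult_left_mono) auto
      then show ?thesis by linarith
    qed
    \<comment> \<open>Completing the square: the cross term is absorbed by the coercive term, at the
      price of a multiple of t squared of order \<epsilon>^4.\<close>
    have "0 \<le> (\<kappa> * d - 2 * \<bar>t\<bar> * \<epsilon>\<^sup>2 * S)\<^sup>2 / (2 * \<kappa>)" using \<kappa> by simp
    also have "\<dots> = \<kappa> / 2 * d\<^sup>2 - 2 * (\<bar>t\<bar> * (\<epsilon>\<^sup>2 * (S * d))) + t\<^sup>2 * (\<epsilon> ^ 4 * (2 * S\<^sup>2 / \<kappa>))"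
      using \<kappa> by (simp add: power2_diff power_mult_distrib power2_eq_square power4_eq_xxxx field_simps)
    finally have i3: "0 \<le> \<kappa> / 2 * d\<^sup>2 - 2 * (\<bar>t\<bar> * (\<epsilon>\<^sup>2 * (S * d))) + t\<^sup>2 * (\<epsilon> ^ 4 * (2 * S\<^sup>2 / \<kappa>))" .
    have "\<epsilon> ^ 4 \<le> \<epsilon> ^ 3" using \<epsilon> e1 by (intro power_decreasing) auto
    then have i4: "t\<^sup>2 * (\<epsilon> ^ 4 * (2 * S\<^sup>2 / \<kappa>)) \<le> t\<^sup>2 * (\<epsilon> ^ 3 * (2 * S\<^sup>2 / \<kappa>))"
      using \<kappa> by (intro mult_left_mono mult_right_mono) auto
    have "t\<^sup>2 * (C2 * \<epsilon> ^ 3) = t\<^sup>2 * (\<epsilon> ^ 3 * (K * \<nu>0 / \<gamma>)) + t\<^sup>2 * (\<epsilon> ^ 3 * (2 * S\<^sup>2 / \<kappa>))"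
      unfolding C2_eq by (simp only: distrib_left distrib_right mult_ac)
    with i1 i2 i3 i4 Qw Qv have "- (t\<^sup>2 * (C2 * \<epsilon> ^ 3)) \<le> Q v v"
      by linarith
    \<comment> \<open>As m(u0,u0) = 1, Cauchy-Schwarz bounds t by the norm of v. This turns the
      error proportional to t squared into one proportional to m(v,v), which is then divided
      out.\<close>
    moreover have "t\<^sup>2 \<le> m v v"
      using m.cauchy_schwarz[OF m0 v(1) u0(1)] u0 by (simp add: t_def)
    then have "t\<^sup>2 * (C2 * \<epsilon> ^ 3) \<le> m v v * (C2 * \<epsilon> ^ 3)"
      using C2 \<epsilon> by (intro mult_right_mono) auto
    moreover have "Q v v = (\<mu> - \<Lambda>) * m v v" using v by (simp add: Q_def algebra_simps)
    ultimately have "- (C2 * \<epsilon> ^ 3) * m v v \<le> (\<mu> - \<Lambda>) * m v v" by (simp add: mult.commute)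
    then show ?thesis using v(2) by (simp only: mult_le_cancel_right_pos)
  qed
  have "0 \<le> C1 * \<epsilon> ^ 3" "0 \<le> C2 * \<epsilon> ^ 3" using C1 C2 \<epsilon> by auto
  with upper lower have "\<bar>\<mu> - \<Lambda>\<bar> \<le> (C1 + C2) * \<epsilon> ^ 3"
    unfolding distrib_right by linarith
  then show ?thesis
    unfolding \<Lambda>_def \<nu>1_def \<nu>2_def C1_def C2_def .
qed

subsection \<open>Square-integrable functions\<close>

text \<open>Stated for an arbitrary measure because two are used side by side: Lebesgue measure
  restricted to the domain for Sobolev functions, and \<open>lborel\<close> wherever functions are
  translated.\<close>

definition sq_int :: "'a measure \<Rightarrow> ('a \<Rightarrow> 'b::euclidean_space) set" where
  "sq_int M = {f \<in> borel_measurable M. integrable M (\<lambda>x. (norm (f x))\<^sup>2)}"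

definition L2norm :: "'a measure \<Rightarrow> ('a \<Rightarrow> 'b::euclidean_space) \<Rightarrow> real" where
  "L2norm M f = sqrt (LINT x|M. (norm (f x))\<^sup>2)"

lemma sq_int_measurable [measurable_dest]: "f \<in> sq_int M \<Longrightarrow> f \<in> borel_measurable M"
  by (simp add: sq_int_def)

lemma sq_int_integrable: "f \<in> sq_int M \<Longrightarrow> integrable M (\<lambda>x. (norm (f x))\<^sup>2)"
  by (simp add: sq_int_def)

lemma L2norm_nonneg [simp]: "0 \<le> L2norm M f"
  by (simp add: L2norm_def)

lemma L2norm_power2: "(L2norm M f)\<^sup>2 = (LINT x|M. (norm (f x))\<^sup>2)"
  by (simp add: L2norm_def)

lemma sq_int_bound:
  assumes "g \<in> sq_int M" "f \<in> borel_measurable M" "AE x in M. norm (f x) \<le> norm (g x)"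
  shows "f \<in> sq_int M"
proof -
  have "integrable M (\<lambda>x. (norm (f x))\<^sup>2)"
  proof (rule Bochner_Integration.integrable_bound[OF sq_int_integrable[OF assms(1)]])
    show "AE x in M. norm ((norm (f x))\<^sup>2) \<le> norm ((norm (g x))\<^sup>2)"
      using assms(3) by eventually_elim simp
  qed (use assms(2) in measurable)
  with assms show ?thesis by (simp add: sq_int_def)
qed

lemma integrable_norm_mult:
  assumes "f \<in> sq_int M" "g \<in> sq_int M"
  shows "integrable M (\<lambda>x. norm (f x) * norm (g x))"
proof (rule Bochner_Integration.integrable_bound)
  show "integrable M (\<lambda>x. (norm (f x))\<^sup>2 + (norm (g x))\<^sup>2)"
    using assms by (simp add: sq_int_integrable)
  show "AE x in M. norm (norm (f x) * norm (g x)) \<le> norm ((norm (f x))\<^sup>2 + (norm (g x))\<^sup>2)"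
  proof (rule AE_I2)
    fix x
    have "2 * (norm (f x) * norm (g x)) \<le> (norm (f x))\<^sup>2 + (norm (g x))\<^sup>2"
      using sum_squares_bound[of "norm (f x)" "norm (g x)"] by (simp add: mult.assoc)
    moreover have "0 \<le> norm (f x) * norm (g x)" by simp
    ultimately show "norm (norm (f x) * norm (g x)) \<le> norm ((norm (f x))\<^sup>2 + (norm (g x))\<^sup>2)"
      unfolding real_norm_def by linarith
  qed
qed (use assms in measurable)

lemma integrable_inner:
  assumes "f \<in> sq_int M" "g \<in> sq_int M"
  shows "integrable M (\<lambda>x. f x \<bullet> g x)"
  by (rule Bochner_Integration.integrable_bound[OF integrable_norm_mult[OF assms]])
    (use assms in \<open>auto intro!: Cauchy_Schwarz_ineq2 borel_measurable_inner simp: sq_int_def abs_mult\<close>)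

lemma integrable_scaleR_sq:
  assumes "f \<in> sq_int M" "g \<in> sq_int M"
  shows "integrable M (\<lambda>x. f x *\<^sub>R g x)"
  by (rule Bochner_Integration.integrable_bound[OF integrable_norm_mult[OF assms]])
    (use assms in \<open>auto intro!: borel_measurable_scaleR simp: sq_int_def abs_mult\<close>)

lemma integrable_mult_sq:
  fixes f g :: "'a \<Rightarrow> real"
  assumes "f \<in> sq_int M" "g \<in> sq_int M"
  shows "integrable M (\<lambda>x. f x * g x)"
  using integrable_inner[OF assms] by simp

lemma sq_int_add:
  assumes "f \<in> sq_int M" "g \<in> sq_int M"
  shows "(\<lambda>x. f x + g x) \<in> sq_int M"
proof -
  have "integrable M (\<lambda>x. (norm (f x + g x))\<^sup>2)"
  proof (rule Bochner_Integration.integrable_bound)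
    show "integrable M (\<lambda>x. (norm (f x))\<^sup>2 + (norm (g x))\<^sup>2 + 2 * (f x \<bullet> g x))"
      using assms by (intro Bochner_Integration.integrable_add integrable_mult_right)
        (simp_all add: sq_int_integrable integrable_inner)
    show "AE x in M. norm ((norm (f x + g x))\<^sup>2)
        \<le> norm ((norm (f x))\<^sup>2 + (norm (g x))\<^sup>2 + 2 * (f x \<bullet> g x))"
      by (rule AE_I2) (simp add: power2_norm_eq_inner inner_add_left inner_add_right inner_commute)
  qed (use assms in measurable)
  then show ?thesis using assms by (auto simp: sq_int_def)
qed

lemma sq_int_bounded_scaleR:
  assumes "f \<in> sq_int M" "a \<in> borel_measurable M" "AE x in M. \<bar>a x\<bar> \<le> C"
  shows "(\<lambda>x. a x *\<^sub>R f x) \<in> sq_int M"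
proof (rule sq_int_bound)
  show "(\<lambda>x. C *\<^sub>R f x) \<in> sq_int M"
    using assms(1) by (auto simp: sq_int_def power_mult_distrib)
  show "AE x in M. norm (a x *\<^sub>R f x) \<le> norm (C *\<^sub>R f x)"
    using assms(3)
  proof eventually_elim
    case (elim x)
    then have "\<bar>a x\<bar> * norm (f x) \<le> \<bar>C\<bar> * norm (f x)" by (intro mult_right_mono) auto
    then show ?case by simp
  qed
qed (use assms in measurable)

lemma sq_int_scaleR: "f \<in> sq_int M \<Longrightarrow> (\<lambda>x. c *\<^sub>R f x) \<in> sq_int M"
  by (auto simp: sq_int_def power_mult_distrib)

lemma sq_int_mult:
  fixes f :: "'a \<Rightarrow> real"
  shows "f \<in> sq_int M \<Longrightarrow> (\<lambda>x. c * f x) \<in> sq_int M"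
  using sq_int_scaleR[of f M c] by simp

lemma sq_int_uminus: "f \<in> sq_int M \<Longrightarrow> (\<lambda>x. - f x) \<in> sq_int M"
  by (simp add: sq_int_def)

lemma sq_int_diff: "f \<in> sq_int M \<Longrightarrow> g \<in> sq_int M \<Longrightarrow> (\<lambda>x. f x - g x) \<in> sq_int M"
  using sq_int_add[of f M "\<lambda>x. - g x"] sq_int_uminus[of g M] by simp

lemma sq_int_zero [simp]: "(\<lambda>x. 0) \<in> sq_int M"
  by (simp add: sq_int_def)

lemma L2norm_minus_commute: "L2norm M (\<lambda>x. f x - g x) = L2norm M (\<lambda>x. g x - f x)"
  by (simp add: L2norm_def norm_minus_commute)

lemma L2norm_scaleR: "L2norm M (\<lambda>x. c *\<^sub>R f x) = \<bar>c\<bar> * L2norm M f"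
  by (simp add: L2norm_def power_mult_distrib real_sqrt_mult)

lemma L2norm_cong_AE:
  assumes "f \<in> borel_measurable M" "g \<in> borel_measurable M" "AE x in M. f x = g x"
  shows "L2norm M f = L2norm M g"
  unfolding L2norm_def using assms by (intro arg_cong[where f=sqrt] integral_cong_AE) auto

lemma L2norm_mono:
  assumes "g \<in> sq_int M" "f \<in> borel_measurable M" "AE x in M. norm (f x) \<le> norm (g x)"
  shows "L2norm M f \<le> L2norm M g"
proof -
  have "AE x in M. (norm (f x))\<^sup>2 \<le> (norm (g x))\<^sup>2" using assms(3) by eventually_elim simp
  then show ?thesis unfolding L2norm_def
    using assms sq_int_bound[OF assms] by (intro real_sqrt_le_mono integral_mono_AE sq_int_integrable)
qed

lemma L2_Cauchy_Schwarz:
  assumes f: "f \<in> sq_int M" and g: "g \<in> sq_int M"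
  shows "\<bar>LINT x|M. f x \<bullet> g x\<bar> \<le> L2norm M f * L2norm M g"
proof -
  have "(LINT x|M. f x \<bullet> g x)\<^sup>2 \<le> (LINT x|M. (norm (f x))\<^sup>2) * (LINT x|M. (norm (g x))\<^sup>2)"
  proof (rule discriminant_le)
    fix t :: real
    have "0 \<le> (LINT x|M. (norm (f x + t *\<^sub>R g x))\<^sup>2)" by simp
    also have "(\<lambda>x. (norm (f x + t *\<^sub>R g x))\<^sup>2)
        = (\<lambda>x. (norm (f x))\<^sup>2 + 2 * t * (f x \<bullet> g x) + t\<^sup>2 * (norm (g x))\<^sup>2)"
      by (auto simp: power2_norm_eq_inner inner_add_left inner_add_right inner_commute
          power2_eq_square[of t] algebra_simps)
    also have "(LINT x|M. \<dots> x) = (LINT x|M. (norm (f x))\<^sup>2)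
        + 2 * t * (LINT x|M. f x \<bullet> g x) + t\<^sup>2 * (LINT x|M. (norm (g x))\<^sup>2)"
      using sq_int_integrable[OF f] sq_int_integrable[OF g] integrable_inner[OF f g] by simp
    finally show "0 \<le> (LINT x|M. (norm (f x))\<^sup>2)
        + 2 * t * (LINT x|M. f x \<bullet> g x) + t\<^sup>2 * (LINT x|M. (norm (g x))\<^sup>2)" .
  qed
  from real_sqrt_le_mono[OF this] show ?thesis
    by (simp add: L2norm_def real_sqrt_mult)
qed

lemma L2norm_triangle:
  assumes f: "f \<in> sq_int M" and g: "g \<in> sq_int M"
  shows "L2norm M (\<lambda>x. f x + g x) \<le> L2norm M f + L2norm M g"
proof (rule power2_le_imp_le)
  have "(\<lambda>x. (norm (f x + g x))\<^sup>2) = (\<lambda>x. (norm (f x))\<^sup>2 + 2 * (f x \<bullet> g x) + (norm (g x))\<^sup>2)"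
    by (auto simp: power2_norm_eq_inner inner_add_left inner_add_right inner_commute)
  then have "(L2norm M (\<lambda>x. f x + g x))\<^sup>2
      = (L2norm M f)\<^sup>2 + 2 * (LINT x|M. f x \<bullet> g x) + (L2norm M g)\<^sup>2"
    using sq_int_integrable[OF f] sq_int_integrable[OF g] integrable_inner[OF f g]
    by (simp add: L2norm_power2)
  also have "\<dots> \<le> (L2norm M f + L2norm M g)\<^sup>2"
    using L2_Cauchy_Schwarz[OF f g] by (simp add: power2_sum)
  finally show "(L2norm M (\<lambda>x. f x + g x))\<^sup>2 \<le> (L2norm M f + L2norm M g)\<^sup>2" .
qed simp

lemma L2norm_triangle_diff:
  assumes "f \<in> sq_int M" "g \<in> sq_int M" "h \<in> sq_int M"
  shows "L2norm M (\<lambda>x. f x - h x) \<le> L2norm M (\<lambda>x. f x - g x) + L2norm M (\<lambda>x. g x - h x)"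
  using L2norm_triangle[OF sq_int_diff[OF assms(1,2)] sq_int_diff[OF assms(2,3)]] by simp

lemma L2norm_diff_abs:
  assumes "f \<in> sq_int M" "g \<in> sq_int M"
  shows "\<bar>L2norm M f - L2norm M g\<bar> \<le> L2norm M (\<lambda>x. f x - g x)"
  using L2norm_triangle[OF sq_int_diff[OF assms] assms(2)]
    L2norm_triangle[OF sq_int_diff[OF assms(2,1)] assms(1)] L2norm_minus_commute[of M f g] by simp

section \<open>Convergence and completeness in L2\<close>

definition L2conv :: "'a measure \<Rightarrow> (nat \<Rightarrow> 'a \<Rightarrow> 'b::euclidean_space) \<Rightarrow> ('a \<Rightarrow> 'b) \<Rightarrow> bool" where
  "L2conv M F f \<longleftrightarrow> (\<forall>n. F n \<in> sq_int M) \<and> f \<in> sq_int M \<and> (\<lambda>n. L2norm M (\<lambda>x. F n x - f x)) \<longlonglongrightarrow> 0"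

lemma L2convD:
  assumes "L2conv M F f"
  shows "F n \<in> sq_int M" "f \<in> sq_int M" "(\<lambda>n. L2norm M (\<lambda>x. F n x - f x)) \<longlonglongrightarrow> 0"
  using assms by (auto simp: L2conv_def)

lemma L2conv_const: "f \<in> sq_int M \<Longrightarrow> L2conv M (\<lambda>_. f) f"
  by (simp add: L2conv_def L2norm_def)

lemma L2conv_subseq: "L2conv M F f \<Longrightarrow> strict_mono r \<Longrightarrow> L2conv M (\<lambda>n. F (r n)) f"
  unfolding L2conv_def using LIMSEQ_subseq_LIMSEQ[of "\<lambda>n. L2norm M (\<lambda>x. F n x - f x)" 0 r]
  by (auto simp: o_def)

lemma L2conv_add:
  assumes "L2conv M F f" "L2conv M G g"
  shows "L2conv M (\<lambda>n x. F n x + c *\<^sub>R G n x) (\<lambda>x. f x + c *\<^sub>R g x)"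
proof -
  note F = L2convD[OF assms(1)] and G = L2convD[OF assms(2)]
  have "(\<lambda>n. L2norm M (\<lambda>x. (F n x + c *\<^sub>R G n x) - (f x + c *\<^sub>R g x))) \<longlonglongrightarrow> 0"
  proof (rule tendsto_sandwich[OF _ _ tendsto_const])
    show "(\<lambda>n. L2norm M (\<lambda>x. F n x - f x) + \<bar>c\<bar> * L2norm M (\<lambda>x. G n x - g x)) \<longlonglongrightarrow> 0"
      using F(3) G(3) by (auto intro!: tendsto_eq_intros)
    have "L2norm M (\<lambda>x. (F n x + c *\<^sub>R G n x) - (f x + c *\<^sub>R g x))
        \<le> L2norm M (\<lambda>x. F n x - f x) + \<bar>c\<bar> * L2norm M (\<lambda>x. G n x - g x)" for n
      using L2norm_triangle[OF sq_int_diff[OF F(1) F(2)] sq_int_scaleR[OF sq_int_diff[OF G(1) G(2)]],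
          of n c n] unfolding L2norm_scaleR by (simp add: algebra_simps)
    then show "\<forall>\<^sub>F n in sequentially. L2norm M (\<lambda>x. (F n x + c *\<^sub>R G n x) - (f x + c *\<^sub>R g x))
        \<le> L2norm M (\<lambda>x. F n x - f x) + \<bar>c\<bar> * L2norm M (\<lambda>x. G n x - g x)" by simp
  qed simp
  with F G show ?thesis by (simp add: L2conv_def sq_int_add sq_int_scaleR)
qed

lemma L2conv_close:
  fixes F G :: "nat \<Rightarrow> 'a \<Rightarrow> 'b::euclidean_space"
  assumes F: "L2conv M F f" and G: "\<And>n. G n \<in> sq_int M"
    and d: "(\<lambda>n. L2norm M (\<lambda>x. G n x - F n x)) \<longlonglongrightarrow> 0"
  shows "L2conv M G f"
  unfolding L2conv_def
proof (intro conjI allI G L2convD(2)[OF F])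
  have le: "L2norm M (\<lambda>x. G n x - f x) \<le> L2norm M (\<lambda>x. G n x - F n x) + L2norm M (\<lambda>x. F n x - f x)" for n
    by (rule L2norm_triangle_diff[OF G L2convD(1)[OF F] L2convD(2)[OF F]])
  have lim: "(\<lambda>n. L2norm M (\<lambda>x. G n x - F n x) + L2norm M (\<lambda>x. F n x - f x)) \<longlonglongrightarrow> 0"
    using tendsto_add[OF d L2convD(3)[OF F]] by simp
  show "(\<lambda>n. L2norm M (\<lambda>x. G n x - f x)) \<longlonglongrightarrow> 0"
    by (rule tendsto_sandwich[OF always_eventually always_eventually tendsto_const lim])
      (use le in \<open>blast intro: L2norm_nonneg\<close>)+
qed

lemma L2conv_inner:
  assumes "L2conv M F f" "L2conv M G g"
  shows "(\<lambda>n. LINT x|M. F n x \<bullet> G n x) \<longlonglongrightarrow> (LINT x|M. f x \<bullet> g x)"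
proof -
  note F = L2convD[OF assms(1)] and G = L2convD[OF assms(2)]
  let ?a = "\<lambda>n. L2norm M (\<lambda>x. F n x - f x)" and ?b = "\<lambda>n. L2norm M (\<lambda>x. G n x - g x)"
  have "(\<lambda>n. (LINT x|M. F n x \<bullet> G n x) - (LINT x|M. f x \<bullet> g x)) \<longlonglongrightarrow> 0"
  proof (rule tendsto_rabs_zero_cancel, rule tendsto_sandwich[OF _ _ tendsto_const])
    show "(\<lambda>n. ?a n * (?b n + L2norm M g) + L2norm M f * ?b n) \<longlonglongrightarrow> 0"
      using F(3) G(3) by (auto intro!: tendsto_eq_intros)
    have "\<bar>(LINT x|M. F n x \<bullet> G n x) - (LINT x|M. f x \<bullet> g x)\<bar>
        \<le> ?a n * (?b n + L2norm M g) + L2norm M f * ?b n" for n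
    proof -
      note int = integrable_inner[OF sq_int_diff[OF F(1) F(2)] G(1)]
        integrable_inner[OF F(2) sq_int_diff[OF G(1) G(2)]]
      have "(LINT x|M. F n x \<bullet> G n x) - (LINT x|M. f x \<bullet> g x)
          = (LINT x|M. F n x \<bullet> G n x - f x \<bullet> g x)"
        using integrable_inner[OF F(1) G(1)] integrable_inner[OF F(2) G(2)] by simp
      also have "\<dots> = (LINT x|M. ((F n x - f x) \<bullet> G n x) + (f x \<bullet> (G n x - g x)))"
        by (simp add: inner_diff_left inner_diff_right)
      also have "\<dots> = (LINT x|M. (F n x - f x) \<bullet> G n x) + (LINT x|M. f x \<bullet> (G n x - g x))"
        using int by (rule Bochner_Integration.integral_add)
      finally have "\<bar>(LINT x|M. F n x \<bullet> G n x) - (LINT x|M. f x \<bullet> g x)\<bar>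
          \<le> ?a n * L2norm M (G n) + L2norm M f * ?b n"
        using L2_Cauchy_Schwarz[OF sq_int_diff[OF F(1) F(2)] G(1), of n n]
          L2_Cauchy_Schwarz[OF F(2) sq_int_diff[OF G(1) G(2)], of n] by linarith
      also have "L2norm M (G n) \<le> ?b n + L2norm M g"
        using L2norm_triangle[OF sq_int_diff[OF G(1) G(2)] G(2), of n] by simp
      finally show ?thesis by (simp add: mult_left_mono)
    qed
    then show "\<forall>\<^sub>F n in sequentially. \<bar>(LINT x|M. F n x \<bullet> G n x) - (LINT x|M. f x \<bullet> g x)\<bar>
        \<le> ?a n * (?b n + L2norm M g) + L2norm M f * ?b n" by simp
  qed simp
  then show ?thesis by (rule LIM_zero_cancel)
qed

lemma L2conv_L2norm:
  assumes "L2conv M F f"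
  shows "(\<lambda>n. L2norm M (F n)) \<longlonglongrightarrow> L2norm M f"
  unfolding L2norm_def using L2conv_inner[OF assms assms]
  by (intro tendsto_real_sqrt) (simp add: power2_norm_eq_inner)

lemma L2conv_AE_subseq:
  assumes "L2conv M F f"
  obtains r :: "nat \<Rightarrow> nat" where "strict_mono r" "AE x in M. (\<lambda>n. F (r n) x) \<longlonglongrightarrow> f x"
proof -
  note F = L2convD[OF assms]
  have "\<exists>r::nat\<Rightarrow>nat. strict_mono r \<and> (AE x in M. (\<lambda>n. (norm (F (r n) x - f x))\<^sup>2) \<longlonglongrightarrow> 0)"
  proof (rule tendsto_L1_AE_subseq)
    show "integrable M (\<lambda>x. (norm (F n x - f x))\<^sup>2)" for n
      using sq_int_integrable[OF sq_int_diff[OF F(1) F(2)]] .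
    show "(\<lambda>n. LINT x|M. norm ((norm (F n x - f x))\<^sup>2)) \<longlonglongrightarrow> 0"
      using tendsto_power[OF F(3), of 2] by (simp add: L2norm_power2)
  qed
  then obtain r :: "nat \<Rightarrow> nat" where r: "strict_mono r"
    "AE x in M. (\<lambda>n. (norm (F (r n) x - f x))\<^sup>2) \<longlonglongrightarrow> 0" by blast
  have "AE x in M. (\<lambda>n. F (r n) x) \<longlonglongrightarrow> f x"
    using r(2)
  proof eventually_elim
    case (elim x)
    from tendsto_real_sqrt[OF this] have "(\<lambda>n. norm (F (r n) x - f x)) \<longlonglongrightarrow> 0" by simp
    then show ?case by (simp add: LIM_zero_cancel tendsto_norm_zero_iff)
  qed
  with r(1) show thesis by (rule that)
qed

text \<open>The limit is dominated by the same majorant, so the squared difference is dominated by 4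
  times the squared majorant, and dominated convergence gives convergence in norm.\<close>

lemma L2conv_dominated:
  assumes "\<And>n. F n \<in> borel_measurable M" "f \<in> borel_measurable M" "w \<in> sq_int M"
    and "\<And>n. AE x in M. norm (F n x) \<le> norm (w x)"
    and "AE x in M. (\<lambda>n. F n x) \<longlonglongrightarrow> f x"
  shows "L2conv M F f"
proof -
  have F: "F n \<in> sq_int M" for n by (rule sq_int_bound[OF assms(3,1,4)])
  have "AE x in M. \<forall>n. norm (F n x) \<le> norm (w x)" using assms(4) by (simp add: AE_all_countable)
  then have fw: "AE x in M. norm (f x) \<le> norm (w x)"
    using assms(5)
  proof eventually_elim
    case (elim x)
    then show ?case by (intro LIMSEQ_le_const2[OF tendsto_norm[OF elim(2)]]) auto
  qed
  have f: "f \<in> sq_int M" by (rule sq_int_bound[OF assms(3,2) fw])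
  have "(\<lambda>n. LINT x|M. (norm (F n x - f x))\<^sup>2) \<longlonglongrightarrow> (LINT x|M. 0)"
  proof (rule integral_dominated_convergence[where w = "\<lambda>x. 4 * (norm (w x))\<^sup>2"])
    show "integrable M (\<lambda>x. 4 * (norm (w x))\<^sup>2)" using assms(3) by (simp add: sq_int_integrable)
    show "AE x in M. (\<lambda>n. (norm (F n x - f x))\<^sup>2) \<longlonglongrightarrow> 0"
      using assms(5)
    proof eventually_elim
      case (elim x)
      then have "(\<lambda>n. norm (F n x - f x)) \<longlonglongrightarrow> 0" by (simp add: LIM_zero tendsto_norm_zero)
      from tendsto_power[OF this, of 2] show ?case by simp
    qed
    show "AE x in M. norm ((norm (F n x - f x))\<^sup>2) \<le> 4 * (norm (w x))\<^sup>2" for n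
      using assms(4)[of n] fw
    proof eventually_elim
      case (elim x)
      have "norm (F n x - f x) \<le> 2 * norm (w x)"
        using elim norm_triangle_ineq4[of "F n x" "f x"] by linarith
      then have "(norm (F n x - f x))\<^sup>2 \<le> (2 * norm (w x))\<^sup>2" by (intro power_mono) auto
      then show ?case by (simp add: power_mult_distrib)
    qed
  qed (use assms(1,2) in measurable)
  then have "(\<lambda>n. L2norm M (\<lambda>x. F n x - f x)) \<longlonglongrightarrow> 0"
    unfolding L2norm_def using tendsto_real_sqrt by fastforce
  with F f show ?thesis by (simp add: L2conv_def)
qed

definition L2Cauchy :: "'a measure \<Rightarrow> (nat \<Rightarrow> 'a \<Rightarrow> 'b::euclidean_space) \<Rightarrow> bool" where
  "L2Cauchy M F \<longleftrightarrow> (\<forall>e>0. \<exists>N. \<forall>m\<ge>N. \<forall>n\<ge>N. L2norm M (\<lambda>x. F m x - F n x) < e)"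

text \<open>Riesz-Fischer. Finiteness of the measure turns L2 bounds on the increments of a fast
  subsequence into L1 bounds, which make the increments summable almost everywhere; Fatou then
  upgrades the pointwise limit to an L2 limit of the whole sequence.\<close>

lemma (in finite_measure) L2_complete:
  fixes F :: "nat \<Rightarrow> 'a \<Rightarrow> 'b::euclidean_space"
  assumes F: "\<And>n. F n \<in> sq_int M" and C: "L2Cauchy M F"
  obtains f where "L2conv M F f"
proof -
  have [measurable]: "F n \<in> borel_measurable M" for n using F by (simp add: sq_int_def)
  have "\<forall>k. \<exists>N. \<forall>m\<ge>N. \<forall>n\<ge>N. L2norm M (\<lambda>x. F m x - F n x) < (1/2) ^ k"
    using C unfolding L2Cauchy_def by simp
  then obtain N where "\<forall>k. \<forall>m\<ge>N k. \<forall>n\<ge>N k. L2norm M (\<lambda>x. F m x - F n x) < (1/2) ^ k"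
    by (rule choice[THEN exE])
  then have N: "\<And>k m n. N k \<le> m \<Longrightarrow> N k \<le> n \<Longrightarrow> L2norm M (\<lambda>x. F m x - F n x) < (1/2) ^ k"
    by blast
  \<comment> \<open>Indices that are strictly increasing and lie beyond the thresholds
    \<open>N k\<close>, so that consecutive terms differ by less than (1/2)^k in norm.\<close>
  define r where "r = rec_nat (N 0) (\<lambda>k rk. max (Suc rk) (N (Suc k)))"
  have r0: "r (Suc k) = max (Suc (r k)) (N (Suc k))" for k by (simp add: r_def)
  have r: "strict_mono r" by (simp add: strict_mono_Suc_iff r0 less_max_iff_disj)
  have rN: "N k \<le> r k" for k
  proof (cases k)
    case 0
    then show ?thesis by (simp add: r_def)
  next
    case (Suc j)
    then show ?thesis by (simp add: r0)
  qed
  have step: "L2norm M (\<lambda>x. F (r (Suc k)) x - F (r k) x) < (1/2) ^ k" for k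
    using N[of k "r (Suc k)" "r k"] rN[of k] strict_monoD[OF r, of k "Suc k"] by simp
  let ?c = "L2norm M (\<lambda>x. 1::real)"
  \<comment> \<open>Cauchy-Schwarz against the constant function 1, which is square integrable
    here.\<close>
  have L1: "(LINT x|M. norm (F (r (Suc k)) x - F (r k) x)) \<le> ?c * (1/2) ^ k" for k
  proof -
    have "(\<lambda>x. norm (F (r (Suc k)) x - F (r k) x)) \<in> sq_int M"
      using sq_int_diff[OF F F, of "r (Suc k)" "r k"] by (simp add: sq_int_def)
    moreover have "(\<lambda>x. 1::real) \<in> sq_int M" by (simp add: sq_int_def)
    ultimately have "\<bar>LINT x|M. 1 \<bullet> norm (F (r (Suc k)) x - F (r k) x)\<bar>
        \<le> ?c * L2norm M (\<lambda>x. norm (F (r (Suc k)) x - F (r k) x))"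
      using L2_Cauchy_Schwarz by blast
    also have "L2norm M (\<lambda>x. norm (F (r (Suc k)) x - F (r k) x))
        = L2norm M (\<lambda>x. F (r (Suc k)) x - F (r k) x)"
      by (simp add: L2norm_def)
    also have "?c * \<dots> \<le> ?c * (1/2) ^ k" using step[of k] by (intro mult_left_mono) auto
    finally show ?thesis by simp
  qed
  have int: "integrable M (\<lambda>x. norm (F (r (Suc k)) x - F (r k) x))" for k
    using integrable_norm_mult[OF sq_int_diff[OF F F], of "\<lambda>x. 1::real" "r (Suc k)" "r k"]
    by (simp add: sq_int_def)
  have "summable (\<lambda>k. LINT x|M. norm (F (r (Suc k)) x - F (r k) x))"
  proof (rule summable_comparison_test'[where N = 0])
    show "summable (\<lambda>k. ?c * (1/2::real) ^ k)" by (intro summable_mult summable_geometric) simp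
    show "norm (LINT x|M. norm (F (r (Suc k)) x - F (r k) x)) \<le> ?c * (1/2) ^ k" for k
      using L1[of k] by (subst real_norm_def, subst abs_of_nonneg) (auto intro: integral_nonneg_AE)
  qed
  then have "AE x in M. summable (\<lambda>k. norm (F (r (Suc k)) x - F (r k) x))"
  proof -
    assume S: "summable (\<lambda>k. LINT x|M. norm (F (r (Suc k)) x - F (r k) x))"
    have "(\<integral>\<^sup>+x. (\<Sum>k. ennreal (norm (F (r (Suc k)) x - F (r k) x))) \<partial>M)
        = (\<Sum>k. \<integral>\<^sup>+x. ennreal (norm (F (r (Suc k)) x - F (r k) x)) \<partial>M)"
      by (rule nn_integral_suminf) measurable
    also have "\<dots> = (\<Sum>k. ennreal (LINT x|M. norm (F (r (Suc k)) x - F (r k) x)))"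
      by (intro suminf_cong nn_integral_eq_integral int) simp
    also have "\<dots> = ennreal (\<Sum>k. LINT x|M. norm (F (r (Suc k)) x - F (r k) x))"
      by (rule suminf_ennreal2[OF _ S]) simp
    also have "\<dots> < \<infinity>" by simp
    finally have "AE x in M. (\<Sum>k. ennreal (norm (F (r (Suc k)) x - F (r k) x))) \<noteq> \<infinity>"
      by (intro nn_integral_noteq_infinite) auto
    then show ?thesis
      by eventually_elim (rule summable_suminf_not_top, auto)
  qed
  then have conv: "AE x in M. convergent (\<lambda>k. F (r k) x)"
  proof eventually_elim
    case (elim x)
    then have "summable (\<lambda>k. F (r (Suc k)) x - F (r k) x)" by (rule summable_norm_cancel)
    then have "convergent (\<lambda>k. \<Sum>i<k. F (r (Suc i)) x - F (r i) x)"
      by (simp add: summable_iff_convergent)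
    then have "convergent (\<lambda>k. F (r k) x - F (r 0) x)" by (simp add: sum_lessThan_telescope[where f = "\<lambda>i. F (r i) x"])
    from convergent_add[OF this convergent_const[of "F (r 0) x"]] show ?case by simp
  qed
  define f where "f x = lim (\<lambda>k. F (r k) x)" for x
  have [measurable]: "f \<in> borel_measurable M"
    unfolding f_def by measurable
  have lim: "AE x in M. (\<lambda>k. F (r k) x) \<longlonglongrightarrow> f x"
    using conv by eventually_elim (simp add: f_def convergent_LIMSEQ_iff)
  \<comment> \<open>Used twice: with a fixed index to see that the limit is square integrable, and
    with arbitrarily small \<open>e\<close> to obtain convergence.\<close>
  have fatou: "(\<integral>\<^sup>+x. (norm (F n x - f x))\<^sup>2 \<partial>M) \<le> ennreal (e\<^sup>2)"
    if e: "e > 0" "\<And>m. N0 \<le> m \<Longrightarrow> L2norm M (\<lambda>x. F n x - F m x) < e" for n N0 e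
  proof -
    have "AE x in M. ennreal ((norm (F n x - f x))\<^sup>2) = liminf (\<lambda>k. ennreal ((norm (F n x - F (r k) x))\<^sup>2))"
      using lim
    proof eventually_elim
      case (elim x)
      then have "(\<lambda>k. ennreal ((norm (F n x - F (r k) x))\<^sup>2)) \<longlonglongrightarrow> ennreal ((norm (F n x - f x))\<^sup>2)"
        by (intro tendsto_intros) auto
      then show ?case by (intro lim_imp_Liminf[symmetric]) auto
    qed
    then have "(\<integral>\<^sup>+x. (norm (F n x - f x))\<^sup>2 \<partial>M)
        = (\<integral>\<^sup>+x. liminf (\<lambda>k. ennreal ((norm (F n x - F (r k) x))\<^sup>2)) \<partial>M)"
      by (rule nn_integral_cong_AE)
    also have "\<dots> \<le> liminf (\<lambda>k. \<integral>\<^sup>+x. ennreal ((norm (F n x - F (r k) x))\<^sup>2) \<partial>M)"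
      by (rule nn_integral_liminf) measurable
    also have "\<dots> \<le> limsup (\<lambda>k. \<integral>\<^sup>+x. ennreal ((norm (F n x - F (r k) x))\<^sup>2) \<partial>M)"
      by (rule Liminf_le_Limsup) simp
    also have "\<dots> \<le> ennreal (e\<^sup>2)"
    proof (rule Limsup_bounded)
      show "\<forall>\<^sub>F k in sequentially. (\<integral>\<^sup>+x. ennreal ((norm (F n x - F (r k) x))\<^sup>2) \<partial>M) \<le> ennreal (e\<^sup>2)"
        using eventually_ge_at_top[of N0]
      proof eventually_elim
        case (elim k)
        then have "N0 \<le> r k" using seq_suble[OF r, of k] by linarith
        then have "(L2norm M (\<lambda>x. F n x - F (r k) x))\<^sup>2 \<le> e\<^sup>2"
          using e by (intro power_mono) (auto intro: less_imp_le)
        moreover have "(\<integral>\<^sup>+x. ennreal ((norm (F n x - F (r k) x))\<^sup>2) \<partial>M)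
            = ennreal ((L2norm M (\<lambda>x. F n x - F (r k) x))\<^sup>2)"
          unfolding L2norm_power2
          by (intro nn_integral_eq_integral sq_int_integrable sq_int_diff F) auto
        ultimately show ?case by (simp add: ennreal_leI)
      qed
    qed
    finally show ?thesis .
  qed
  have Nex: "\<exists>N0. \<forall>n\<ge>N0. \<forall>m\<ge>N0. L2norm M (\<lambda>x. F n x - F m x) < e" if "e > 0" for e
    using C that unfolding L2Cauchy_def by blast
  have fsq: "f \<in> sq_int M"
  proof -
    obtain N0 where N0: "\<And>m. N0 \<le> m \<Longrightarrow> L2norm M (\<lambda>x. F N0 x - F m x) < 1"
      using Nex[of 1] by auto
    have "(\<integral>\<^sup>+x. (norm (F N0 x - f x))\<^sup>2 \<partial>M) \<le> ennreal (1\<^sup>2)"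
      by (rule fatou[OF _ N0]) auto
    also have "\<dots> < \<infinity>" by simp
    finally have "(\<integral>\<^sup>+x. (norm (F N0 x - f x))\<^sup>2 \<partial>M) < \<infinity>" .
    then have "(\<lambda>x. F N0 x - f x) \<in> sq_int M"
      by (auto simp: sq_int_def integrable_iff_bounded)
    from sq_int_diff[OF F[of N0] this] show ?thesis by simp
  qed
  have "(\<lambda>n. L2norm M (\<lambda>x. F n x - f x)) \<longlonglongrightarrow> 0"
  proof (rule LIMSEQ_I)
    fix e :: real assume "e > 0"
    then obtain N0 where N0: "\<And>n m. N0 \<le> n \<Longrightarrow> N0 \<le> m \<Longrightarrow> L2norm M (\<lambda>x. F n x - F m x) < e / 2"
      using Nex[of "e / 2"] by auto
    have "norm (L2norm M (\<lambda>x. F n x - f x) - 0) < e" if "n \<ge> N0" for n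
    proof -
      have "ennreal ((L2norm M (\<lambda>x. F n x - f x))\<^sup>2) = (\<integral>\<^sup>+x. (norm (F n x - f x))\<^sup>2 \<partial>M)"
        unfolding L2norm_power2
        by (intro nn_integral_eq_integral[symmetric] sq_int_integrable sq_int_diff F fsq) auto
      also have "\<dots> \<le> ennreal ((e / 2)\<^sup>2)"
        using \<open>e > 0\<close> by (intro fatou[of _ N0] N0 that) auto
      finally have "(L2norm M (\<lambda>x. F n x - f x))\<^sup>2 \<le> (e / 2)\<^sup>2"
        by (simp add: ennreal_le_iff)
      then have "L2norm M (\<lambda>x. F n x - f x) \<le> e / 2"
        by (rule power2_le_imp_le) (use \<open>e > 0\<close> in simp)
      with \<open>e > 0\<close> show ?thesis by simp
    qed
    then show "\<exists>N0. \<forall>n\<ge>N0. norm (L2norm M (\<lambda>x. F n x - f x) - 0) < e" by blast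
  qed
  then have "L2conv M F f" using F fsq by (simp add: L2conv_def)
  then show thesis by (rule that)
qed

lemma L2conv_imp_Cauchy:
  assumes "L2conv M F f"
  shows "L2Cauchy M F"
  unfolding L2Cauchy_def
proof (intro allI impI)
  note F = L2convD[OF assms]
  fix e :: real assume "e > 0"
  then obtain N where N: "\<And>n. n \<ge> N \<Longrightarrow> norm (L2norm M (\<lambda>x. F n x - f x) - 0) < e / 2"
    using LIMSEQ_D[OF F(3), of "e / 2"] by auto
  have "L2norm M (\<lambda>x. F m x - F n x) < e" if "m \<ge> N" "n \<ge> N" for m n
    using L2norm_triangle_diff[OF F(1)[of m] F(2) F(1)[of n]] N[OF that(1)] N[OF that(2)]
      L2norm_minus_commute[of M f "F n"] by simp
  then show "\<exists>N. \<forall>m\<ge>N. \<forall>n\<ge>N. L2norm M (\<lambda>x. F m x - F n x) < e" by blast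
qed

subsection \<open>Smooth functions\<close>

definition pd :: "('a::euclidean_space \<Rightarrow> real) \<Rightarrow> 'a \<Rightarrow> 'a \<Rightarrow> real" where
  "pd f b x = frechet_derivative f (at x) b"

lemma pd_eq: "(f has_derivative f') (at x) \<Longrightarrow> pd f b x = f' b"
  by (simp add: pd_def frechet_derivative_at[symmetric])

lemma Ck_Suc_iff: "Ck (Suc k) f \<longleftrightarrow> (\<forall>x. f differentiable (at x)) \<and> (\<forall>b\<in>Basis. Ck k (pd f b))"
  by (simp add: pd_def[abs_def])

lemma Ck_imp_continuous: "Ck k f \<Longrightarrow> continuous_on UNIV f"
  by (cases k) (auto simp: continuous_on_eq_continuous_at intro: differentiable_imp_continuous_within)

lemma Ck_Suc_imp: "Ck (Suc k) f \<Longrightarrow> Ck k f"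
proof (induction k arbitrary: f)
  case 0
  then have "continuous_on UNIV f" by (rule Ck_imp_continuous)
  then show ?case by simp
next
  case (Suc k)
  have *: "(\<forall>x. f differentiable (at x)) \<and> (\<forall>b\<in>Basis. Ck (Suc k) (pd f b))"
    using Suc.prems unfolding Ck_Suc_iff[of "Suc k"] .
  show ?case unfolding Ck_Suc_iff using * Suc.IH by blast
qed

text \<open>\<open>Ck\<close> is phrased through \<open>frechet_derivative\<close>. By uniqueness of
  derivatives it suffices to exhibit one, and the closure properties below work with explicit
  formulas.\<close>

lemma Ck_SucI:
  assumes "\<And>x. (f has_derivative f' x) (at x)" "\<And>b. b \<in> Basis \<Longrightarrow> Ck k (\<lambda>x. f' x b)"
  shows "Ck (Suc k) f"
proof -
  have "pd f b = (\<lambda>x. f' x b)" for b using pd_eq[OF assms(1)] by auto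
  then show ?thesis unfolding Ck_Suc_iff using assms by (auto simp: differentiable_def)
qed

lemma Ck_Suc_has_derivative:
  assumes "Ck (Suc k) f"
  shows "(f has_derivative (\<lambda>h. pd f h x)) (at x)"
  using assms by (auto simp: pd_def frechet_derivative_works[symmetric])

lemma Ck_pd: "Ck (Suc k) f \<Longrightarrow> b \<in> Basis \<Longrightarrow> Ck k (pd f b)"
  unfolding Ck_Suc_iff by blast

lemma Ck_const: "Ck k (\<lambda>x. c)"
proof (induction k arbitrary: c)
  case (Suc k)
  show ?case by (rule Ck_SucI[where f' = "\<lambda>x h. 0"]) (use Suc in auto)
qed simp

lemma Ck_add: "Ck k f \<Longrightarrow> Ck k g \<Longrightarrow> Ck k (\<lambda>x. f x + g x)"
proof (induction k arbitrary: f g)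
  case (Suc k)
  show ?case
  proof (rule Ck_SucI[where f' = "\<lambda>x h. pd f h x + pd g h x"])
    show "((\<lambda>x. f x + g x) has_derivative (\<lambda>h. pd f h x + pd g h x)) (at x)" for x
      using Suc.prems by (intro has_derivative_add Ck_Suc_has_derivative)
    show "Ck k (\<lambda>x. pd f b x + pd g b x)" if "b \<in> Basis" for b
      using Suc.prems that by (intro Suc.IH Ck_pd)
  qed
qed (auto intro: continuous_intros)

lemma Ck_mult: "Ck k f \<Longrightarrow> Ck k g \<Longrightarrow> Ck k (\<lambda>x. f x * g x)"
proof (induction k arbitrary: f g)
  case (Suc k)
  show ?case
  proof (rule Ck_SucI[where f' = "\<lambda>x h. f x * pd g h x + pd f h x * g x"])
    show "((\<lambda>x. f x * g x) has_derivative (\<lambda>h. f x * pd g h x + pd f h x * g x)) (at x)" for x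
      using Suc.prems by (intro has_derivative_mult Ck_Suc_has_derivative)
    show "Ck k (\<lambda>x. f x * pd g b x + pd f b x * g x)" if "b \<in> Basis" for b
      using Suc.prems that by (intro Ck_add Suc.IH Ck_pd Ck_Suc_imp[of k])
  qed
qed (auto intro: continuous_intros)

lemma Ck_scale: "Ck k f \<Longrightarrow> Ck k (\<lambda>x. c * f x)"
  by (intro Ck_mult Ck_const)

lemma Ck_uminus: "Ck k f \<Longrightarrow> Ck k (\<lambda>x. - f x)"
  using Ck_scale[of k f "-1"] by simp

lemma Ck_diff: "Ck k f \<Longrightarrow> Ck k g \<Longrightarrow> Ck k (\<lambda>x. f x - g x)"
  using Ck_add[of k f "\<lambda>x. - g x"] Ck_uminus[of k g] by simp

lemma Ck_prod: "(\<And>i. i \<in> I \<Longrightarrow> Ck k (f i)) \<Longrightarrow> Ck k (\<lambda>x. \<Prod>i\<in>I. f i x)"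
  by (induction I rule: infinite_finite_induct) (auto intro: Ck_const Ck_mult)

lemma Ck_sum: "(\<And>i. i \<in> I \<Longrightarrow> Ck k (f i)) \<Longrightarrow> Ck k (\<lambda>x. \<Sum>i\<in>I. f i x)"
  by (induction I rule: infinite_finite_induct) (auto intro: Ck_const Ck_add)

lemma Ck_inner: "Ck k (\<lambda>x. x \<bullet> v)"
proof (cases k)
  case (Suc j)
  show ?thesis unfolding Suc
    by (rule Ck_SucI[where f' = "\<lambda>x h. h \<bullet> v"]) (auto intro!: derivative_eq_intros Ck_const)
qed (auto intro: continuous_intros)

lemma Ck_norm_diff_square: "Ck k (\<lambda>y. (norm (y - x))\<^sup>2)"
proof -
  have "(\<lambda>y. (norm (y - x))\<^sup>2) = (\<lambda>y. \<Sum>b\<in>Basis. (y \<bullet> b - x \<bullet> b) * (y \<bullet> b - x \<bullet> b))"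
    unfolding power2_norm_eq_inner by (subst euclidean_inner) (simp add: inner_diff_left)
  then show ?thesis by (simp add: Ck_sum Ck_mult Ck_diff Ck_const Ck_inner)
qed

text \<open>A smooth function of one real variable, presented as the sequence of all its
  derivatives; the function itself is \<open>F 0\<close>.\<close>

definition derivatives :: "(nat \<Rightarrow> real \<Rightarrow> real) \<Rightarrow> bool" where
  "derivatives F \<longleftrightarrow> (\<forall>n t. (F n has_real_derivative F (Suc n) t) (at t))"

text \<open>The chain rule replaces \<open>F n\<close> by \<open>F (Suc n)\<close>, so the induction
  on the order of smoothness has to run for all n at once.\<close>

lemma Ck_compose:
  assumes "derivatives F"
  shows "Ck k g \<Longrightarrow> Ck k (\<lambda>x. F n (g x))"
proof (induction k arbitrary: g n)
  case 0
  have "continuous_on UNIV (F n)"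
    using assms by (auto simp: derivatives_def continuous_on_eq_continuous_at intro: DERIV_isCont)
  then show ?case using 0 by (auto intro: continuous_on_compose2)
next
  case (Suc k)
  show ?case
  proof (rule Ck_SucI[where f' = "\<lambda>x h. F (Suc n) (g x) * pd g h x"])
    show "((\<lambda>x. F n (g x)) has_derivative (\<lambda>h. F (Suc n) (g x) * pd g h x)) (at x)" for x
      using assms has_derivative_compose[OF Ck_Suc_has_derivative[OF Suc.prems], of "F n"]
      by (simp add: derivatives_def has_field_derivative_def)
    show "Ck k (\<lambda>x. F (Suc n) (g x) * pd g b x)" if "b \<in> Basis" for b
      using Suc.prems that by (intro Ck_mult Suc.IH Ck_pd Ck_Suc_imp[of k])
  qed
qed

text \<open>\<open>flat n\<close> is the \<open>n\<close>-th derivative of the function \<open>exp (- 1 / t)\<close>, extended by \<open>0\<close> to \<open>t \<le> 0\<close>.\<close>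

primrec flat_poly :: "nat \<Rightarrow> real poly" where
  "flat_poly 0 = 1"
| "flat_poly (Suc n) = monom 1 2 * (flat_poly n - pderiv (flat_poly n))"

definition flat :: "nat \<Rightarrow> real \<Rightarrow> real" where
  "flat n t = (if 0 < t then poly (flat_poly n) (1 / t) * exp (- (1 / t)) else 0)"

text \<open>The extra power of s is carried along so that the induction on the polynomial can move
  one factor s into it.\<close>

lemma tendsto_poly_exp_0: "((\<lambda>s::real. s ^ k * poly p s * exp (- s)) \<longlongrightarrow> 0) at_top"
proof (induction p arbitrary: k)
  case (pCons a p)
  have "((\<lambda>s. a * (s ^ k / exp s) + s ^ Suc k * poly p s * exp (- s)) \<longlongrightarrow> a * 0 + 0) at_top"
    by (intro tendsto_intros tendsto_power_div_exp_0 pCons.IH)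
  then show ?case by (simp add: exp_minus field_simps)
qed simp

lemma derivatives_flat: "derivatives flat"
  unfolding derivatives_def
proof (intro allI)
  fix n t
  consider "t > 0" | "t < 0" | "t = (0::real)" by linarith
  then show "(flat n has_real_derivative flat (Suc n) t) (at t)"
  proof cases
    case 1
    have "((\<lambda>t. poly (flat_poly n) (1 / t) * exp (- (1 / t))) has_real_derivative flat (Suc n) t) (at t)"
      using 1 by (auto intro!: derivative_eq_intros simp: flat_def poly_monom field_simps power2_eq_square)
    then show ?thesis
      by (rule DERIV_cong_ev[THEN iffD1, OF refl _ refl, rotated])
        (use 1 in \<open>auto simp: flat_def eventually_nhds intro!: exI[of _ "{0<..}"]\<close>)
  next
    case 2
    have "((\<lambda>t. 0) has_real_derivative flat (Suc n) t) (at t)"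
      using 2 by (auto simp: flat_def)
    then show ?thesis
      by (rule DERIV_cong_ev[THEN iffD1, OF refl _ refl, rotated])
        (use 2 in \<open>auto simp: flat_def eventually_nhds intro!: exI[of _ "{..<0}"]\<close>)
  next
    case 3
    \<comment> \<open>The difference quotient at 0 from the right becomes s * p(s) * exp(- s) under
      s = 1 / h, with s tending to infinity.\<close>
    have "((\<lambda>h. flat n h / h) \<longlongrightarrow> 0) (at_right 0)"
    proof (rule Lim_transform_eventually)
      have "((\<lambda>h. (inverse h) ^ 1 * poly (flat_poly n) (inverse h) * exp (- inverse h)) \<longlongrightarrow> 0) (at_right 0)"
        by (rule filterlim_compose[OF tendsto_poly_exp_0 filterlim_inverse_at_top_right])
      then show "((\<lambda>h. (inverse h) ^ 1 * poly (flat_poly n) (inverse h) * exp (- inverse h)) \<longlongrightarrow> 0) (at_right 0)" .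
      show "\<forall>\<^sub>F h in at_right 0. (inverse h) ^ 1 * poly (flat_poly n) (inverse h) * exp (- inverse h) = flat n h / h"
        using eventually_at_right_less[of 0]
        by eventually_elim (simp add: flat_def inverse_eq_divide)
    qed
    moreover have "((\<lambda>h. flat n h / h) \<longlongrightarrow> 0) (at_left 0)"
    proof (rule Lim_transform_eventually)
      show "((\<lambda>h::real. 0::real) \<longlongrightarrow> 0) (at_left 0)" by simp
      show "\<forall>\<^sub>F h in at_left 0. 0 = flat n h / h"
        using eventually_at_left_real[of "-1" 0] by (auto simp: flat_def elim: eventually_mono)
    qed
    ultimately have "((\<lambda>h. flat n h / h) \<longlongrightarrow> 0) (at 0)" by (simp add: filterlim_split_at)
    then show ?thesis unfolding 3 DERIV_def by (simp add: flat_def)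
  qed
qed

lemma flat_has_derivative: "(flat n has_real_derivative flat (Suc n) t) (at t)"
  using derivatives_flat by (simp add: derivatives_def)

lemma continuous_flat: "continuous_on UNIV (flat n)"
  using flat_has_derivative by (auto simp: continuous_on_eq_continuous_at intro: DERIV_isCont)

lemma flat_nonpos: "t \<le> 0 \<Longrightarrow> flat n t = 0"
  by (simp add: flat_def)

lemma flat_0: "flat 0 t = (if 0 < t then exp (- (1 / t)) else 0)"
  by (simp add: flat_def)

lemma flat_1: "flat (Suc 0) t = (if 0 < t then exp (- (1 / t)) / t\<^sup>2 else 0)"
  by (simp add: flat_def poly_monom field_simps)

subsection \<open>Test functions\<close>

lemma test_functionsD:
  assumes "\<phi> \<in> test_functions \<Omega>"
  shows "Ck k \<phi>" "compact (closure {x. \<phi> x \<noteq> 0})" "closure {x. \<phi> x \<noteq> 0} \<subseteq> \<Omega>"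
  using assms by (auto simp: test_functions_def)

lemma test_functionI:
  assumes "\<And>k. Ck k \<phi>" "compact K" "K \<subseteq> \<Omega>" "\<And>x. x \<notin> K \<Longrightarrow> \<phi> x = 0"
  shows "\<phi> \<in> test_functions \<Omega>"
proof -
  have "closure {x. \<phi> x \<noteq> 0} \<subseteq> K"
    using assms by (intro closure_minimal compact_imp_closed) auto
  with assms show ?thesis
    by (auto simp: test_functions_def compact_eq_bounded_closed intro: bounded_subset)
qed

text \<open>One compact set serves for the function and for its derivatives, since off the closed
  support the function vanishes in a neighbourhood.\<close>

lemma test_function_support:
  assumes "\<phi> \<in> test_functions \<Omega>"
  obtains K where "compact K" "K \<subseteq> \<Omega>" "\<And>x. x \<notin> K \<Longrightarrow> \<phi> x = 0" "\<And>x b. x \<notin> K \<Longrightarrow> pd \<phi> b x = 0"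
proof
  let ?K = "closure {x. \<phi> x \<noteq> 0}"
  show "compact ?K" "?K \<subseteq> \<Omega>" using test_functionsD[OF assms] by auto
  show *: "\<phi> x = 0" if "x \<notin> ?K" for x using that closure_subset[of "{x. \<phi> x \<noteq> 0}"] by blast
  show "pd \<phi> b x = 0" if "x \<notin> ?K" for x b
  proof -
    have "((\<lambda>x. 0::real) has_derivative (\<lambda>h. 0)) (at x)" by simp
    then have "(\<phi> has_derivative (\<lambda>h. 0)) (at x)"
    proof (rule has_derivative_transform_within_open)
      show "open (- ?K)" by (rule open_Compl) (rule closed_closure)
      show "x \<in> - ?K" using that by simp
      show "0 = \<phi> y" if "y \<in> - ?K" for y using *[of y] that by simp
    qed
    then show ?thesis by (rule pd_eq)
  qed
qed

lemma test_function_pd: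
  assumes "\<phi> \<in> test_functions \<Omega>" "b \<in> Basis"
  shows "pd \<phi> b \<in> test_functions \<Omega>"
proof -
  obtain K where "compact K" "K \<subseteq> \<Omega>" "\<And>x. x \<notin> K \<Longrightarrow> pd \<phi> b x = 0"
    using test_function_support[OF assms(1)] by metis
  moreover have "Ck k (pd \<phi> b)" for k
    using Ck_pd[OF test_functionsD(1)[OF assms(1), of "Suc k"] assms(2)] .
  ultimately show ?thesis by (intro test_functionI)
qed

lemma test_function_add_scale:
  assumes "\<phi> \<in> test_functions \<Omega>" "\<psi> \<in> test_functions \<Omega>"
  shows "(\<lambda>x. \<phi> x + c * \<psi> x) \<in> test_functions \<Omega>"
proof -
  obtain K where K: "compact K" "K \<subseteq> \<Omega>" "\<And>x. x \<notin> K \<Longrightarrow> \<phi> x = 0"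
    using test_function_support[OF assms(1)] by metis
  obtain L where L: "compact L" "L \<subseteq> \<Omega>" "\<And>x. x \<notin> L \<Longrightarrow> \<psi> x = 0"
    using test_function_support[OF assms(2)] by metis
  show ?thesis
  proof (rule test_functionI[of _ "K \<union> L"])
    show "Ck k (\<lambda>x. \<phi> x + c * \<psi> x)" for k
      by (intro Ck_add Ck_scale test_functionsD(1)[OF assms(1)] test_functionsD(1)[OF assms(2)])
  qed (use K L in auto)
qed

lemma test_function_mult:
  assumes "\<phi> \<in> test_functions \<Omega>" "\<psi> \<in> test_functions \<Omega>"
  shows "(\<lambda>x. \<phi> x * \<psi> x) \<in> test_functions \<Omega>"
proof -
  obtain K where K: "compact K" "K \<subseteq> \<Omega>" "\<And>x. x \<notin> K \<Longrightarrow> \<phi> x = 0"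
    using test_function_support[OF assms(1)] by metis
  show ?thesis
    by (rule test_functionI[OF _ K(1,2)]) (use K assms in \<open>auto intro: Ck_mult test_functionsD\<close>)
qed

text \<open>The condition at 0 keeps the support of the composition inside that of the test
  function.\<close>

lemma test_function_compose:
  assumes "\<phi> \<in> test_functions \<Omega>" "derivatives F" "F 0 0 = 0"
  shows "(\<lambda>x. F 0 (\<phi> x)) \<in> test_functions \<Omega>"
proof -
  obtain K where K: "compact K" "K \<subseteq> \<Omega>" "\<And>x. x \<notin> K \<Longrightarrow> \<phi> x = 0"
    using test_function_support[OF assms(1)] by metis
  show ?thesis
    by (rule test_functionI[OF _ K(1,2)]) (use K assms in \<open>auto intro: Ck_compose test_functionsD\<close>)
qed

lemma test_function_has_derivative:
  "\<phi> \<in> test_functions \<Omega> \<Longrightarrow> (\<phi> has_derivative (\<lambda>h. pd \<phi> h x)) (at x)"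
  using Ck_Suc_has_derivative test_functionsD(1) by blast

lemma test_function_continuous: "\<phi> \<in> test_functions \<Omega> \<Longrightarrow> continuous_on A \<phi>"
  using Ck_imp_continuous test_functionsD(1) continuous_on_subset by blast

lemma test_function_measurable [measurable_dest]:
  "\<phi> \<in> test_functions \<Omega> \<Longrightarrow> \<phi> \<in> borel_measurable borel"
  by (intro borel_measurable_continuous_onI test_function_continuous)

lemma grad_eq_pd: "grad \<phi> x = (\<Sum>b\<in>Basis. pd \<phi> b x *\<^sub>R b)"
  by (simp add: grad_def pd_def)

lemma grad_inner_Basis: "b \<in> Basis \<Longrightarrow> grad \<phi> x \<bullet> b = pd \<phi> b x"
  by (simp add: grad_eq_pd inner_sum_left inner_Basis if_distrib cong: if_cong)

lemma test_function_pd_eq_grad: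
  assumes "\<phi> \<in> test_functions \<Omega>"
  shows "pd \<phi> h x = grad \<phi> x \<bullet> h"
proof -
  interpret linear "\<lambda>h. pd \<phi> h x"
    using test_function_has_derivative[OF assms] by (rule has_derivative_linear)
  have "pd \<phi> h x = pd \<phi> (\<Sum>b\<in>Basis. (h \<bullet> b) *\<^sub>R b) x" by (simp add: euclidean_representation)
  also have "\<dots> = (\<Sum>b\<in>Basis. (h \<bullet> b) * pd \<phi> b x)" by (simp add: sum scale)
  also have "\<dots> = grad \<phi> x \<bullet> h"
    by (simp add: grad_eq_pd inner_sum_left inner_commute[of h] mult.commute)
  finally show ?thesis .
qed

lemma test_function_derivative_grad:
  "\<phi> \<in> test_functions \<Omega> \<Longrightarrow> (\<phi> has_derivative (\<lambda>h. grad \<phi> x \<bullet> h)) (at x)"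
  using test_function_has_derivative[of \<phi> \<Omega> x] by (simp add: test_function_pd_eq_grad)

lemma test_function_grad_continuous:
  assumes "\<phi> \<in> test_functions \<Omega>"
  shows "continuous_on A (grad \<phi>)"
proof -
  have "continuous_on A (\<lambda>x. \<Sum>b\<in>Basis. pd \<phi> b x *\<^sub>R b)"
    using test_function_continuous[OF test_function_pd[OF assms]] by (intro continuous_intros) auto
  then show ?thesis by (simp add: grad_eq_pd[abs_def])
qed

lemma grad_eqI:
  assumes "(f has_derivative (\<lambda>h. v \<bullet> h)) (at x)"
  shows "grad f x = v"
  by (rule euclidean_eqI) (simp add: grad_inner_Basis pd_eq[OF assms])

lemma grad_test_function_add_scale:
  assumes "\<phi> \<in> test_functions \<Omega>" "\<psi> \<in> test_functions \<Omega>"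
  shows "grad (\<lambda>x. \<phi> x + c * \<psi> x) x = grad \<phi> x + c *\<^sub>R grad \<psi> x"
  by (rule grad_eqI)
    (auto intro!: derivative_eq_intros test_function_derivative_grad[OF assms(1)]
      test_function_derivative_grad[OF assms(2)] simp: inner_add_left)

lemma grad_test_function_mult:
  assumes "\<phi> \<in> test_functions \<Omega>" "\<psi> \<in> test_functions \<Omega>"
  shows "grad (\<lambda>x. \<phi> x * \<psi> x) x = \<phi> x *\<^sub>R grad \<psi> x + \<psi> x *\<^sub>R grad \<phi> x"
  by (rule grad_eqI)
    (auto intro!: derivative_eq_intros test_function_derivative_grad[OF assms(1)]
      test_function_derivative_grad[OF assms(2)] simp: inner_add_left algebra_simps)

lemma grad_test_function_compose:
  assumes "\<phi> \<in> test_functions \<Omega>" "(f has_real_derivative d) (at (\<phi> x))"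
  shows "grad (\<lambda>x. f (\<phi> x)) x = d *\<^sub>R grad \<phi> x"
  by (rule grad_eqI)
    (use has_derivative_compose[OF test_function_derivative_grad[OF assms(1)]] assms(2)
      in \<open>auto simp: has_field_derivative_def\<close>)

lemma test_function_bounded:
  assumes "\<phi> \<in> test_functions \<Omega>"
  obtains C where "C > 0" "\<And>x. \<bar>\<phi> x\<bar> \<le> C" "\<And>x. norm (grad \<phi> x) \<le> C"
proof -
  obtain K where K: "compact K" "\<And>x. x \<notin> K \<Longrightarrow> \<phi> x = 0" "\<And>x b. x \<notin> K \<Longrightarrow> pd \<phi> b x = 0"
    using test_function_support[OF assms] by metis
  have "compact (\<phi> ` K)" "compact (grad \<phi> ` K)"
    using K(1) assms by (auto intro!: compact_continuous_image test_function_continuous test_function_grad_continuous)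
  then obtain B C where B: "\<forall>y\<in>\<phi> ` K. norm y \<le> B" and C: "\<forall>y\<in>grad \<phi> ` K. norm y \<le> C"
    using compact_imp_bounded bounded_iff by metis
  have "\<bar>\<phi> x\<bar> \<le> \<bar>B\<bar> + \<bar>C\<bar> + 1" for x
  proof (cases "x \<in> K")
    case True
    then have "\<bar>\<phi> x\<bar> \<le> B" using B by auto
    then show ?thesis by linarith
  qed (simp add: K(2))
  moreover have "norm (grad \<phi> x) \<le> \<bar>B\<bar> + \<bar>C\<bar> + 1" for x
  proof (cases "x \<in> K")
    case True
    then have "norm (grad \<phi> x) \<le> C" using C by auto
    then show ?thesis by linarith
  qed (simp add: grad_eq_pd K(3))
  ultimately show thesis by (intro that[of "\<bar>B\<bar> + \<bar>C\<bar> + 1"]) auto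
qed

subsection \<open>Integrals of test functions\<close>

lemma integrable_lborel_bounded_support:
  fixes f :: "'a::euclidean_space \<Rightarrow> 'b::euclidean_space"
  assumes "f \<in> borel_measurable borel" "bounded K" "\<And>x. x \<notin> K \<Longrightarrow> f x = 0" "\<And>x. norm (f x) \<le> C"
  shows "integrable lborel f"
proof -
  obtain a b where ab: "K \<subseteq> cbox a b" using bounded_subset_cbox_symmetric[OF assms(2)] by blast
  show ?thesis
  proof (rule Bochner_Integration.integrable_bound)
    show "integrable lborel (\<lambda>x. C * indicat_real (cbox a b) x)"
      by (intro integrable_mult_right integrable_real_indicator) (use emeasure_lborel_cbox_finite emeasure_lborel_cball_finite in \<open>auto simp flip: infinity_ennreal_def\<close>)
    show "AE x in lborel. norm (f x) \<le> norm (C * indicat_real (cbox a b) x)"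
    proof (rule AE_I2)
      fix x show "norm (f x) \<le> norm (C * indicat_real (cbox a b) x)"
        using assms(3,4)[of x] ab by (cases "x \<in> cbox a b") auto
    qed
  qed (use assms(1) in simp)
qed

lemma lborel_integral_translate:
  fixes f :: "'a::euclidean_space \<Rightarrow> 'b::euclidean_space"
  assumes "f \<in> borel_measurable borel"
  shows "(LINT x|lborel. f (x + z)) = (LINT x|lborel. f x)"
proof -
  have "(LINT x|lborel. f x) = (LINT x|distr lborel borel ((+) z). f x)"
    by (simp only: lborel_distr_plus)
  also have "\<dots> = (LINT x|lborel. f (z + x))" using assms by (intro integral_distr) auto
  finally show ?thesis by (simp add: add.commute)
qed

lemma lborel_integrable_translate:
  fixes f :: "'a::euclidean_space \<Rightarrow> 'b::euclidean_space"
  assumes "integrable lborel f"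
  shows "integrable lborel (\<lambda>x. f (x + z))"
proof -
  have "integrable (distr lborel borel ((+) z)) f" using assms by (simp only: lborel_distr_plus)
  then have "integrable lborel (\<lambda>x. f (z + x))"
    using borel_measurable_integrable[OF assms] by (subst (asm) integrable_distr_eq) auto
  then show ?thesis by (simp add: add.commute)
qed

lemma sq_int_lborel_translate:
  fixes f :: "'a::euclidean_space \<Rightarrow> 'b::euclidean_space"
  assumes "f \<in> sq_int lborel"
  shows "(\<lambda>x. f (x + z)) \<in> sq_int lborel"
  using assms lborel_integrable_translate[of "\<lambda>x. (norm (f x))\<^sup>2" z]
  by (auto simp: sq_int_def)

lemma L2norm_lborel_translate:
  fixes f :: "'a::euclidean_space \<Rightarrow> 'b::euclidean_space"
  assumes "f \<in> borel_measurable borel"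
  shows "L2norm lborel (\<lambda>x. f (x + z)) = L2norm lborel f"
  unfolding L2norm_def using lborel_integral_translate[of "\<lambda>x. (norm (f x))\<^sup>2" z] assms by simp

lemma test_function_integrable:
  assumes "\<phi> \<in> test_functions \<Omega>"
  shows "integrable lborel \<phi>"
proof -
  obtain K where "compact K" "\<And>x. x \<notin> K \<Longrightarrow> \<phi> x = 0" using test_function_support[OF assms] by metis
  moreover obtain C where "\<And>x. \<bar>\<phi> x\<bar> \<le> C" using test_function_bounded[OF assms] by metis
  ultimately show ?thesis
    using assms by (intro integrable_lborel_bounded_support[of \<phi> K C] compact_imp_bounded test_function_measurable) auto
qed

lemma test_function_grad_measurable [measurable_dest]:
  "\<phi> \<in> test_functions \<Omega> \<Longrightarrow> grad \<phi> \<in> borel_measurable borel"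
  by (intro borel_measurable_continuous_onI test_function_grad_continuous)

lemma test_function_sq_int_lborel:
  assumes "\<phi> \<in> test_functions \<Omega>"
  shows "\<phi> \<in> sq_int lborel" "grad \<phi> \<in> sq_int lborel"
proof -
  obtain K where K: "compact K" "\<And>x. x \<notin> K \<Longrightarrow> \<phi> x = 0" "\<And>x b. x \<notin> K \<Longrightarrow> pd \<phi> b x = 0"
    using test_function_support[OF assms] by metis
  obtain C where C: "C > 0" "\<And>x. \<bar>\<phi> x\<bar> \<le> C" "\<And>x. norm (grad \<phi> x) \<le> C"
    using test_function_bounded[OF assms] by metis
  note m = test_function_measurable[OF assms] test_function_grad_measurable[OF assms]
  have K': "grad \<phi> x = 0" if "x \<notin> K" for x using K(3)[OF that] by (simp add: grad_eq_pd)
  have "integrable lborel (\<lambda>x. (norm (\<phi> x))\<^sup>2)"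
    by (rule integrable_lborel_bounded_support[of _ K "C\<^sup>2"])
      (use m C K in \<open>auto intro!: compact_imp_bounded simp: abs_le_square_iff[symmetric]\<close>)
  moreover have "integrable lborel (\<lambda>x. (norm (grad \<phi> x))\<^sup>2)"
    by (rule integrable_lborel_bounded_support[of _ K "C\<^sup>2"])
      (use m C K K' in \<open>auto intro!: compact_imp_bounded power_mono\<close>)
  ultimately show "\<phi> \<in> sq_int lborel" "grad \<phi> \<in> sq_int lborel"
    using m by (auto simp: sq_int_def)
qed

lemma test_function_diff_bound:
  assumes "\<phi> \<in> test_functions \<Omega>" "\<And>x. norm (grad \<phi> x) \<le> C"
  shows "\<bar>\<phi> (x + h) - \<phi> x\<bar> \<le> C * norm h"
proof -
  have "norm (\<phi> (x + h) - \<phi> x) \<le> norm (x + h - x) * C"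
  proof (subst mult.commute, rule differentiable_bound[where S = UNIV and f' = "\<lambda>x h. grad \<phi> x \<bullet> h"])
    show "(\<phi> has_derivative (\<lambda>h. grad \<phi> x \<bullet> h)) (at x)" for x
      using assms(1) by (rule test_function_derivative_grad)
    show "onorm (\<lambda>h. grad \<phi> x \<bullet> h) \<le> C" for x
    proof (rule onorm_le)
      fix h
      have "norm (grad \<phi> x \<bullet> h) \<le> norm (grad \<phi> x) * norm h" by (simp add: Cauchy_Schwarz_ineq2)
      also have "\<dots> \<le> C * norm h" using assms(2) by (intro mult_right_mono) auto
      finally show "norm (grad \<phi> x \<bullet> h) \<le> C * norm h" .
    qed
  qed auto
  then show ?thesis by (simp add: mult.commute)
qed

section \<open>Difference quotients and integration by parts\<close>

lemma test_function_difference_quotient: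
  assumes "\<phi> \<in> test_functions \<Omega>"
  shows "(\<lambda>n. (\<phi> (x + (1 / real (Suc n)) *\<^sub>R z) - \<phi> x) * real (Suc n)) \<longlonglongrightarrow> grad \<phi> x \<bullet> z"
proof -
  have "((\<lambda>t. \<phi> (x + t *\<^sub>R z)) has_derivative (\<lambda>t. grad \<phi> (x + 0 *\<^sub>R z) \<bullet> (t *\<^sub>R z))) (at 0)"
  proof (rule has_derivative_compose[of "\<lambda>t. x + t *\<^sub>R z"])
    show "((\<lambda>t. x + t *\<^sub>R z) has_derivative (\<lambda>t. t *\<^sub>R z)) (at 0)"
      by (auto intro!: derivative_eq_intros)
  qed (rule test_function_derivative_grad[OF assms])
  then have "((\<lambda>t. \<phi> (x + t *\<^sub>R z)) has_real_derivative (grad \<phi> x \<bullet> z)) (at 0)"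
    by (simp add: has_field_derivative_def mult.commute[of _ "grad \<phi> x \<bullet> z"] cong: if_cong)
  then have "((\<lambda>h. (\<phi> (x + h *\<^sub>R z) - \<phi> x) / h) \<longlongrightarrow> grad \<phi> x \<bullet> z) (at 0)"
    by (simp add: DERIV_def)
  moreover have "filterlim (\<lambda>n. 1 / real (Suc n)) (at 0) sequentially"
    unfolding filterlim_at using LIMSEQ_inverse_real_of_nat by (auto simp: inverse_eq_divide)
  ultimately have "(\<lambda>n. (\<phi> (x + (1 / real (Suc n)) *\<^sub>R z) - \<phi> x) / (1 / real (Suc n))) \<longlonglongrightarrow> grad \<phi> x \<bullet> z"
    by (rule filterlim_compose)
  then show ?thesis by simp
qed

text \<open>All shifts have length at most that of z, so the quotients vanish off one common ball,
  and there the gradient bound applies. This is the majorant for every passage from difference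
  quotients to derivatives.\<close>

lemma test_function_difference_quotient_bound:
  fixes z :: "'a::euclidean_space"
  assumes "\<phi> \<in> test_functions \<Omega>"
  obtains C R where "\<And>n x. \<bar>(\<phi> (x + (1 / real (Suc n)) *\<^sub>R z) - \<phi> x) * real (Suc n)\<bar> \<le> C * indicat_real (cball 0 R) x"
proof -
  obtain K where K: "compact K" "\<And>x. x \<notin> K \<Longrightarrow> \<phi> x = 0"
    using test_function_support[OF assms] by metis
  obtain C where C: "C > 0" "\<And>x. norm (grad \<phi> x) \<le> C"
    using test_function_bounded[OF assms] by metis
  obtain R where R: "\<And>x. x \<in> K \<Longrightarrow> norm x \<le> R" using compact_imp_bounded[OF K(1)] bounded_iff by metis
  let ?B = "cball 0 (R + norm z) :: 'a set"
  have "\<bar>(\<phi> (x + (1 / real (Suc n)) *\<^sub>R z) - \<phi> x) * real (Suc n)\<bar> \<le> (C * norm z) * indicat_real ?B x" for n x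
  proof (cases "x \<in> ?B")
    case True
    have "\<bar>\<phi> (x + (1 / real (Suc n)) *\<^sub>R z) - \<phi> x\<bar> * real (Suc n)
        \<le> (C * norm ((1 / real (Suc n)) *\<^sub>R z)) * real (Suc n)"
      by (rule mult_right_mono[OF test_function_diff_bound[OF assms C(2)]]) simp
    also have "\<dots> = C * norm z" by simp
    finally show ?thesis using True by (simp add: abs_mult)
  next
    case False
    have n: "norm ((1 / real (Suc n)) *\<^sub>R z) \<le> norm z"
      by (simp add: divide_le_eq) (simp add: distrib_left)
    have "norm x \<le> norm (x + (1 / real (Suc n)) *\<^sub>R z) + norm ((1 / real (Suc n)) *\<^sub>R z)"
      using norm_triangle_ineq4[of "x + (1 / real (Suc n)) *\<^sub>R z" "(1 / real (Suc n)) *\<^sub>R z"] by simp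
    with n False have "\<not> norm (x + (1 / real (Suc n)) *\<^sub>R z) \<le> R" by simp
    then have "x + (1 / real (Suc n)) *\<^sub>R z \<notin> K" using R by blast
    moreover have "\<not> norm x \<le> R" using False norm_ge_zero[of z] by (simp del: norm_ge_zero)
    then have "x \<notin> K" using R by blast
    ultimately show ?thesis using False K(2) by simp
  qed
  then show thesis by (rule that)
qed

lemma integrable_indicator_cball:
  "integrable lborel (\<lambda>x. C * indicat_real (cball (a::'a::euclidean_space) R) x)"
  by (intro integrable_mult_right integrable_real_indicator)
    (use emeasure_lborel_cball_finite in \<open>auto simp flip: infinity_ennreal_def\<close>)

text \<open>Translation invariance makes the integral of each difference quotient zero; dominated
  convergence carries this to the derivative. Combined with the product rule this is integration by
  parts.\<close>

lemma integral_test_function_pd: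
  fixes b :: "'a::euclidean_space"
  assumes "\<phi> \<in> test_functions \<Omega>"
  shows "(LINT x|lborel. grad \<phi> x \<bullet> b) = 0"
proof -
  have [measurable]: "\<phi> \<in> borel_measurable borel" "grad \<phi> \<in> borel_measurable borel"
    using assms by (auto intro: test_function_measurable test_function_grad_measurable)
  let ?q = "\<lambda>n x. (\<phi> (x + (1 / real (Suc n)) *\<^sub>R b) - \<phi> x) * real (Suc n)"
  obtain C R where CR: "\<And>n x. \<bar>?q n x\<bar> \<le> C * indicat_real (cball 0 R) x"
    by (rule test_function_difference_quotient_bound[OF assms, of b]) (rule that)
  have "(\<lambda>n. LINT x|lborel. ?q n x) \<longlonglongrightarrow> (LINT x|lborel. grad \<phi> x \<bullet> b)"
  proof (rule integral_dominated_convergence[where w = "\<lambda>x. C * indicat_real (cball 0 R) x"])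
    show "AE x in lborel. norm (?q n x) \<le> C * indicat_real (cball 0 R) x" for n
      using CR by (intro AE_I2) (simp only: real_norm_def)
    show "AE x in lborel. (\<lambda>n. ?q n x) \<longlonglongrightarrow> grad \<phi> x \<bullet> b"
      by (rule AE_I2) (rule test_function_difference_quotient[OF assms])
  qed (use integrable_indicator_cball in measurable)
  moreover have "(LINT x|lborel. ?q n x) = 0" for n
  proof -
    have "(LINT x|lborel. ?q n x)
        = ((LINT x|lborel. \<phi> (x + (1 / real (Suc n)) *\<^sub>R b)) - (LINT x|lborel. \<phi> x)) * real (Suc n)"
      using test_function_integrable[OF assms] lborel_integrable_translate[OF test_function_integrable[OF assms]]
      by simp
    also have "\<dots> = 0" by (subst lborel_integral_translate) auto
    finally show ?thesis .
  qed
  ultimately have "(\<lambda>n. 0) \<longlonglongrightarrow> (LINT x|lborel. grad \<phi> x \<bullet> b)" by simp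
  then show ?thesis using LIMSEQ_unique[OF _ tendsto_const] by blast
qed

lemma integral_by_parts_test_functions:
  fixes b :: "'a::euclidean_space"
  assumes "\<phi> \<in> test_functions \<Omega>" "\<psi> \<in> test_functions \<Omega>"
  shows "(LINT x|lborel. \<phi> x * (grad \<psi> x \<bullet> b)) = - (LINT x|lborel. \<psi> x * (grad \<phi> x \<bullet> b))"
proof -
  note sq = test_function_sq_int_lborel[OF assms(1)] test_function_sq_int_lborel[OF assms(2)]
  have 1: "integrable lborel (\<lambda>x. \<phi> x * (grad \<psi> x \<bullet> b))"
    using integrable_inner_left[OF integrable_scaleR_sq[OF sq(1) sq(4)], of b] by simp
  have 2: "integrable lborel (\<lambda>x. \<psi> x * (grad \<phi> x \<bullet> b))"
    using integrable_inner_left[OF integrable_scaleR_sq[OF sq(3) sq(2)], of b] by simp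
  have "0 = (LINT x|lborel. grad (\<lambda>x. \<phi> x * \<psi> x) x \<bullet> b)"
    using integral_test_function_pd[OF test_function_mult[OF assms]] by simp
  also have "\<dots> = (LINT x|lborel. \<phi> x * (grad \<psi> x \<bullet> b) + \<psi> x * (grad \<phi> x \<bullet> b))"
    by (simp add: grad_test_function_mult[OF assms] inner_add_left)
  also have "\<dots> = (LINT x|lborel. \<phi> x * (grad \<psi> x \<bullet> b)) + (LINT x|lborel. \<psi> x * (grad \<phi> x \<bullet> b))"
    using 1 2 by (rule Bochner_Integration.integral_add)
  finally show ?thesis by simp
qed

text \<open>Restricted Lebesgue measure lives on the completed sigma-algebra, \<open>lborel\<close>
  on the Borel sets. Agreement of the integrals is what makes the translation arguments available
  for functions on the domain.\<close>

lemma integral_lebesgue_on_eq_lborel: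
  fixes f :: "'a::euclidean_space \<Rightarrow> 'b::euclidean_space"
  assumes "f \<in> borel_measurable borel" "S \<in> sets lebesgue" "\<And>x. x \<notin> S \<Longrightarrow> f x = 0"
  shows "(LINT x|lebesgue_on S. f x) = (LINT x|lborel. f x)"
proof -
  have "(LINT x|lebesgue_on S. f x) = (LINT x|lebesgue. indicator S x *\<^sub>R f x)"
    using assms(2) by (intro integral_restrict_space) auto
  also have "(\<lambda>x. indicator S x *\<^sub>R f x) = f"
    using assms(3) by (auto simp: indicator_def)
  also have "(LINT x|lebesgue. f x) = (LINT x|lborel. f x)"
    using assms(1) by (intro integral_completion) simp
  finally show ?thesis .
qed

lemma integrable_lebesgue_on_lborel:
  fixes f :: "'a::euclidean_space \<Rightarrow> 'b::euclidean_space"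
  assumes "integrable lborel f" "S \<in> sets lebesgue"
  shows "integrable (lebesgue_on S) f"
proof -
  have "integrable lebesgue f" using assms(1) by (simp add: integrable_completion)
  then have "integrable lebesgue (\<lambda>x. indicator S x *\<^sub>R f x)"
    using assms(2) by (intro integrable_mult_indicator)
  then show ?thesis using assms(2) by (simp add: integrable_restrict_space)
qed

lemma borel_measurable_lebesgue_on:
  "f \<in> borel_measurable borel \<Longrightarrow> f \<in> borel_measurable (lebesgue_on S)"
  by (intro measurable_restrict_space1 measurable_completion) simp

lemma sq_int_lborel_lebesgue_on:
  fixes f :: "'a::euclidean_space \<Rightarrow> 'b::euclidean_space"
  assumes "f \<in> sq_int lborel" "S \<in> sets lebesgue"
  shows "f \<in> sq_int (lebesgue_on S)"
  using assms integrable_lebesgue_on_lborel[of "\<lambda>x. (norm (f x))\<^sup>2" S]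
  by (auto simp: sq_int_def intro: borel_measurable_lebesgue_on)

lemma L2norm_lebesgue_on_eq_lborel:
  fixes f :: "'a::euclidean_space \<Rightarrow> 'b::euclidean_space"
  assumes "f \<in> borel_measurable borel" "S \<in> sets lebesgue" "\<And>x. x \<notin> S \<Longrightarrow> f x = 0"
  shows "L2norm (lebesgue_on S) f = L2norm lborel f"
  unfolding L2norm_def using assms by (subst integral_lebesgue_on_eq_lborel) auto

lemma L2_eq_sq_int: "L2 S = sq_int (lebesgue_on S)"
  by (simp add: L2_def sq_int_def)

subsection \<open>The Sobolev space with zero boundary values\<close>

locale bounded_open =
  fixes \<Omega> :: "'a::euclidean_space set"
  assumes open_dom: "open \<Omega>" and bounded_dom: "bounded \<Omega>"
begin

abbreviation "M \<equiv> lebesgue_on \<Omega>"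

lemma dom_sets: "\<Omega> \<in> sets lebesgue"
  using open_dom by simp

sublocale fin: finite_measure M
proof
  have "\<Omega> \<in> lmeasurable" by (rule lmeasurable_open[OF bounded_dom open_dom])
  then show "emeasure M (space M) \<noteq> \<infinity>"
    using dom_sets by (simp add: emeasure_restrict_space fmeasurable_def)
qed

lemma test_function_outside:
  assumes "\<phi> \<in> test_functions \<Omega>" "x \<notin> \<Omega>"
  shows "\<phi> x = 0" "grad \<phi> x = 0"
proof -
  obtain K where "K \<subseteq> \<Omega>" "\<And>x. x \<notin> K \<Longrightarrow> \<phi> x = 0" "\<And>x b. x \<notin> K \<Longrightarrow> pd \<phi> b x = 0"
    using test_function_support[OF assms(1)] by metis
  moreover from this assms(2) have "x \<notin> K" by blast
  ultimately show "\<phi> x = 0" "grad \<phi> x = 0" by (simp_all add: grad_eq_pd)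
qed

lemma test_function_sq_int:
  assumes "\<phi> \<in> test_functions \<Omega>"
  shows "\<phi> \<in> sq_int M" "grad \<phi> \<in> sq_int M"
  using test_function_sq_int_lborel[OF assms] dom_sets by (auto intro: sq_int_lborel_lebesgue_on)

lemma test_function_L2norm:
  assumes "\<phi> \<in> test_functions \<Omega>"
  shows "L2norm M \<phi> = L2norm lborel \<phi>" "L2norm M (grad \<phi>) = L2norm lborel (grad \<phi>)"
  using assms by (auto intro!: L2norm_lebesgue_on_eq_lborel dom_sets test_function_measurable
      test_function_grad_measurable simp: test_function_outside)

lemma integral_by_parts_test:
  assumes "\<phi> \<in> test_functions \<Omega>" "\<psi> \<in> test_functions \<Omega>"
  shows "(LINT x|M. \<phi> x * (grad \<psi> x \<bullet> b)) = - (LINT x|M. \<psi> x * (grad \<phi> x \<bullet> b))"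
proof -
  have [measurable]: "\<phi> \<in> borel_measurable borel" "grad \<phi> \<in> borel_measurable borel"
    "\<psi> \<in> borel_measurable borel" "grad \<psi> \<in> borel_measurable borel"
    using assms by (auto intro: test_function_measurable test_function_grad_measurable)
  have "(LINT x|M. \<phi> x * (grad \<psi> x \<bullet> b)) = (LINT x|lborel. \<phi> x * (grad \<psi> x \<bullet> b))"
    using dom_sets assms by (intro integral_lebesgue_on_eq_lborel) (auto simp: test_function_outside)
  moreover have "(LINT x|M. \<psi> x * (grad \<phi> x \<bullet> b)) = (LINT x|lborel. \<psi> x * (grad \<phi> x \<bullet> b))"
    using dom_sets assms by (intro integral_lebesgue_on_eq_lborel) (auto simp: test_function_outside)
  ultimately show ?thesis using integral_by_parts_test_functions[OF assms] by simp
qed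

text \<open>The compositions \<open>flat 0 (n * p x)\<close>, with \<open>p\<close> smooth and positive exactly on the open box,
  increase to the indicator function of the box.\<close>

lemma integral_box_eq_0:
  fixes g :: "'a \<Rightarrow> real"
  assumes g: "integrable M g" and 0: "\<And>\<phi>. \<phi> \<in> test_functions \<Omega> \<Longrightarrow> (LINT x|M. \<phi> x * g x) = 0"
    and ab: "cbox a b \<subseteq> \<Omega>"
  shows "(LINT x|M. indicator (box a b) x * g x) = 0"
proof -
  define p where "p x = (\<Prod>i\<in>Basis. flat 0 (x \<bullet> i - a \<bullet> i) * flat 0 (b \<bullet> i - x \<bullet> i))" for x :: 'a
  have pk: "Ck k p" for k
    unfolding p_def[abs_def]
    by (intro Ck_prod Ck_mult Ck_compose[OF derivatives_flat] Ck_diff Ck_inner Ck_const)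
  have p_pos: "p x > 0" if "x \<in> box a b" for x
    unfolding p_def using that by (intro prod_pos ballI mult_pos_pos) (auto simp: box_def flat_0)
  have p_0: "p x = 0" if "x \<notin> box a b" for x
    using that unfolding p_def by (auto simp: box_def flat_0 not_less intro!: bexI)
  define \<phi> where "\<phi> n x = flat 0 (real n * p x)" for n x
  have \<phi>0: "\<phi> n x = 0" if "x \<notin> box a b" for n x using p_0[OF that] by (simp add: \<phi>_def flat_0)
  have \<phi>: "\<phi> n \<in> test_functions \<Omega>" for n
  proof (rule test_functionI[OF _ compact_cbox ab])
    show "Ck k (\<phi> n)" for k
      unfolding \<phi>_def[abs_def] by (intro Ck_compose[OF derivatives_flat] Ck_scale pk)
    show "\<phi> n x = 0" if "x \<notin> cbox a b" for x
      using that box_subset_cbox by (intro \<phi>0) blast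
  qed
  have bd: "\<bar>\<phi> n x\<bar> \<le> 1" for n x by (auto simp: \<phi>_def flat_0)
  have lim: "(\<lambda>n. \<phi> n x) \<longlonglongrightarrow> indicator (box a b) x" for x
  proof (cases "x \<in> box a b")
    case True
    have "(\<lambda>n. - (1 / (real n * p x))) \<longlonglongrightarrow> - 0"
      using lim_const_over_n[of "1 / p x"] by (intro tendsto_minus) (simp add: field_simps)
    from tendsto_exp[OF this] have "(\<lambda>n. exp (- (1 / (real n * p x)))) \<longlonglongrightarrow> 1" by simp
    moreover have "\<forall>\<^sub>F n in sequentially. exp (- (1 / (real n * p x))) = \<phi> n x"
      using eventually_gt_at_top[of 0] by eventually_elim (use p_pos[OF True] in \<open>simp add: \<phi>_def flat_0\<close>)
    ultimately show ?thesis using True by (simp add: Lim_transform_eventually)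
  next
    case False
    then show ?thesis by (simp add: \<phi>0)
  qed
  have "(\<lambda>n. LINT x|M. \<phi> n x * g x) \<longlonglongrightarrow> (LINT x|M. indicator (box a b) x * g x)"
  proof (rule integral_dominated_convergence[where w = "\<lambda>x. norm (g x)"])
    show "(\<lambda>x. indicat_real (box a b) x * g x) \<in> borel_measurable M"
      using g by (intro borel_measurable_times borel_measurable_lebesgue_on[of "indicat_real (box a b)"]) auto
    show "(\<lambda>x. \<phi> n x * g x) \<in> borel_measurable M" for n
      using g test_function_measurable[OF \<phi>]
      by (intro borel_measurable_times borel_measurable_lebesgue_on[of "\<phi> n"]) auto
    show "AE x in M. (\<lambda>n. \<phi> n x * g x) \<longlonglongrightarrow> indicator (box a b) x * g x"
      using lim by (intro AE_I2 tendsto_mult) auto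
    show "AE x in M. norm (\<phi> n x * g x) \<le> norm (g x)" for n
      using bd by (intro AE_I2) (auto simp: abs_mult intro: mult_left_le_one_le)
  qed (use g in auto)
  with 0[OF \<phi>] have "(\<lambda>n. 0) \<longlonglongrightarrow> (LINT x|M. indicator (box a b) x * g x)" by simp
  then show ?thesis using LIMSEQ_unique[OF _ tendsto_const] by blast
qed

text \<open>The integral of g over every box inside the domain is zero, and by Lebesgue
  differentiation g is almost everywhere the limit of its averages over shrinking cubes.\<close>

lemma fundamental_lemma_real:
  fixes g :: "'a \<Rightarrow> real"
  assumes g: "integrable M g" and 0: "\<And>\<phi>. \<phi> \<in> test_functions \<Omega> \<Longrightarrow> (LINT x|M. \<phi> x * g x) = 0"
  shows "AE x in M. g x = 0"
proof -
  define f where "f x = (if x \<in> \<Omega> then g x else 0)" for x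
  have fi: "integrable lebesgue f"
    unfolding f_def using g dom_sets by (simp add: Lebesgue_Measure.integrable_restrict_UNIV)
  have "f integrable_on UNIV"
    using has_integral_integral_lebesgue[OF fi] by blast
  then have "f integrable_on cbox a b" for a b by (rule integrable_on_subcbox) auto
  then obtain N where N: "negligible N"
    "\<And>x e. \<lbrakk>x \<notin> N; 0 < e\<rbrakk> \<Longrightarrow> \<exists>d>0. \<forall>h. 0 < h \<and> h < d \<longrightarrow>
       norm (integral (cbox x (x + h *\<^sub>R One)) f /\<^sub>R h ^ DIM('a) - f x) < e"
    by (rule integrable_ccontinuous_explicit) (rule that)
  have int0: "integral (cbox a b) f = 0" if ab: "cbox a b \<subseteq> \<Omega>" for a b
  proof -
    have fb: "integrable (lebesgue_on (box a b)) f"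
    proof -
      have "integrable lebesgue (\<lambda>x. indicator (box a b) x *\<^sub>R f x)"
        using fi by (intro integrable_mult_indicator) auto
      then show ?thesis by (simp add: integrable_restrict_space)
    qed
    have "integral (cbox a b) f = integral (box a b) f" by (simp add: integral_open_interval)
    also have "\<dots> = (LINT x|lebesgue_on (box a b). f x)"
      using fb by (intro lebesgue_integral_eq_integral[symmetric]) auto
    also have "\<dots> = (LINT x|lebesgue. indicator (box a b) x *\<^sub>R f x)"
      by (intro integral_restrict_space) auto
    also have "\<dots> = (LINT x|lebesgue. indicator \<Omega> x *\<^sub>R (indicator (box a b) x * g x))"
      using ab box_subset_cbox[of a b]
      by (intro Bochner_Integration.integral_cong refl) (auto simp: f_def indicator_def)
    also have "\<dots> = (LINT x|M. indicator (box a b) x * g x)"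
      using dom_sets by (intro integral_restrict_space[symmetric]) auto
    also have "\<dots> = 0" by (rule integral_box_eq_0[OF g 0 ab])
    finally show ?thesis .
  qed
  have "g x = 0" if x: "x \<in> \<Omega>" "x \<notin> N" for x
  proof (rule ccontr)
    assume "g x \<noteq> 0"
    then obtain d where d: "d > 0" "\<And>h. 0 < h \<Longrightarrow> h < d \<Longrightarrow>
        norm (integral (cbox x (x + h *\<^sub>R One)) f /\<^sub>R h ^ DIM('a) - f x) < \<bar>g x\<bar>"
      using N(2)[OF x(2), of "\<bar>g x\<bar>"] by auto
    obtain e where e: "e > 0" "cball x e \<subseteq> \<Omega>" using open_dom x(1) open_contains_cball by metis
    \<comment> \<open>Below the threshold of the differentiation theorem, and small enough for the
      cube to lie in the ball of radius e: its diagonal is estimated by the sum of its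
      sides.\<close>
    define h where "h = min (d / 2) (e / real DIM('a))"
    have h: "0 < h" "h < d" using d(1) e(1) by (auto simp: h_def)
    have "cbox x (x + h *\<^sub>R One) \<subseteq> cball x e"
    proof
      fix y assume y: "y \<in> cbox x (x + h *\<^sub>R One)"
      have "norm (y - x) \<le> (\<Sum>b\<in>Basis. \<bar>(y - x) \<bullet> b\<bar>)" by (rule norm_le_l1)
      also have "\<dots> \<le> (\<Sum>b\<in>(Basis::'a set). h)"
        using y by (intro sum_mono) (auto simp: mem_box inner_diff_left inner_add_left)
      also have "\<dots> = real DIM('a) * h" by simp
      also have "\<dots> \<le> real DIM('a) * (e / real DIM('a))" by (intro mult_left_mono) (auto simp: h_def)
      also have "\<dots> = e" by simp
      finally show "y \<in> cball x e" by (simp add: dist_norm norm_minus_commute)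
    qed
    with e have "integral (cbox x (x + h *\<^sub>R One)) f = 0" by (intro int0) auto
    with d(2)[OF h] x show False by (simp add: f_def)
  qed
  moreover have "N \<in> null_sets lebesgue" using N(1) negligible_iff_null_sets by blast
  ultimately have "AE x in lebesgue. x \<in> \<Omega> \<longrightarrow> g x = 0"
    by (intro AE_I'[of N]) auto
  then show ?thesis using dom_sets by (simp add: AE_restrict_space_iff)
qed

lemma fundamental_lemma:
  fixes G :: "'a \<Rightarrow> 'b::euclidean_space"
  assumes G: "G \<in> sq_int M" and 0: "\<And>\<phi>. \<phi> \<in> test_functions \<Omega> \<Longrightarrow> (LINT x|M. \<phi> x *\<^sub>R G x) = 0"
  shows "AE x in M. G x = 0"
proof -
  have "AE x in M. G x \<bullet> b = 0" if "b \<in> Basis" for b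
  proof (rule fundamental_lemma_real)
    have one: "(\<lambda>x. 1::real) \<in> sq_int M" by (simp add: sq_int_def)
    show "integrable M (\<lambda>x. G x \<bullet> b)"
      using integrable_scaleR_sq[OF one G] by (intro integrable_inner_left) simp
    fix \<phi> assume \<phi>: "\<phi> \<in> test_functions \<Omega>"
    have "(LINT x|M. \<phi> x * (G x \<bullet> b)) = (LINT x|M. (\<phi> x *\<^sub>R G x) \<bullet> b)" by simp
    also have "\<dots> = (LINT x|M. \<phi> x *\<^sub>R G x) \<bullet> b"
      using integrable_scaleR_sq[OF test_function_sq_int(1)[OF \<phi>] G] by (intro integral_inner_left)
    also have "\<dots> = 0" using 0[OF \<phi>] by simp
    finally show "(LINT x|M. \<phi> x * (G x \<bullet> b)) = 0" .
  qed
  then have "AE x in M. \<forall>b\<in>Basis. G x \<bullet> b = 0" by (simp add: AE_ball_countable countable_finite)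
  then show ?thesis by eventually_elim (auto intro: euclidean_eqI)
qed

lemma weak_gradient_unique:
  assumes "G \<in> sq_int M" "H \<in> sq_int M" "has_weak_gradient \<Omega> u G" "has_weak_gradient \<Omega> u H"
  shows "AE x in M. G x = H x"
proof -
  have "AE x in M. G x - H x = 0"
  proof (rule fundamental_lemma[OF sq_int_diff[OF assms(1,2)]])
    fix \<phi> assume \<phi>: "\<phi> \<in> test_functions \<Omega>"
    have "(LINT x|M. \<phi> x *\<^sub>R (G x - H x)) = (LINT x|M. \<phi> x *\<^sub>R G x) - (LINT x|M. \<phi> x *\<^sub>R H x)"
      using integrable_scaleR_sq[OF test_function_sq_int(1)[OF \<phi>] assms(1)]
        integrable_scaleR_sq[OF test_function_sq_int(1)[OF \<phi>] assms(2)]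
      by (simp add: scaleR_diff_right)
    also have "\<dots> = 0" using assms(3,4) \<phi> by (simp add: has_weak_gradient_def)
    finally show "(LINT x|M. \<phi> x *\<^sub>R (G x - H x)) = 0" .
  qed
  then show ?thesis by eventually_elim simp
qed

text \<open>The only access to the chosen gradient: once some square integrable weak gradient is
  exhibited, the choice is one as well and agrees with it almost everywhere.\<close>

lemma wgrad_eq:
  assumes "G \<in> sq_int M" "has_weak_gradient \<Omega> u G"
  shows "wgrad \<Omega> u \<in> sq_int M" "has_weak_gradient \<Omega> u (wgrad \<Omega> u)" "AE x in M. wgrad \<Omega> u x = G x"
proof -
  have "wgrad \<Omega> u \<in> L2 \<Omega> \<and> has_weak_gradient \<Omega> u (wgrad \<Omega> u)"
    unfolding wgrad_def by (rule someI[of _ G]) (use assms in \<open>simp add: L2_eq_sq_int\<close>)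
  then show *: "wgrad \<Omega> u \<in> sq_int M" "has_weak_gradient \<Omega> u (wgrad \<Omega> u)"
    by (auto simp: L2_eq_sq_int)
  show "AE x in M. wgrad \<Omega> u x = G x" by (rule weak_gradient_unique[OF *(1) assms(1) *(2) assms(2)])
qed

lemma has_weak_gradient_add:
  assumes "u \<in> sq_int M" "v \<in> sq_int M" "G \<in> sq_int M" "H \<in> sq_int M"
    and "has_weak_gradient \<Omega> u G" "has_weak_gradient \<Omega> v H"
  shows "has_weak_gradient \<Omega> (\<lambda>x. u x + c * v x) (\<lambda>x. G x + c *\<^sub>R H x)"
  unfolding has_weak_gradient_def
proof
  fix \<phi> assume \<phi>: "\<phi> \<in> test_functions \<Omega>"
  note T = test_function_sq_int[OF \<phi>]
  have "(LINT x|M. (u x + c * v x) *\<^sub>R grad \<phi> x) = (LINT x|M. u x *\<^sub>R grad \<phi> x) + c *\<^sub>R (LINT x|M. v x *\<^sub>R grad \<phi> x)"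
    using integrable_scaleR_sq[OF assms(1) T(2)] integrable_scaleR_sq[OF assms(2) T(2)]
    by (simp add: scaleR_add_left flip: scaleR_scaleR)
  also have "\<dots> = - ((LINT x|M. \<phi> x *\<^sub>R G x) + c *\<^sub>R (LINT x|M. \<phi> x *\<^sub>R H x))"
    using assms(5,6) \<phi> by (simp add: has_weak_gradient_def)
  also have "(LINT x|M. \<phi> x *\<^sub>R G x) + c *\<^sub>R (LINT x|M. \<phi> x *\<^sub>R H x) = (LINT x|M. \<phi> x *\<^sub>R (G x + c *\<^sub>R H x))"
  proof -
    have "(LINT x|M. \<phi> x *\<^sub>R (G x + c *\<^sub>R H x)) = (LINT x|M. \<phi> x *\<^sub>R G x + c *\<^sub>R (\<phi> x *\<^sub>R H x))"
      by (simp add: scaleR_add_right mult.commute)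
    also have "\<dots> = (LINT x|M. \<phi> x *\<^sub>R G x) + (LINT x|M. c *\<^sub>R (\<phi> x *\<^sub>R H x))"
      by (intro Bochner_Integration.integral_add integrable_scaleR_right integrable_scaleR_sq T assms)
    also have "(LINT x|M. c *\<^sub>R (\<phi> x *\<^sub>R H x)) = c *\<^sub>R (LINT x|M. \<phi> x *\<^sub>R H x)"
      by (rule integral_scaleR_right)
    finally show ?thesis by simp
  qed
  finally show "(LINT x|M. (u x + c * v x) *\<^sub>R grad \<phi> x) = - (LINT x|M. \<phi> x *\<^sub>R (G x + c *\<^sub>R H x))" .
qed

text \<open>The pair (u, G) belongs to the closure of the graph of the gradient on test functions.
  Naming G separately keeps the choice operator out of approximation arguments;
  \<open>H1_limit_H10\<close> and \<open>H10_limit\<close> translate to and from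
  \<open>H10\<close>.\<close>

definition H1_limit :: "(nat \<Rightarrow> 'a \<Rightarrow> real) \<Rightarrow> ('a \<Rightarrow> real) \<Rightarrow> ('a \<Rightarrow> 'a) \<Rightarrow> bool" where
  "H1_limit \<phi> u G \<longleftrightarrow> (\<forall>n. \<phi> n \<in> test_functions \<Omega>) \<and> L2conv M \<phi> u \<and> L2conv M (\<lambda>n. grad (\<phi> n)) G"

text \<open>The weak gradient is a closed operator: for a fixed test function both sides of the
  defining identity are, component by component, L2 inner products and hence continuous in
  L2.\<close>

lemma weak_gradient_limit:
  assumes u: "L2conv M U u" and G: "L2conv M V G" and w: "\<And>n. has_weak_gradient \<Omega> (U n) (V n)"
  shows "has_weak_gradient \<Omega> u G"
  unfolding has_weak_gradient_def
proof
  fix \<psi> assume \<psi>: "\<psi> \<in> test_functions \<Omega>"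
  note T = test_function_sq_int[OF \<psi>]
  show "(LINT x|M. u x *\<^sub>R grad \<psi> x) = - (LINT x|M. \<psi> x *\<^sub>R G x)"
  proof (rule euclidean_eqI)
    fix b :: 'a assume b: "b \<in> Basis"
    have Tb: "(\<lambda>x. grad \<psi> x \<bullet> b) \<in> sq_int M"
      using T(2) by (rule sq_int_bound) (use T(2) Basis_le_norm[OF b] in \<open>auto simp: sq_int_def\<close>)
    have Tc: "(\<lambda>x. \<psi> x *\<^sub>R b) \<in> sq_int M"
      using T(1) by (rule sq_int_bound) (use T(1) b in \<open>auto simp: sq_int_def\<close>)
    have 1: "(\<lambda>n. LINT x|M. U n x \<bullet> (grad \<psi> x \<bullet> b)) \<longlonglongrightarrow> (LINT x|M. u x \<bullet> (grad \<psi> x \<bullet> b))"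
      by (rule L2conv_inner[OF u L2conv_const[OF Tb]])
    have 2: "(\<lambda>n. LINT x|M. V n x \<bullet> (\<psi> x *\<^sub>R b)) \<longlonglongrightarrow> (LINT x|M. G x \<bullet> (\<psi> x *\<^sub>R b))"
      by (rule L2conv_inner[OF G L2conv_const[OF Tc]])
    have eq1: "(LINT x|M. v x \<bullet> (grad \<psi> x \<bullet> b)) = (LINT x|M. v x *\<^sub>R grad \<psi> x) \<bullet> b" if "v \<in> sq_int M" for v
      using integral_inner_left[OF integrable_scaleR_sq[OF that T(2)], of b] by simp
    have eq2: "(LINT x|M. v x \<bullet> (\<psi> x *\<^sub>R b)) = (LINT x|M. \<psi> x *\<^sub>R v x) \<bullet> b" if "v \<in> sq_int M" for v
      using integral_inner_left[OF integrable_scaleR_sq[OF T(1) that], of b] by simp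
    have "(LINT x|M. U n x \<bullet> (grad \<psi> x \<bullet> b)) = - (LINT x|M. V n x \<bullet> (\<psi> x *\<^sub>R b))" for n
      unfolding eq1[OF L2convD(1)[OF u]] eq2[OF L2convD(1)[OF G]]
      using w[of n] \<psi> by (simp add: has_weak_gradient_def)
    with 1 have "(\<lambda>n. - (LINT x|M. V n x \<bullet> (\<psi> x *\<^sub>R b))) \<longlonglongrightarrow> (LINT x|M. u x \<bullet> (grad \<psi> x \<bullet> b))" by simp
    from LIMSEQ_unique[OF this tendsto_minus[OF 2]]
    show "(LINT x|M. u x *\<^sub>R grad \<psi> x) \<bullet> b = (- (LINT x|M. \<psi> x *\<^sub>R G x)) \<bullet> b"
      unfolding eq1[OF L2convD(2)[OF u]] eq2[OF L2convD(2)[OF G]] by simp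
  qed
qed

lemma has_weak_gradient_test_function:
  assumes "\<phi> \<in> test_functions \<Omega>"
  shows "has_weak_gradient \<Omega> \<phi> (grad \<phi>)"
  unfolding has_weak_gradient_def
proof
  fix \<psi> assume \<psi>: "\<psi> \<in> test_functions \<Omega>"
  note T = test_function_sq_int[OF \<psi>] test_function_sq_int[OF assms]
  show "(LINT x|M. \<phi> x *\<^sub>R grad \<psi> x) = - (LINT x|M. \<psi> x *\<^sub>R grad \<phi> x)"
  proof (rule euclidean_eqI)
    fix b :: 'a
    show "(LINT x|M. \<phi> x *\<^sub>R grad \<psi> x) \<bullet> b = (- (LINT x|M. \<psi> x *\<^sub>R grad \<phi> x)) \<bullet> b"
      using integral_inner_left[OF integrable_scaleR_sq[OF T(1,4)], of b]
        integral_inner_left[OF integrable_scaleR_sq[OF T(3,2)], of b]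
        integral_by_parts_test[OF assms \<psi>, of b] by simp
  qed
qed

lemma H1_norm_eq: "H1_norm \<Omega> u = sqrt ((L2norm M u)\<^sup>2 + (L2norm M (wgrad \<Omega> u))\<^sup>2)"
  by (simp add: H1_norm_def L2norm_power2)

lemma H1_limit_H10:
  assumes "H1_limit \<phi> u G"
  shows "u \<in> H10 \<Omega>" "AE x in M. wgrad \<Omega> u x = G x"
proof -
  have \<phi>: "\<And>n. \<phi> n \<in> test_functions \<Omega>" and u: "L2conv M \<phi> u" and G: "L2conv M (\<lambda>n. grad (\<phi> n)) G"
    using assms by (auto simp: H1_limit_def)
  note us = L2convD(2)[OF u] and Gs = L2convD(2)[OF G]
  have w: "has_weak_gradient \<Omega> u G"
    by (rule weak_gradient_limit[OF u G has_weak_gradient_test_function[OF \<phi>]])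
  show "AE x in M. wgrad \<Omega> u x = G x" by (rule wgrad_eq[OF Gs w])
  have H1: "u \<in> H1 \<Omega>" using us Gs w by (auto simp: H1_def L2_eq_sq_int)
  have "H1_norm \<Omega> (\<lambda>x. u x - \<phi> n x)
      = sqrt ((L2norm M (\<lambda>x. \<phi> n x - u x))\<^sup>2 + (L2norm M (\<lambda>x. grad (\<phi> n) x - G x))\<^sup>2)" for n
  proof -
    note T = test_function_sq_int[OF \<phi>[of n]]
    have wd: "has_weak_gradient \<Omega> (\<lambda>x. u x - \<phi> n x) (\<lambda>x. G x - grad (\<phi> n) x)"
      using has_weak_gradient_add[OF us T(1) Gs T(2) w has_weak_gradient_test_function[OF \<phi>], of "-1"] by simp
    note W = wgrad_eq[OF sq_int_diff[OF Gs T(2)] wd]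
    have "L2norm M (wgrad \<Omega> (\<lambda>x. u x - \<phi> n x)) = L2norm M (\<lambda>x. G x - grad (\<phi> n) x)"
      using W(1) sq_int_diff[OF Gs T(2)] W(3) by (intro L2norm_cong_AE) (auto simp: sq_int_def)
    also have "\<dots> = L2norm M (\<lambda>x. grad (\<phi> n) x - G x)" by (rule L2norm_minus_commute)
    finally show ?thesis
      unfolding H1_norm_eq using L2norm_minus_commute[of M u "\<phi> n"] by simp
  qed
  moreover have "(\<lambda>n. sqrt ((L2norm M (\<lambda>x. \<phi> n x - u x))\<^sup>2 + (L2norm M (\<lambda>x. grad (\<phi> n) x - G x))\<^sup>2)) \<longlonglongrightarrow> sqrt (0\<^sup>2 + 0\<^sup>2)"
    using L2convD(3)[OF u] L2convD(3)[OF G] by (intro tendsto_intros)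
  ultimately have "(\<lambda>n. H1_norm \<Omega> (\<lambda>x. u x - \<phi> n x)) \<longlonglongrightarrow> 0" by simp
  with H1 \<phi> show "u \<in> H10 \<Omega>" by (auto simp: H10_def)
qed

lemma H10_sq_int:
  assumes "u \<in> H10 \<Omega>"
  shows "u \<in> sq_int M" "wgrad \<Omega> u \<in> sq_int M" "has_weak_gradient \<Omega> u (wgrad \<Omega> u)"
  using assms wgrad_eq(1,2) by (auto simp: H10_def H1_def L2_eq_sq_int)

lemma H10_limit:
  assumes "u \<in> H10 \<Omega>"
  obtains \<phi> where "H1_limit \<phi> u (wgrad \<Omega> u)"
proof -
  note U = H10_sq_int[OF assms]
  obtain \<phi> where \<phi>: "\<And>n. \<phi> n \<in> test_functions \<Omega>"
    and lim: "(\<lambda>n. H1_norm \<Omega> (\<lambda>x. u x - \<phi> n x)) \<longlonglongrightarrow> 0"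
    using assms by (auto simp: H10_def)
  have le: "L2norm M (\<lambda>x. \<phi> n x - u x) \<le> H1_norm \<Omega> (\<lambda>x. u x - \<phi> n x)"
      "L2norm M (\<lambda>x. grad (\<phi> n) x - wgrad \<Omega> u x) \<le> H1_norm \<Omega> (\<lambda>x. u x - \<phi> n x)" for n
  proof -
    note T = test_function_sq_int[OF \<phi>[of n]]
    have wd: "has_weak_gradient \<Omega> (\<lambda>x. u x - \<phi> n x) (\<lambda>x. wgrad \<Omega> u x - grad (\<phi> n) x)"
      using has_weak_gradient_add[OF U(1) T(1) U(2) T(2) U(3) has_weak_gradient_test_function[OF \<phi>], of "-1"] by simp
    note W = wgrad_eq[OF sq_int_diff[OF U(2) T(2)] wd]
    have "L2norm M (wgrad \<Omega> (\<lambda>x. u x - \<phi> n x)) = L2norm M (\<lambda>x. wgrad \<Omega> u x - grad (\<phi> n) x)"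
      using W(1) sq_int_diff[OF U(2) T(2)] W(3) by (intro L2norm_cong_AE) (auto simp: sq_int_def)
    also have "\<dots> = L2norm M (\<lambda>x. grad (\<phi> n) x - wgrad \<Omega> u x)" by (rule L2norm_minus_commute)
    finally have 1: "L2norm M (\<lambda>x. grad (\<phi> n) x - wgrad \<Omega> u x) = L2norm M (wgrad \<Omega> (\<lambda>x. u x - \<phi> n x))" ..
    show "L2norm M (\<lambda>x. grad (\<phi> n) x - wgrad \<Omega> u x) \<le> H1_norm \<Omega> (\<lambda>x. u x - \<phi> n x)"
      unfolding 1 H1_norm_eq by (rule real_le_rsqrt) simp
    show "L2norm M (\<lambda>x. \<phi> n x - u x) \<le> H1_norm \<Omega> (\<lambda>x. u x - \<phi> n x)"
      unfolding L2norm_minus_commute[of M "\<phi> n"] H1_norm_eq by (rule real_le_rsqrt) simp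
  qed
  have "L2conv M \<phi> u"
    unfolding L2conv_def using test_function_sq_int(1)[OF \<phi>] U(1)
    by (auto intro!: tendsto_sandwich[OF _ _ tendsto_const lim] simp: le)
  moreover have "L2conv M (\<lambda>n. grad (\<phi> n)) (wgrad \<Omega> u)"
    unfolding L2conv_def using test_function_sq_int(2)[OF \<phi>] U(2)
    by (auto intro!: tendsto_sandwich[OF _ _ tendsto_const lim] simp: le)
  ultimately have "H1_limit \<phi> u (wgrad \<Omega> u)" using \<phi> by (simp add: H1_limit_def)
  then show thesis by (rule that)
qed

lemma H10_add:
  assumes "u \<in> H10 \<Omega>" "v \<in> H10 \<Omega>"
  shows "(\<lambda>x. u x + c * v x) \<in> H10 \<Omega>"
    and "AE x in M. wgrad \<Omega> (\<lambda>x. u x + c * v x) x = wgrad \<Omega> u x + c *\<^sub>R wgrad \<Omega> v x"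
proof -
  obtain \<phi> where \<phi>: "H1_limit \<phi> u (wgrad \<Omega> u)" by (rule H10_limit[OF assms(1)])
  obtain \<psi> where \<psi>: "H1_limit \<psi> v (wgrad \<Omega> v)" by (rule H10_limit[OF assms(2)])
  have "H1_limit (\<lambda>n x. \<phi> n x + c * \<psi> n x) (\<lambda>x. u x + c * v x) (\<lambda>x. wgrad \<Omega> u x + c *\<^sub>R wgrad \<Omega> v x)"
    unfolding H1_limit_def
  proof (intro conjI allI)
    have T: "\<And>n. \<phi> n \<in> test_functions \<Omega>" "\<And>n. \<psi> n \<in> test_functions \<Omega>"
      using \<phi> \<psi> by (auto simp: H1_limit_def)
    show "(\<lambda>x. \<phi> n x + c * \<psi> n x) \<in> test_functions \<Omega>" for n
      by (rule test_function_add_scale[OF T])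
    show "L2conv M (\<lambda>n x. \<phi> n x + c * \<psi> n x) (\<lambda>x. u x + c * v x)"
      using L2conv_add[of M \<phi> u \<psi> v c] \<phi> \<psi> by (simp add: H1_limit_def)
    have "L2conv M (\<lambda>n x. grad (\<phi> n) x + c *\<^sub>R grad (\<psi> n) x) (\<lambda>x. wgrad \<Omega> u x + c *\<^sub>R wgrad \<Omega> v x)"
      by (rule L2conv_add) (use \<phi> \<psi> in \<open>auto simp: H1_limit_def\<close>)
    moreover have "(\<lambda>n. grad (\<lambda>x. \<phi> n x + c * \<psi> n x)) = (\<lambda>n x. grad (\<phi> n) x + c *\<^sub>R grad (\<psi> n) x)"
      using grad_test_function_add_scale[OF T] by blast
    ultimately show "L2conv M (\<lambda>n. grad (\<lambda>x. \<phi> n x + c * \<psi> n x)) (\<lambda>x. wgrad \<Omega> u x + c *\<^sub>R wgrad \<Omega> v x)" by simp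
  qed
  then show "(\<lambda>x. u x + c * v x) \<in> H10 \<Omega>"
    "AE x in M. wgrad \<Omega> (\<lambda>x. u x + c * v x) x = wgrad \<Omega> u x + c *\<^sub>R wgrad \<Omega> v x"
    by (rule H1_limit_H10)+
qed

lemma H10_approx:
  assumes "u \<in> H10 \<Omega>" "e > 0"
  obtains \<phi> where "\<phi> \<in> test_functions \<Omega>" "L2norm M (\<lambda>x. \<phi> x - u x) < e"
    "L2norm M (\<lambda>x. grad \<phi> x - wgrad \<Omega> u x) < e"
proof -
  obtain \<phi> where \<phi>: "H1_limit \<phi> u (wgrad \<Omega> u)" by (rule H10_limit[OF assms(1)])
  have "\<forall>\<^sub>F n in sequentially. L2norm M (\<lambda>x. \<phi> n x - u x) < e"
    "\<forall>\<^sub>F n in sequentially. L2norm M (\<lambda>x. grad (\<phi> n) x - wgrad \<Omega> u x) < e"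
    using \<phi> \<open>e > 0\<close> by (auto simp: H1_limit_def L2conv_def intro: order_tendstoD)
  then have "\<forall>\<^sub>F n in sequentially. L2norm M (\<lambda>x. \<phi> n x - u x) < e
      \<and> L2norm M (\<lambda>x. grad (\<phi> n) x - wgrad \<Omega> u x) < e"
    by (rule eventually_conj)
  then obtain n where "L2norm M (\<lambda>x. \<phi> n x - u x) < e" "L2norm M (\<lambda>x. grad (\<phi> n) x - wgrad \<Omega> u x) < e"
    using eventually_happens'[OF sequentially_bot] by blast
  with \<phi> that[of "\<phi> n"] show thesis by (simp add: H1_limit_def)
qed

lemma H10_approx_seq:
  assumes "\<And>n. u n \<in> H10 \<Omega>"
  obtains \<phi> where "\<And>n. \<phi> n \<in> test_functions \<Omega>"
    "\<And>n. L2norm M (\<lambda>x. \<phi> n x - u n x) < 1 / real (Suc n)"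
    "\<And>n. L2norm M (\<lambda>x. grad (\<phi> n) x - wgrad \<Omega> (u n) x) < 1 / real (Suc n)"
proof -
  have "\<exists>\<phi>. \<phi> \<in> test_functions \<Omega> \<and> L2norm M (\<lambda>x. \<phi> x - u n x) < 1 / real (Suc n)
      \<and> L2norm M (\<lambda>x. grad \<phi> x - wgrad \<Omega> (u n) x) < 1 / real (Suc n)" for n
    by (rule H10_approx[OF assms, of "1 / real (Suc n)" n]) auto
  then obtain \<phi> where "\<forall>n. \<phi> n \<in> test_functions \<Omega> \<and> L2norm M (\<lambda>x. \<phi> n x - u n x) < 1 / real (Suc n)
      \<and> L2norm M (\<lambda>x. grad (\<phi> n) x - wgrad \<Omega> (u n) x) < 1 / real (Suc n)"
    using choice[of "\<lambda>n \<phi>. \<phi> \<in> test_functions \<Omega> \<and> L2norm M (\<lambda>x. \<phi> x - u n x) < 1 / real (Suc n)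
      \<and> L2norm M (\<lambda>x. grad \<phi> x - wgrad \<Omega> (u n) x) < 1 / real (Suc n)"] by blast
  then show thesis by (intro that[of \<phi>]) blast+
qed

lemma L2conv_perturb:
  fixes F G :: "nat \<Rightarrow> 'a \<Rightarrow> 'b::euclidean_space"
  assumes F: "L2conv M F f" and G: "\<And>n. G n \<in> sq_int M"
    and d: "\<And>n. L2norm M (\<lambda>x. G n x - F n x) < 1 / real (Suc n)"
  shows "L2conv M G f"
proof (rule L2conv_close[OF F G])
  have lim: "(\<lambda>n. 1 / real (Suc n)) \<longlonglongrightarrow> 0"
    using LIMSEQ_inverse_real_of_nat by (simp add: inverse_eq_divide)
  show "(\<lambda>n. L2norm M (\<lambda>x. G n x - F n x)) \<longlonglongrightarrow> 0"
    by (rule tendsto_sandwich[OF always_eventually always_eventually tendsto_const lim])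
      (use less_imp_le[OF d] in \<open>blast intro: L2norm_nonneg\<close>)+
qed

text \<open>Each member of the sequence is replaced by a test function within 1 / (n + 1) in both
  norms; the replacements converge to the same limits.\<close>

lemma H10_closed:
  assumes u: "\<And>n. u n \<in> H10 \<Omega>" and c: "L2conv M u v" "L2conv M (\<lambda>n. wgrad \<Omega> (u n)) G"
  shows "v \<in> H10 \<Omega>" "AE x in M. wgrad \<Omega> v x = G x"
proof -
  obtain \<phi> where \<phi>: "\<And>n. \<phi> n \<in> test_functions \<Omega>"
    "\<And>n. L2norm M (\<lambda>x. \<phi> n x - u n x) < 1 / real (Suc n)"
    "\<And>n. L2norm M (\<lambda>x. grad (\<phi> n) x - wgrad \<Omega> (u n) x) < 1 / real (Suc n)"
    by (rule H10_approx_seq[of u, OF u]) (rule that)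
  have "H1_limit \<phi> v G"
    unfolding H1_limit_def
    by (intro conjI allI \<phi>(1) L2conv_perturb[OF c(1) test_function_sq_int(1)[OF \<phi>(1)] \<phi>(2)]
        L2conv_perturb[OF c(2) test_function_sq_int(2)[OF \<phi>(1)] \<phi>(3)])
  then show "v \<in> H10 \<Omega>" "AE x in M. wgrad \<Omega> v x = G x" by (rule H1_limit_H10)+
qed

lemma H10_complete:
  assumes u: "\<And>n. u n \<in> H10 \<Omega>" and c: "L2Cauchy M u" "L2Cauchy M (\<lambda>n. wgrad \<Omega> (u n))"
  obtains v where "v \<in> H10 \<Omega>" "L2conv M u v" "L2conv M (\<lambda>n. wgrad \<Omega> (u n)) (wgrad \<Omega> v)"
proof -
  note U = H10_sq_int[OF u]
  obtain v where v: "L2conv M u v" using fin.L2_complete[OF U(1) c(1)] .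
  obtain G where G: "L2conv M (\<lambda>n. wgrad \<Omega> (u n)) G" using fin.L2_complete[OF U(2) c(2)] .
  note V = H10_closed[OF u v G]
  have "L2norm M (\<lambda>x. wgrad \<Omega> (u n) x - wgrad \<Omega> v x) = L2norm M (\<lambda>x. wgrad \<Omega> (u n) x - G x)" for n
    using V(2) U(2)[of n] L2convD(2)[OF G] H10_sq_int(2)[OF V(1)]
    by (intro L2norm_cong_AE) (auto simp: sq_int_def)
  then have "L2conv M (\<lambda>n. wgrad \<Omega> (u n)) (wgrad \<Omega> v)"
    using G H10_sq_int(2)[OF V(1)] by (simp add: L2conv_def)
  with V(1) v show thesis by (rule that)
qed

end

subsection \<open>Compactness\<close>

lemma L2norm_le_nn_integral:
  fixes f :: "'a \<Rightarrow> 'b::euclidean_space"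
  assumes "f \<in> borel_measurable M" "(\<integral>\<^sup>+x. (norm (f x))\<^sup>2 \<partial>M) \<le> ennreal (c\<^sup>2)" "0 \<le> c"
  shows "f \<in> sq_int M" "L2norm M f \<le> c"
proof -
  have "(\<integral>\<^sup>+x. (norm (f x))\<^sup>2 \<partial>M) < \<infinity>" using assms(2) by (rule order_le_less_trans) simp
  then show f: "f \<in> sq_int M" using assms(1) by (auto simp: sq_int_def integrable_iff_bounded)
  have "ennreal ((L2norm M f)\<^sup>2) = (\<integral>\<^sup>+x. (norm (f x))\<^sup>2 \<partial>M)"
    unfolding L2norm_power2 by (rule nn_integral_eq_integral[symmetric]) (use f in \<open>auto simp: sq_int_def\<close>)
  with assms(2) have "ennreal ((L2norm M f)\<^sup>2) \<le> ennreal (c\<^sup>2)" by (simp only:)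
  then have "(L2norm M f)\<^sup>2 \<le> c\<^sup>2" by (simp add: ennreal_le_iff)
  then show "L2norm M f \<le> c" using assms(3) by (rule power2_le_imp_le)
qed

lemma L2norm_lebesgue_on_le_lborel:
  fixes f :: "'a::euclidean_space \<Rightarrow> 'b::euclidean_space"
  assumes "f \<in> sq_int lborel" "S \<in> sets lebesgue"
  shows "L2norm (lebesgue_on S) f \<le> L2norm lborel f"
proof -
  have i: "integrable lebesgue (\<lambda>x. (norm (f x))\<^sup>2)"
    using assms(1) by (subst integrable_completion) (auto simp: sq_int_def)
  have "(LINT x|lebesgue_on S. (norm (f x))\<^sup>2) = (LINT x|lebesgue. indicator S x *\<^sub>R (norm (f x))\<^sup>2)"
    using assms(2) by (intro integral_restrict_space) auto
  also have "\<dots> \<le> (LINT x|lebesgue. (norm (f x))\<^sup>2)"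
    using i assms(2) by (intro integral_mono integrable_mult_indicator) (auto simp: indicator_def)
  also have "\<dots> = (LINT x|lborel. (norm (f x))\<^sup>2)"
    using assms(1) by (intro integral_completion) (auto simp: sq_int_def)
  finally show ?thesis unfolding L2norm_def by (rule real_sqrt_le_mono)
qed

section \<open>Translation estimates in L2\<close>

lemma test_function_translate_multiple:
  fixes w :: "'a::euclidean_space"
  assumes "\<phi> \<in> test_functions \<Omega>"
  shows "L2norm lborel (\<lambda>x. \<phi> (x + real k *\<^sub>R w) - \<phi> x) \<le> real k * L2norm lborel (\<lambda>x. \<phi> (x + w) - \<phi> x)"
proof (induction k)
  case (Suc k)
  note sq = test_function_sq_int_lborel(1)[OF assms]
  note m = test_function_measurable[OF assms]
  have "L2norm lborel (\<lambda>x. \<phi> (x + real (Suc k) *\<^sub>R w) - \<phi> x)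
      \<le> L2norm lborel (\<lambda>x. \<phi> (x + real (Suc k) *\<^sub>R w) - \<phi> (x + w)) + L2norm lborel (\<lambda>x. \<phi> (x + w) - \<phi> x)"
    by (intro L2norm_triangle_diff sq_int_lborel_translate sq)
  also have "L2norm lborel (\<lambda>x. \<phi> (x + real (Suc k) *\<^sub>R w) - \<phi> (x + w))
      = L2norm lborel (\<lambda>x. \<phi> (x + real k *\<^sub>R w) - \<phi> x)"
    using L2norm_lborel_translate[of "\<lambda>x. \<phi> (x + real k *\<^sub>R w) - \<phi> x" w] m
    by (simp add: algebra_simps)
  finally show ?case using Suc by (simp add: algebra_simps)
qed (simp add: L2norm_def)

text \<open>The shift by z is split into n + 1 equal shifts, each with the same norm of the
  increment. Hence the increment is bounded by the norm of the difference quotient with step 1 / (n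
  + 1), and this tends to the norm of the directional derivative.\<close>

lemma test_function_translate:
  fixes z :: "'a::euclidean_space"
  assumes "\<phi> \<in> test_functions \<Omega>"
  shows "L2norm lborel (\<lambda>x. \<phi> (x + z) - \<phi> x) \<le> norm z * L2norm lborel (grad \<phi>)"
proof -
  let ?q = "\<lambda>n x. (\<phi> (x + (1 / real (Suc n)) *\<^sub>R z) - \<phi> x) * real (Suc n)"
  note m = test_function_measurable[OF assms] test_function_grad_measurable[OF assms]
  obtain C R where CR: "\<And>n x. \<bar>?q n x\<bar> \<le> C * indicat_real (cball 0 R) x"
    by (rule test_function_difference_quotient_bound[OF assms, of z]) (rule that)
  have "L2conv lborel ?q (\<lambda>x. grad \<phi> x \<bullet> z)"
  proof (rule L2conv_dominated[where w = "\<lambda>x. C * indicat_real (cball 0 R) x"])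
    show "?q n \<in> borel_measurable lborel" for n using m by simp
    show "(\<lambda>x. grad \<phi> x \<bullet> z) \<in> borel_measurable lborel" using m by simp
    have "(\<lambda>x. (norm (C * indicat_real (cball (0::'a) R) x))\<^sup>2) = (\<lambda>x. C\<^sup>2 * indicat_real (cball 0 R) x)"
      by (auto simp: indicator_def)
    moreover have "(\<lambda>x. C * indicat_real (cball (0::'a) R) x) \<in> borel_measurable lborel"
      by (intro borel_measurable_times borel_measurable_indicator) auto
    ultimately show "(\<lambda>x. C * indicat_real (cball (0::'a) R) x) \<in> sq_int lborel"
      unfolding sq_int_def using integrable_indicator_cball[of "C\<^sup>2" "0::'a" R] by (simp only: mem_Collect_eq simp_thms)
    show "AE x in lborel. norm (?q n x) \<le> norm (C * indicat_real (cball 0 R) x)" for n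
      by (rule AE_I2, unfold real_norm_def) (rule order_trans[OF CR abs_ge_self])
    show "AE x in lborel. (\<lambda>n. ?q n x) \<longlonglongrightarrow> grad \<phi> x \<bullet> z"
      by (rule AE_I2) (rule test_function_difference_quotient[OF assms])
  qed
  then have lim: "(\<lambda>n. L2norm lborel (?q n)) \<longlonglongrightarrow> L2norm lborel (\<lambda>x. grad \<phi> x \<bullet> z)"
    by (rule L2conv_L2norm)
  have "L2norm lborel (\<lambda>x. \<phi> (x + z) - \<phi> x) \<le> L2norm lborel (?q n)" for n
  proof -
    have "L2norm lborel (?q n) = real (Suc n) * L2norm lborel (\<lambda>x. \<phi> (x + (1 / real (Suc n)) *\<^sub>R z) - \<phi> x)"
      using L2norm_scaleR[of lborel "real (Suc n)" "\<lambda>x. \<phi> (x + (1 / real (Suc n)) *\<^sub>R z) - \<phi> x"]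
      by (simp add: mult.commute)
    then show ?thesis
      using test_function_translate_multiple[OF assms, of "Suc n" "(1 / real (Suc n)) *\<^sub>R z"] by simp
  qed
  then have "L2norm lborel (\<lambda>x. \<phi> (x + z) - \<phi> x) \<le> L2norm lborel (\<lambda>x. grad \<phi> x \<bullet> z)"
    by (intro LIMSEQ_le_const[OF lim]) auto
  also have "\<dots> \<le> L2norm lborel (\<lambda>x. norm z *\<^sub>R grad \<phi> x)"
    using test_function_sq_int_lborel(2)[OF assms] m
    by (intro L2norm_mono sq_int_scaleR AE_I2) (auto simp: Cauchy_Schwarz_ineq2 mult.commute[of "norm z"])
  finally show ?thesis by (simp add: L2norm_scaleR)
qed

section \<open>Cube means as mollifiers\<close>

definition cube :: "real \<Rightarrow> 'a::euclidean_space set" where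
  "cube h = cbox 0 (h *\<^sub>R One)"

text \<open>The Steklov average over the cube with x as its lowest corner. It smooths enough for
  equicontinuity, while the translation estimate controls its distance to the function.\<close>

definition cube_mean :: "real \<Rightarrow> ('a::euclidean_space \<Rightarrow> real) \<Rightarrow> 'a \<Rightarrow> real" where
  "cube_mean h \<phi> x = (LINT z|lborel. indicator (cube h) z * \<phi> (x + z)) / h ^ DIM('a)"

lemma norm_cube:
  fixes z :: "'a::euclidean_space" and h :: real
  assumes z: "z \<in> cube h"
  shows "norm z \<le> DIM('a) * h"
proof -
  have "norm z \<le> (\<Sum>b\<in>Basis. \<bar>z \<bullet> b\<bar>)" by (rule norm_le_l1)
  also have "\<dots> \<le> (\<Sum>b\<in>(Basis::'a set). h)"
    using z by (intro sum_mono) (auto simp: cube_def mem_box)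
  finally show ?thesis by simp
qed

lemma indicator_cube_sq_int:
  "h \<ge> 0 \<Longrightarrow> indicat_real (cube h :: 'a::euclidean_space set) \<in> sq_int lborel"
  "h \<ge> 0 \<Longrightarrow> L2norm lborel (indicat_real (cube h :: 'a set)) = sqrt (h ^ DIM('a))"
proof -
  assume h: "h \<ge> 0"
  have e: "emeasure lborel (cube h :: 'a set) = ennreal (h ^ DIM('a))"
    unfolding cube_def using h by (subst emeasure_lborel_cbox_eq) (simp add: inner_Basis)
  have sq: "(\<lambda>x. (norm (indicat_real (cube h :: 'a set) x))\<^sup>2) = indicat_real (cube h)"
    by (auto simp: indicator_def)
  have [measurable]: "cube h \<in> sets (borel :: 'a measure)" by (simp add: cube_def)
  show "indicat_real (cube h :: 'a set) \<in> sq_int lborel"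
    unfolding sq_int_def mem_Collect_eq sq using e by (auto intro!: integrable_real_indicator)
  show "L2norm lborel (indicat_real (cube h :: 'a set)) = sqrt (h ^ DIM('a))"
    unfolding L2norm_def sq using h e by (simp add: measure_def)
qed

lemma cube_integral_bound:
  fixes f :: "'a::euclidean_space \<Rightarrow> real"
  assumes "f \<in> sq_int lborel" "h > 0"
  shows "\<bar>(LINT z|lborel. indicator (cube h) z * f z) / h ^ DIM('a)\<bar> \<le> L2norm lborel f / sqrt (h ^ DIM('a))"
proof -
  let ?q = "h ^ DIM('a)"
  have q: "?q > 0" using assms by simp
  have "\<bar>LINT z|lborel. indicator (cube h) z * f z\<bar> \<le> sqrt ?q * L2norm lborel f"
    using L2_Cauchy_Schwarz[OF indicator_cube_sq_int(1) assms(1), of h] assms(2) indicator_cube_sq_int(2)[of h, where 'a='a]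
    by simp
  then have "\<bar>LINT z|lborel. indicator (cube h) z * f z\<bar> / ?q \<le> sqrt ?q * L2norm lborel f / ?q"
    using q by (intro divide_right_mono) auto
  also have "sqrt ?q * L2norm lborel f / ?q = L2norm lborel f / sqrt ?q"
    using q sqrt_divide_self_eq[of ?q] by (simp add: divide_inverse mult_ac)
  finally show ?thesis using q by (simp add: abs_divide)
qed

context
  fixes \<phi> :: "'a::euclidean_space \<Rightarrow> real" and \<Omega> and h :: real
  assumes \<phi>: "\<phi> \<in> test_functions \<Omega>" and h: "h > 0"
begin

lemma translate_sq_int: "(\<lambda>z. \<phi> (x + z)) \<in> sq_int lborel"
  using sq_int_lborel_translate[OF test_function_sq_int_lborel(1)[OF \<phi>], of x] by (simp add: add.commute)

lemma cube_integrable: "integrable lborel (\<lambda>z. indicator (cube h) z * \<phi> (x + z))"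
  using integrable_mult_sq[OF indicator_cube_sq_int(1) translate_sq_int] h by simp

lemma cube_mean_bound: "\<bar>cube_mean h \<phi> x\<bar> \<le> L2norm lborel \<phi> / sqrt (h ^ DIM('a))"
  using cube_integral_bound[OF translate_sq_int h, of x]
    L2norm_lborel_translate[OF test_function_measurable[OF \<phi>], of x]
  by (simp add: cube_mean_def add.commute)

text \<open>The Lipschitz constant depends on the function only through the norm of its gradient,
  which is what makes a family with bounded gradients equicontinuous.\<close>

lemma cube_mean_lipschitz:
  "\<bar>cube_mean h \<phi> x - cube_mean h \<phi> y\<bar> \<le> norm (x - y) * L2norm lborel (grad \<phi>) / sqrt (h ^ DIM('a))"
proof -
  have eq: "cube_mean h \<phi> x - cube_mean h \<phi> y
      = (LINT z|lborel. indicator (cube h) z * (\<phi> (x + z) - \<phi> (y + z))) / h ^ DIM('a)"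
    using cube_integrable by (simp add: cube_mean_def right_diff_distrib diff_divide_distrib)
  have "L2norm lborel (\<lambda>z. \<phi> (x + z) - \<phi> (y + z)) = L2norm lborel (\<lambda>z. \<phi> (z + (x - y)) - \<phi> z)"
    using L2norm_lborel_translate[of "\<lambda>z. \<phi> (z + (x - y)) - \<phi> z" y] test_function_measurable[OF \<phi>]
    by (simp add: algebra_simps)
  also have "\<dots> \<le> norm (x - y) * L2norm lborel (grad \<phi>)" by (rule test_function_translate[OF \<phi>])
  finally have "L2norm lborel (\<lambda>z. \<phi> (x + z) - \<phi> (y + z)) / sqrt (h ^ DIM('a))
      \<le> norm (x - y) * L2norm lborel (grad \<phi>) / sqrt (h ^ DIM('a))"
    using h by (intro divide_right_mono) auto
  with cube_integral_bound[OF sq_int_diff[OF translate_sq_int translate_sq_int] h, of x y]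
  show ?thesis unfolding eq by linarith
qed

lemma cube_mean_continuous: "continuous_on UNIV (cube_mean h \<phi>)"
proof -
  let ?L = "L2norm lborel (grad \<phi>) / sqrt (h ^ DIM('a))"
  have "?L-lipschitz_on UNIV (cube_mean h \<phi>)"
    by (rule lipschitz_onI)
      (use cube_mean_lipschitz h in \<open>auto simp: dist_norm mult.commute\<close>)
  then show ?thesis by (rule lipschitz_on_continuous_on)
qed

text \<open>Pointwise, Cauchy-Schwarz bounds the squared deviation by the mean of the squared
  increments over the cube. After exchanging the integrals each increment is a translation by some z
  of length at most DIM * h.\<close>

lemma cube_mean_close:
  shows "(\<lambda>x. \<phi> x - cube_mean h \<phi> x) \<in> sq_int lborel"
    and "L2norm lborel (\<lambda>x. \<phi> x - cube_mean h \<phi> x) \<le> DIM('a) * h * L2norm lborel (grad \<phi>)"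
proof -
  let ?q = "h ^ DIM('a)" and ?c = "DIM('a) * h * L2norm lborel (grad \<phi>)"
  have q: "?q > 0" using h by simp
  have [measurable]: "\<phi> \<in> borel_measurable borel" "cube_mean h \<phi> \<in> borel_measurable borel"
    "cube h \<in> sets (borel :: 'a measure)"
    using test_function_measurable[OF \<phi>] cube_mean_continuous
    by (auto intro: borel_measurable_continuous_onI simp: cube_def)
  have pt: "ennreal ((norm (\<phi> x - cube_mean h \<phi> x))\<^sup>2)
      \<le> (\<integral>\<^sup>+z. ennreal (indicator (cube h) z * (\<phi> (x + z) - \<phi> x)\<^sup>2 / ?q) \<partial>lborel)" for x
  proof -
    have c: "(\<lambda>z. indicator (cube h) z * \<phi> x) \<in> sq_int lborel"
      using sq_int_mult[OF indicator_cube_sq_int(1)[of h], of "\<phi> x"] h by (simp add: mult.commute)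
    have p: "(\<lambda>z. indicator (cube h) z * \<phi> (x + z)) \<in> sq_int lborel"
      by (rule sq_int_bound[OF translate_sq_int[of x]]) (auto simp: indicator_def)
    have d: "(\<lambda>z. indicator (cube h) z * (\<phi> (x + z) - \<phi> x)) \<in> sq_int lborel"
      using sq_int_diff[OF p c] by (simp add: right_diff_distrib)
    have i1: "(LINT z|lborel. indicator (cube h :: 'a set) z * \<phi> x) = ?q * \<phi> x"
      using h by (simp add: cube_def measure_lborel_cbox_eq inner_Basis)
    have "\<phi> x - cube_mean h \<phi> x = - ((LINT z|lborel. indicator (cube h) z * \<phi> (x + z)) - ?q * \<phi> x) / ?q"
    proof -
      have "c - I / Q = - (I - Q * c) / Q" if "Q > 0" for c I Q :: real
        using that by (simp add: field_simps)
      then show ?thesis unfolding cube_mean_def using q .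
    qed
    \<comment> \<open>The indicator is written twice so that \<open>cube_integral_bound\<close> sees
      the truncated increment; otherwise the norm over the whole space would appear.\<close>
    also have "(LINT z|lborel. indicator (cube h) z * \<phi> (x + z)) - ?q * \<phi> x
        = (LINT z|lborel. indicator (cube h) z * (indicator (cube h) z * (\<phi> (x + z) - \<phi> x)))"
    proof -
      have "integrable lborel (\<lambda>z. indicator (cube h :: 'a set) z * \<phi> x)"
        using integrable_mult_sq[OF indicator_cube_sq_int(1)[of h] c] h
        by (simp add: mult.assoc[symmetric] indicator_inter_arith[symmetric])
      then have "(LINT z|lborel. indicator (cube h) z * \<phi> (x + z)) - ?q * \<phi> x
          = (LINT z|lborel. indicator (cube h) z * \<phi> (x + z) - indicator (cube h) z * \<phi> x)"
        unfolding i1[symmetric] using cube_integrable by (intro Bochner_Integration.integral_diff[symmetric])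
      also have "(\<lambda>z. indicator (cube h) z * \<phi> (x + z) - indicator (cube h) z * \<phi> x)
          = (\<lambda>z. indicator (cube h) z * (indicator (cube h) z * (\<phi> (x + z) - \<phi> x)))"
        by (auto simp: indicator_def)
      finally show ?thesis .
    qed
    finally have "norm (\<phi> x - cube_mean h \<phi> x)
        \<le> L2norm lborel (\<lambda>z. indicator (cube h) z * (\<phi> (x + z) - \<phi> x)) / sqrt ?q"
      using cube_integral_bound[OF d h] by simp
    then have "(norm (\<phi> x - cube_mean h \<phi> x))\<^sup>2
        \<le> (L2norm lborel (\<lambda>z. indicator (cube h) z * (\<phi> (x + z) - \<phi> x)) / sqrt ?q)\<^sup>2"
      by (intro power_mono) auto
    also have "\<dots> = (LINT z|lborel. (norm (indicator (cube h) z * (\<phi> (x + z) - \<phi> x)))\<^sup>2) / ?q"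
      using q by (simp add: power_divide L2norm_power2)
    also have "(\<lambda>z. (norm (indicator (cube h) z * (\<phi> (x + z) - \<phi> x)))\<^sup>2)
        = (\<lambda>z. indicator (cube h) z * (\<phi> (x + z) - \<phi> x)\<^sup>2)"
      by (auto simp: indicator_def)
    also have "(LINT z|lborel. indicator (cube h) z * (\<phi> (x + z) - \<phi> x)\<^sup>2) / ?q
        = (LINT z|lborel. indicator (cube h) z * (\<phi> (x + z) - \<phi> x)\<^sup>2 / ?q)"
      by simp
    finally have "ennreal ((norm (\<phi> x - cube_mean h \<phi> x))\<^sup>2)
        \<le> ennreal (LINT z|lborel. indicator (cube h) z * (\<phi> (x + z) - \<phi> x)\<^sup>2 / ?q)"
      by (rule ennreal_leI)
    also have "\<dots> = (\<integral>\<^sup>+z. ennreal (indicator (cube h) z * (\<phi> (x + z) - \<phi> x)\<^sup>2 / ?q) \<partial>lborel)"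
    proof (rule nn_integral_eq_integral[symmetric])
      have "(\<lambda>z. (norm (indicator (cube h) z * (\<phi> (x + z) - \<phi> x)))\<^sup>2)
          = (\<lambda>z. indicator (cube h) z * (\<phi> (x + z) - \<phi> x)\<^sup>2)"
        by (auto simp: indicator_def)
      with sq_int_integrable[OF d] show "integrable lborel (\<lambda>z. indicator (cube h) z * (\<phi> (x + z) - \<phi> x)\<^sup>2 / ?q)"
        by simp
    qed (use q in auto)
    finally show ?thesis .
  qed
  have "(\<integral>\<^sup>+x. ennreal ((norm (\<phi> x - cube_mean h \<phi> x))\<^sup>2) \<partial>lborel)
      \<le> (\<integral>\<^sup>+x. (\<integral>\<^sup>+z. ennreal (indicator (cube h) z * (\<phi> (x + z) - \<phi> x)\<^sup>2 / ?q) \<partial>lborel) \<partial>lborel)"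
    by (rule nn_integral_mono) (rule pt)
  also have "\<dots> = (\<integral>\<^sup>+z. (\<integral>\<^sup>+x. ennreal (indicator (cube h) z * (\<phi> (x + z) - \<phi> x)\<^sup>2 / ?q) \<partial>lborel) \<partial>lborel)"
    by (rule lborel_pair.Fubini') measurable
  also have "\<dots> \<le> (\<integral>\<^sup>+z. ennreal (?c\<^sup>2 / ?q) * indicator (cube h :: 'a set) z \<partial>lborel)"
  proof (rule nn_integral_mono)
    fix z :: 'a
    show "(\<integral>\<^sup>+x. ennreal (indicator (cube h) z * (\<phi> (x + z) - \<phi> x)\<^sup>2 / ?q) \<partial>lborel)
        \<le> ennreal (?c\<^sup>2 / ?q) * indicator (cube h) z"
    proof (cases "z \<in> cube h")
      case True
      have sq: "(\<lambda>x. \<phi> (x + z) - \<phi> x) \<in> sq_int lborel"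
        by (intro sq_int_diff sq_int_lborel_translate test_function_sq_int_lborel(1)[OF \<phi>])
      have "L2norm lborel (\<lambda>x. \<phi> (x + z) - \<phi> x) \<le> norm z * L2norm lborel (grad \<phi>)"
        by (rule test_function_translate[OF \<phi>])
      also have "\<dots> \<le> ?c" using norm_cube[OF True] by (intro mult_right_mono) auto
      finally have "(L2norm lborel (\<lambda>x. \<phi> (x + z) - \<phi> x))\<^sup>2 \<le> ?c\<^sup>2" by (intro power_mono) auto
      then have "(LINT x|lborel. (\<phi> (x + z) - \<phi> x)\<^sup>2 / ?q) \<le> ?c\<^sup>2 / ?q"
        using q by (simp add: L2norm_power2 divide_right_mono)
      moreover have "(\<integral>\<^sup>+x. ennreal ((\<phi> (x + z) - \<phi> x)\<^sup>2 / ?q) \<partial>lborel)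
          = ennreal (LINT x|lborel. (\<phi> (x + z) - \<phi> x)\<^sup>2 / ?q)"
        using sq_int_integrable[OF sq] q by (intro nn_integral_eq_integral) auto
      ultimately show ?thesis using True by (simp add: ennreal_leI)
    qed simp
  qed
  also have "\<dots> = ennreal (?c\<^sup>2 / ?q) * emeasure lborel (cube h :: 'a set)"
    by (rule nn_integral_cmult_indicator) simp
  also have "emeasure lborel (cube h :: 'a set) = ennreal ?q"
    unfolding cube_def using h by (subst emeasure_lborel_cbox_eq) (simp add: inner_Basis)
  also have "ennreal (?c\<^sup>2 / ?q) * ennreal ?q = ennreal (?c\<^sup>2)"
    using q by (simp add: ennreal_mult[symmetric])
  finally have *: "(\<integral>\<^sup>+x. ennreal ((norm (\<phi> x - cube_mean h \<phi> x))\<^sup>2) \<partial>lborel) \<le> ennreal (?c\<^sup>2)" .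
  have mm: "(\<lambda>x. \<phi> x - cube_mean h \<phi> x) \<in> borel_measurable lborel" by measurable
  have c0: "?c \<ge> 0" using h by simp
  show "(\<lambda>x. \<phi> x - cube_mean h \<phi> x) \<in> sq_int lborel"
    "L2norm lborel (\<lambda>x. \<phi> x - cube_mean h \<phi> x) \<le> ?c"
    using L2norm_le_nn_integral[OF mm * c0] by auto
qed

end

section \<open>The Poincare inequality and Rellich compactness\<close>

context bounded_open
begin

text \<open>A shift longer than the diameter separates the function from its translate. Where the
  translate is nonzero the increment equals it, so the translation estimate bounds the function
  itself. The length 2 * R + 1 exceeds the diameter of a domain inside the ball of radius R.\<close>

lemma poincare_test_functions:
  obtains P where "P > 0" "\<And>\<phi>. \<phi> \<in> test_functions \<Omega> \<Longrightarrow> L2norm lborel \<phi> \<le> P * L2norm lborel (grad \<phi>)"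
proof -
  obtain R where R: "R > 0" "\<And>x. x \<in> \<Omega> \<Longrightarrow> norm x \<le> R"
    using bounded_dom bounded_pos by metis
  obtain b :: 'a where b: "b \<in> Basis" using nonempty_Basis by blast
  define z where "z = (2 * R + 1) *\<^sub>R b"
  have nz: "norm z = 2 * R + 1" using b R by (simp add: z_def)
  have "L2norm lborel \<phi> \<le> (2 * R + 1) * L2norm lborel (grad \<phi>)" if \<phi>: "\<phi> \<in> test_functions \<Omega>" for \<phi>
  proof -
    note sq = test_function_sq_int_lborel(1)[OF \<phi>]
    have disj: "\<phi> (x + z) = 0 \<or> \<phi> x = 0" for x
    proof (rule ccontr)
      assume "\<not> ?thesis"
      then have "norm (x + z) \<le> R" "norm x \<le> R" using R test_function_outside(1)[OF \<phi>] by blast+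
      with norm_triangle_ineq4[of "x + z" x] nz show False by simp
    qed
    have "L2norm lborel \<phi> = L2norm lborel (\<lambda>x. \<phi> (x + z))"
      using L2norm_lborel_translate[OF test_function_measurable[OF \<phi>]] by simp
    also have "\<dots> \<le> L2norm lborel (\<lambda>x. \<phi> (x + z) - \<phi> x)"
    proof (rule L2norm_mono)
      show "AE x in lborel. norm (\<phi> (x + z)) \<le> norm (\<phi> (x + z) - \<phi> x)"
      proof (rule AE_I2)
        fix x
        show "norm (\<phi> (x + z)) \<le> norm (\<phi> (x + z) - \<phi> x)" using disj[of x] by auto
      qed
    qed (intro sq_int_diff sq_int_measurable sq_int_lborel_translate sq)+
    also have "\<dots> \<le> norm z * L2norm lborel (grad \<phi>)" by (rule test_function_translate[OF \<phi>])
    finally show ?thesis by (simp add: nz)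
  qed
  with R show thesis by (intro that[of "2 * R + 1"]) auto
qed

text \<open>For one fixed tolerance. The cube means at a suitable scale are bounded and
  equicontinuous, so Arzela-Ascoli makes a subsequence of them converge uniformly; two errors of
  mollification and one of uniform convergence, each at most e / 4, stay below e.\<close>

lemma rellich_step:
  assumes \<phi>: "\<And>n. \<phi> n \<in> test_functions \<Omega>" and K: "\<And>n. L2norm lborel (grad (\<phi> n)) \<le> K" and e: "e > 0"
  shows "\<exists>r::nat\<Rightarrow>nat. strict_mono r \<and> (\<exists>N. \<forall>m\<ge>N. \<forall>n\<ge>N. L2norm M (\<lambda>x. \<phi> (r m) x - \<phi> (r n) x) < e)"
proof -
  have K0: "K \<ge> 0" using K[of 0] L2norm_nonneg[of lborel "grad (\<phi> 0)"] by linarith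
  obtain P where P: "P > 0" "\<And>\<phi>. \<phi> \<in> test_functions \<Omega> \<Longrightarrow> L2norm lborel \<phi> \<le> P * L2norm lborel (grad \<phi>)"
    by (rule poincare_test_functions) (rule that)
  obtain R where R: "\<And>x. x \<in> \<Omega> \<Longrightarrow> norm x \<le> R" using bounded_dom bounded_iff by metis
  \<comment> \<open>Chosen so that the mollification error DIM * h * K is at most e / 4; K + 1
    covers the case K = 0.\<close>
  define h where "h = e / (4 * DIM('a) * (K + 1))"
  have h: "h > 0" using e K0 by (simp add: h_def)
  have hK: "DIM('a) * h * K \<le> e / 4"
  proof -
    have "D * (e / (4 * D * K1)) * K = e / 4 * (K / K1)" if "D > 0" "K1 > 0" for D K1
      using that by (simp add: field_simps)
    then have "DIM('a) * h * K = e / 4 * (K / (K + 1))" unfolding h_def using K0 by simp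
    also have "\<dots> \<le> e / 4 * 1" using e K0 by (intro mult_left_mono) (auto simp: field_simps)
    finally show ?thesis by simp
  qed
  let ?s = "sqrt (h ^ DIM('a))"
  have s: "?s > 0" using h by simp
  obtain g k where gk: "continuous_on (cball 0 R) g" "strict_mono (k :: nat \<Rightarrow> nat)"
     "\<And>e. 0 < e \<Longrightarrow> \<exists>N. \<forall>n x. n \<ge> N \<and> x \<in> cball 0 R \<longrightarrow> norm (cube_mean h (\<phi> (k n)) x - g x) < e"
  proof (rule Arzela_Ascoli[of "cball 0 R" "\<lambda>n. cube_mean h (\<phi> n)" "P * K / ?s"])
    show "norm (cube_mean h (\<phi> n) x) \<le> P * K / ?s" for n x
    proof -
      have "norm (cube_mean h (\<phi> n) x) \<le> L2norm lborel (\<phi> n) / ?s"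
        using cube_mean_bound[OF \<phi> h] by simp
      also have "\<dots> \<le> P * K / ?s"
        using s order_trans[OF P(2)[OF \<phi>[of n]] mult_left_mono[OF K[of n]]] P(1)
        by (intro divide_right_mono) auto
      finally show ?thesis .
    qed
    show "\<exists>d. 0 < d \<and> (\<forall>n y. y \<in> cball 0 R \<and> norm (x - y) < d
        \<longrightarrow> norm (cube_mean h (\<phi> n) x - cube_mean h (\<phi> n) y) < e')" if "0 < e'" for x e'
    proof (intro exI conjI allI impI)
      show "0 < e' * ?s / (K + 1)" using that s K0 by simp
      fix n y assume y: "y \<in> cball 0 R \<and> norm (x - y) < e' * ?s / (K + 1)"
      have "norm (cube_mean h (\<phi> n) x - cube_mean h (\<phi> n) y) \<le> norm (x - y) * L2norm lborel (grad (\<phi> n)) / ?s"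
        using cube_mean_lipschitz[OF \<phi> h] by simp
      also have "\<dots> \<le> norm (x - y) * (K + 1) / ?s"
        using K[of n] s by (intro divide_right_mono mult_left_mono) auto
      also have "\<dots> < e' * ?s / (K + 1) * (K + 1) / ?s"
        using y s K0 by (intro divide_strict_right_mono mult_strict_right_mono) auto
      also have "\<dots> = e'" using s K0 h by simp
      finally show "norm (cube_mean h (\<phi> n) x - cube_mean h (\<phi> n) y) < e'" .
    qed
  qed auto
  \<comment> \<open>Two cube means, each within d of the uniform limit, differ by at most 2 * d
    pointwise, hence by at most e / 4 in L2.\<close>
  define d where "d = e / (8 * (sqrt (measure M (space M)) + 1))"
  have d: "d > 0" using e by (simp add: d_def add_nonneg_pos)
  obtain N where N: "\<And>n x. n \<ge> N \<Longrightarrow> x \<in> cball 0 R \<Longrightarrow> norm (cube_mean h (\<phi> (k n)) x - g x) < d"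
    using gk(3)[OF d] by blast
  have "L2norm M (\<lambda>x. \<phi> (k m) x - \<phi> (k n) x) < e" if mn: "m \<ge> N" "n \<ge> N" for m n
  proof -
    let ?S = "\<lambda>n. cube_mean h (\<phi> (k n))"
    note close = cube_mean_close[OF \<phi> h]
    have cl: "(\<lambda>x. \<phi> (k n) x - ?S n x) \<in> sq_int M" "L2norm M (\<lambda>x. \<phi> (k n) x - ?S n x) \<le> e / 4" for n
    proof -
      show "(\<lambda>x. \<phi> (k n) x - ?S n x) \<in> sq_int M"
        using close(1) dom_sets by (rule sq_int_lborel_lebesgue_on)
      have "L2norm M (\<lambda>x. \<phi> (k n) x - ?S n x) \<le> L2norm lborel (\<lambda>x. \<phi> (k n) x - ?S n x)"
        using close(1) dom_sets by (rule L2norm_lebesgue_on_le_lborel)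
      also have "\<dots> \<le> DIM('a) * h * L2norm lborel (grad (\<phi> (k n)))" by (rule close(2))
      also have "\<dots> \<le> DIM('a) * h * K" using K h by (intro mult_left_mono) auto
      finally show "L2norm M (\<lambda>x. \<phi> (k n) x - ?S n x) \<le> e / 4" using hK by linarith
    qed
    have Sq: "?S n \<in> sq_int M" for n
      using sq_int_diff[OF test_function_sq_int(1)[OF \<phi>[of "k n"]] cl(1)[of n]] by simp
    have const: "(\<lambda>x. 2 * d) \<in> sq_int M" by (simp add: sq_int_def)
    have "L2norm M (\<lambda>x. ?S m x - ?S n x) \<le> L2norm M (\<lambda>x. 2 * d)"
    proof (rule L2norm_mono[OF const])
      show "AE x in M. norm (?S m x - ?S n x) \<le> norm (2 * d)"
      proof (rule AE_I2)
        fix x assume "x \<in> space M"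
        then have "x \<in> cball 0 R" using R by simp
        from N[OF mn(1) this] N[OF mn(2) this] show "norm (?S m x - ?S n x) \<le> norm (2 * d)"
          by (simp add: abs_le_iff) linarith
      qed
    qed (use sq_int_diff[OF Sq Sq] in \<open>auto simp: sq_int_def\<close>)
    also have "\<dots> = 2 * d * sqrt (measure M (space M))"
      using d by (simp add: L2norm_def real_sqrt_mult)
    also have "\<dots> = e / 4 * (sqrt (measure M (space M)) / (sqrt (measure M (space M)) + 1))"
    proof -
      have "2 * (e / (8 * Y)) * X = e / 4 * (X / Y)" for X Y by simp
      then show ?thesis unfolding d_def .
    qed
    also have "\<dots> \<le> e / 4 * 1"
      using e by (intro mult_left_mono) (auto simp: divide_le_eq add_nonneg_pos)
    finally have S: "L2norm M (\<lambda>x. ?S m x - ?S n x) \<le> e / 4" by simp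
    have "L2norm M (\<lambda>x. \<phi> (k m) x - \<phi> (k n) x)
        \<le> L2norm M (\<lambda>x. \<phi> (k m) x - ?S m x) + L2norm M (\<lambda>x. ?S m x - \<phi> (k n) x)"
      by (intro L2norm_triangle_diff Sq test_function_sq_int \<phi>)
    also have "L2norm M (\<lambda>x. ?S m x - \<phi> (k n) x)
        \<le> L2norm M (\<lambda>x. ?S m x - ?S n x) + L2norm M (\<lambda>x. ?S n x - \<phi> (k n) x)"
      by (intro L2norm_triangle_diff Sq test_function_sq_int \<phi>)
    also have "L2norm M (\<lambda>x. ?S n x - \<phi> (k n) x) = L2norm M (\<lambda>x. \<phi> (k n) x - ?S n x)"
      by (rule L2norm_minus_commute)
    finally show ?thesis using cl(2)[of m] cl(2)[of n] S e by linarith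
  qed
  then show ?thesis using gk(2) by blast
qed

text \<open>Diagonal argument over the tolerances 1 / (j + 1). Being eventually within a tolerance
  is inherited by subsequences, which is the stability that the diagonal sequence requires.\<close>

lemma rellich_test_functions:
  assumes \<phi>: "\<And>n. \<phi> n \<in> test_functions \<Omega>" and K: "\<And>n. L2norm lborel (grad (\<phi> n)) \<le> K"
  obtains r :: "nat \<Rightarrow> nat" where "strict_mono r" "L2Cauchy M (\<lambda>n. \<phi> (r n))"
proof -
  define P where "P j s \<longleftrightarrow> (\<exists>N. \<forall>m\<ge>N. \<forall>n\<ge>N. L2norm M (\<lambda>x. \<phi> (s m) x - \<phi> (s n) x) < 1 / real (Suc j))"
    for j and s :: "nat \<Rightarrow> nat"
  interpret subseqs P
  proof
    fix j and s :: "nat \<Rightarrow> nat"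
    show "\<exists>r. strict_mono r \<and> P j (s \<circ> r)"
      unfolding P_def o_def using rellich_step[of "\<lambda>n. \<phi> (s n)" K "1 / real (Suc j)"] \<phi> K by simp
  qed
  have stable: "P j (s \<circ> r)" if r: "strict_mono r" and s: "P j s" for r s :: "nat \<Rightarrow> nat" and j
  proof -
    obtain N where N: "\<forall>m\<ge>N. \<forall>n\<ge>N. L2norm M (\<lambda>x. \<phi> (s m) x - \<phi> (s n) x) < 1 / real (Suc j)"
      using s unfolding P_def by blast
    have "N \<le> r m" if "N \<le> m" for m
      using seq_suble[OF r, of m] that by linarith
    with N show ?thesis unfolding P_def o_def by blast
  qed
  have "L2Cauchy M (\<lambda>n. \<phi> (diagseq n))"
    unfolding L2Cauchy_def
  proof (intro allI impI)
    fix e :: real assume "e > 0"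
    then obtain j where j: "1 / real (Suc j) < e" using nat_approx_posE by blast
    \<comment> \<open>The j-th property is available for the diagonal sequence from index
      \<open>Suc j\<close> on, hence the offset in the thresholds below.\<close>
    have "P j (diagseq \<circ> ((+) (Suc j)))" using stable by (rule diagseq_holds)
    then obtain N where N: "\<And>m n. m \<ge> N \<Longrightarrow> n \<ge> N \<Longrightarrow>
        L2norm M (\<lambda>x. \<phi> (diagseq (Suc j + m)) x - \<phi> (diagseq (Suc j + n)) x) < 1 / real (Suc j)"
      unfolding P_def o_def by blast
    have "L2norm M (\<lambda>x. \<phi> (diagseq m) x - \<phi> (diagseq n) x) < e" if "m \<ge> N + Suc j" "n \<ge> N + Suc j" for m n
    proof -
      have "Suc j + (m - Suc j) = m" "Suc j + (n - Suc j) = n" "N \<le> m - Suc j" "N \<le> n - Suc j"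
        using that by auto
      with N[of "m - Suc j" "n - Suc j"] j show ?thesis by simp
    qed
    then show "\<exists>N. \<forall>m\<ge>N. \<forall>n\<ge>N. L2norm M (\<lambda>x. \<phi> (diagseq m) x - \<phi> (diagseq n) x) < e" by blast
  qed
  with subseq_diagseq show thesis by (rule that)
qed

lemma poincare:
  obtains P where "P > 0" "\<And>u. u \<in> H10 \<Omega> \<Longrightarrow> L2norm M u \<le> P * L2norm M (wgrad \<Omega> u)"
proof -
  obtain P where P: "P > 0" "\<And>\<phi>. \<phi> \<in> test_functions \<Omega> \<Longrightarrow> L2norm lborel \<phi> \<le> P * L2norm lborel (grad \<phi>)"
    by (rule poincare_test_functions) (rule that)
  have "L2norm M u \<le> P * L2norm M (wgrad \<Omega> u)" if u: "u \<in> H10 \<Omega>" for u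
  proof -
    obtain \<phi> where \<phi>: "H1_limit \<phi> u (wgrad \<Omega> u)" by (rule H10_limit[OF u])
    then have l: "(\<lambda>n. L2norm M (\<phi> n)) \<longlonglongrightarrow> L2norm M u"
      "(\<lambda>n. P * L2norm M (grad (\<phi> n))) \<longlonglongrightarrow> P * L2norm M (wgrad \<Omega> u)"
      by (auto simp: H1_limit_def intro!: tendsto_mult tendsto_const L2conv_L2norm)
    have "L2norm M (\<phi> n) \<le> P * L2norm M (grad (\<phi> n))" for n
      using P(2) \<phi> by (simp add: H1_limit_def test_function_L2norm)
    then show ?thesis by (intro LIMSEQ_le[OF l]) auto
  qed
  with P(1) show thesis by (rule that)
qed

lemma rellich:
  assumes u: "\<And>n. u n \<in> H10 \<Omega>" and K: "\<And>n. L2norm M (wgrad \<Omega> (u n)) \<le> K"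
  obtains r :: "nat \<Rightarrow> nat" where "strict_mono r" "L2Cauchy M (\<lambda>n. u (r n))"
proof -
  note U = H10_sq_int[OF u]
  obtain \<phi> where \<phi>: "\<And>n. \<phi> n \<in> test_functions \<Omega>"
    "\<And>n. L2norm M (\<lambda>x. \<phi> n x - u n x) < 1 / real (Suc n)"
    "\<And>n. L2norm M (\<lambda>x. grad (\<phi> n) x - wgrad \<Omega> (u n) x) < 1 / real (Suc n)"
    by (rule H10_approx_seq[of u, OF u]) (rule that)
  note T = test_function_sq_int[OF \<phi>(1)]
  have K1: "L2norm lborel (grad (\<phi> n)) \<le> K + 1" for n
  proof -
    have "L2norm M (grad (\<phi> n)) \<le> L2norm M (\<lambda>x. grad (\<phi> n) x - wgrad \<Omega> (u n) x) + L2norm M (wgrad \<Omega> (u n))"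
      using L2norm_triangle[OF sq_int_diff[OF T(2) U(2)] U(2), of n n n] by simp
    also have "\<dots> \<le> 1 + K"
    proof (rule add_mono[OF _ K])
      have "1 / real (Suc n) \<le> 1" by simp
      with \<phi>(3)[of n] show "L2norm M (\<lambda>x. grad (\<phi> n) x - wgrad \<Omega> (u n) x) \<le> 1" by linarith
    qed
    finally show ?thesis using test_function_L2norm(2)[OF \<phi>(1)] by simp
  qed
  obtain r :: "nat \<Rightarrow> nat" where r: "strict_mono r" "L2Cauchy M (\<lambda>n. \<phi> (r n))"
    by (rule rellich_test_functions[of \<phi> "K + 1", OF \<phi>(1) K1]) (rule that)
  obtain f where f: "L2conv M (\<lambda>n. \<phi> (r n)) f"
    using fin.L2_complete[OF T(1) r(2)] .
  have "L2conv M (\<lambda>n. u (r n)) f"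
  proof (rule L2conv_perturb[OF f U(1)])
    fix n
    have "L2norm M (\<lambda>x. u (r n) x - \<phi> (r n) x) < 1 / real (Suc (r n))"
      using \<phi>(2)[of "r n"] by (simp add: L2norm_minus_commute[of M "u (r n)"])
    also have "\<dots> \<le> 1 / real (Suc n)"
      using seq_suble[OF r(1), of n] by (intro divide_left_mono) auto
    finally show "L2norm M (\<lambda>x. u (r n) x - \<phi> (r n) x) < 1 / real (Suc n)" .
  qed
  then have "L2Cauchy M (\<lambda>n. u (r n))" by (rule L2conv_imp_Cauchy)
  with r(1) show thesis by (rule that)
qed

end

subsection \<open>The first eigenvalue as a minimum\<close>

lemma L2conv_bounded_scaleR:
  assumes F: "L2conv M F f" and a: "a \<in> borel_measurable M" "\<And>x. \<bar>a x\<bar> \<le> C"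
  shows "L2conv M (\<lambda>n x. a x *\<^sub>R F n x) (\<lambda>x. a x *\<^sub>R f x)"
  unfolding L2conv_def
proof (intro conjI allI)
  note F' = L2convD[OF F]
  show sq: "(\<lambda>x. a x *\<^sub>R F n x) \<in> sq_int M" "(\<lambda>x. a x *\<^sub>R f x) \<in> sq_int M" for n
    using sq_int_bounded_scaleR[OF _ a(1) AE_I2[OF a(2)]] F' by auto
  have le: "L2norm M (\<lambda>x. a x *\<^sub>R F n x - a x *\<^sub>R f x) \<le> \<bar>C\<bar> * L2norm M (\<lambda>x. F n x - f x)" for n
  proof -
    have d: "(\<lambda>x. F n x - f x) \<in> sq_int M" by (rule sq_int_diff[OF F'(1) F'(2)])
    have "L2norm M (\<lambda>x. a x *\<^sub>R F n x - a x *\<^sub>R f x) \<le> L2norm M (\<lambda>x. C *\<^sub>R (F n x - f x))"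
    proof (rule L2norm_mono[OF sq_int_scaleR[OF d]])
      show "(\<lambda>x. a x *\<^sub>R F n x - a x *\<^sub>R f x) \<in> borel_measurable M"
        using sq_int_diff[OF sq] by (rule sq_int_measurable)
      show "AE x in M. norm (a x *\<^sub>R F n x - a x *\<^sub>R f x) \<le> norm (C *\<^sub>R (F n x - f x))"
      proof (rule AE_I2)
        fix x
        have "\<bar>a x\<bar> * norm (F n x - f x) \<le> \<bar>C\<bar> * norm (F n x - f x)"
          using a(2)[of x] by (intro mult_right_mono) auto
        then show "norm (a x *\<^sub>R F n x - a x *\<^sub>R f x) \<le> norm (C *\<^sub>R (F n x - f x))"
          by (simp add: scaleR_diff_right[symmetric])
      qed
    qed
    then show ?thesis by (simp add: L2norm_scaleR)
  qed
  have lim: "(\<lambda>n. \<bar>C\<bar> * L2norm M (\<lambda>x. F n x - f x)) \<longlonglongrightarrow> 0"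
    using tendsto_mult[OF tendsto_const F'(3), of "\<bar>C\<bar>"] by simp
  show "(\<lambda>n. L2norm M (\<lambda>x. a x *\<^sub>R F n x - a x *\<^sub>R f x)) \<longlonglongrightarrow> 0"
    by (rule tendsto_sandwich[OF always_eventually always_eventually tendsto_const lim])
      (use le in \<open>blast intro: L2norm_nonneg\<close>)+
qed

lemma L2_inner_add_left:
  assumes "u \<in> sq_int M" "v \<in> sq_int M" "w \<in> sq_int M"
  shows "(LINT x|M. (u x + c *\<^sub>R v x) \<bullet> w x) = (LINT x|M. u x \<bullet> w x) + c * (LINT x|M. v x \<bullet> w x)"
  using integrable_inner[OF assms(1,3)] integrable_inner[OF assms(2,3)] by (simp add: inner_add_left)

context bounded_open
begin

definition mass :: "('a \<Rightarrow> real) \<Rightarrow> ('a \<Rightarrow> real) \<Rightarrow> real" where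
  "mass u v = (LINT x|M. u x * v x)"

definition energy :: "('a \<Rightarrow> real) \<Rightarrow> ('a \<Rightarrow> real) \<Rightarrow> ('a \<Rightarrow> real) \<Rightarrow> real" where
  "energy a u v = (LINT x|M. a x * (wgrad \<Omega> u x \<bullet> wgrad \<Omega> v x))"

lemma mass_self: "mass u u = (L2norm M u)\<^sup>2"
  unfolding mass_def L2norm_power2 by (simp add: power2_eq_square)

lemma mass_nonneg: "0 \<le> mass u u"
  by (simp add: mass_self)

lemma sym_form_mass: "sym_form (H10 \<Omega>) mass"
proof
  show "(\<lambda>x. u x + c * v x) \<in> H10 \<Omega>" if "u \<in> H10 \<Omega>" "v \<in> H10 \<Omega>" for u v c
    using that by (rule H10_add)
  show "mass u v = mass v u" for u v by (simp add: mass_def mult.commute)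
  show "mass (\<lambda>x. u x + c * v x) w = mass u w + c * mass v w"
    if "u \<in> H10 \<Omega>" "v \<in> H10 \<Omega>" "w \<in> H10 \<Omega>" for u v w c
    using L2_inner_add_left[OF H10_sq_int(1)[OF that(1)] H10_sq_int(1)[OF that(2)] H10_sq_int(1)[OF that(3)], of c]
    by (simp add: mass_def)
qed

lemma mass_pos_iff:
  assumes "u \<in> sq_int M"
  shows "mass u u > 0 \<longleftrightarrow> \<not> (AE x in M. u x = 0)"
proof -
  have "mass u u = 0 \<longleftrightarrow> (AE x in M. u x * u x = 0)"
    unfolding mass_def using integrable_mult_sq[OF assms assms] by (intro integral_nonneg_eq_0_iff_AE) auto
  then have "mass u u = 0 \<longleftrightarrow> (AE x in M. u x = 0)" by simp
  with mass_nonneg[of u] show ?thesis by linarith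
qed

text \<open>The lower bound c is a parameter that may be 0: this covers the degenerate weight
  supported on B, while coercivity is drawn from c > 0 where it is required.\<close>

definition coeff :: "real \<Rightarrow> real \<Rightarrow> ('a \<Rightarrow> real) \<Rightarrow> bool" where
  "coeff c C a \<longleftrightarrow> a \<in> borel_measurable M \<and> (\<forall>x. c \<le> a x \<and> a x \<le> C)"

lemma coeff_abs:
  assumes "coeff c C a"
  shows "\<bar>a x\<bar> \<le> \<bar>c\<bar> + \<bar>C\<bar>"
proof -
  have "c \<le> a x" "a x \<le> C" using assms by (auto simp: coeff_def)
  then show ?thesis by linarith
qed

lemma coeff_sq_int:
  assumes "coeff c C a" "f \<in> sq_int M"
  shows "(\<lambda>x. a x *\<^sub>R f x) \<in> sq_int M"
  using assms(1) by (intro sq_int_bounded_scaleR[OF assms(2) _ AE_I2[OF coeff_abs[OF assms(1)]]]) (simp add: coeff_def)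

text \<open>The gradient of a combination equals the combination of the gradients only almost
  everywhere, so additivity passes through equality of integrals rather than of integrands.\<close>

lemma sym_form_energy:
  assumes a: "coeff c C a"
  shows "sym_form (H10 \<Omega>) (energy a)"
proof
  show "(\<lambda>x. u x + c * v x) \<in> H10 \<Omega>" if "u \<in> H10 \<Omega>" "v \<in> H10 \<Omega>" for u v c
    using that by (rule H10_add)
  show "energy a u v = energy a v u" for u v by (simp add: energy_def inner_commute)
  show "energy a (\<lambda>x. u x + d * v x) w = energy a u w + d * energy a v w"
    if uvw: "u \<in> H10 \<Omega>" "v \<in> H10 \<Omega>" "w \<in> H10 \<Omega>" for u v w d
  proof -
    note G = H10_sq_int(2)[OF uvw(1)] H10_sq_int(2)[OF uvw(2)]
    note W = coeff_sq_int[OF a H10_sq_int(2)[OF uvw(3)]]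
    have e: "energy a u w = (LINT x|M. wgrad \<Omega> u x \<bullet> (a x *\<^sub>R wgrad \<Omega> w x))" for u
      by (simp add: energy_def)
    have "energy a (\<lambda>x. u x + d * v x) w = (LINT x|M. (wgrad \<Omega> u x + d *\<^sub>R wgrad \<Omega> v x) \<bullet> (a x *\<^sub>R wgrad \<Omega> w x))"
      unfolding e
    proof (rule integral_cong_AE)
      show "(\<lambda>x. wgrad \<Omega> (\<lambda>x. u x + d * v x) x \<bullet> (a x *\<^sub>R wgrad \<Omega> w x)) \<in> borel_measurable M"
        using integrable_inner[OF H10_sq_int(2)[OF H10_add(1)[OF uvw(1,2)]] W] by (rule borel_measurable_integrable)
      show "(\<lambda>x. (wgrad \<Omega> u x + d *\<^sub>R wgrad \<Omega> v x) \<bullet> (a x *\<^sub>R wgrad \<Omega> w x)) \<in> borel_measurable M"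
        using integrable_inner[OF sq_int_add[OF G(1) sq_int_scaleR[OF G(2)]] W] by (rule borel_measurable_integrable)
      show "AE x in M. wgrad \<Omega> (\<lambda>x. u x + d * v x) x \<bullet> (a x *\<^sub>R wgrad \<Omega> w x)
          = (wgrad \<Omega> u x + d *\<^sub>R wgrad \<Omega> v x) \<bullet> (a x *\<^sub>R wgrad \<Omega> w x)"
        using H10_add(2)[OF uvw(1,2), of d] by eventually_elim simp
    qed
    also have "\<dots> = energy a u w + d * energy a v w"
      unfolding e by (rule L2_inner_add_left[OF G W])
    finally show ?thesis .
  qed
qed

lemma energy_integrable:
  assumes "coeff c C a" "u \<in> H10 \<Omega>" "v \<in> H10 \<Omega>"
  shows "integrable M (\<lambda>x. a x * (wgrad \<Omega> u x \<bullet> wgrad \<Omega> v x))"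
  using integrable_inner[OF coeff_sq_int[OF assms(1) H10_sq_int(2)[OF assms(2)]] H10_sq_int(2)[OF assms(3)]] by simp

lemma energy_mono:
  assumes "coeff c C a" "coeff c' C' a'" "\<And>x. a x \<le> a' x" "u \<in> H10 \<Omega>"
  shows "energy a u u \<le> energy a' u u"
  unfolding energy_def
  by (rule integral_mono[OF energy_integrable[OF assms(1,4,4)] energy_integrable[OF assms(2,4,4)]])
    (use assms(3) in \<open>auto intro: mult_right_mono\<close>)

lemma energy_lower:
  assumes "coeff c C a" "u \<in> H10 \<Omega>"
  shows "c * (L2norm M (wgrad \<Omega> u))\<^sup>2 \<le> energy a u u"
proof -
  have "energy (\<lambda>x. c) u u \<le> energy a u u"
    by (rule energy_mono[of c c _ c C]) (use assms in \<open>auto simp: coeff_def\<close>)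
  then show ?thesis by (simp add: energy_def L2norm_power2 power2_norm_eq_inner)
qed

lemma energy_limit:
  assumes a: "coeff c C a" and U: "L2conv M (\<lambda>n. wgrad \<Omega> (u n)) (wgrad \<Omega> v)"
  shows "(\<lambda>n. energy a (u n) (u n)) \<longlonglongrightarrow> energy a v v"
proof -
  have "L2conv M (\<lambda>n x. a x *\<^sub>R wgrad \<Omega> (u n) x) (\<lambda>x. a x *\<^sub>R wgrad \<Omega> v x)"
    by (rule L2conv_bounded_scaleR[OF U _ coeff_abs[OF a]]) (use a in \<open>simp add: coeff_def\<close>)
  from L2conv_inner[OF this U] show ?thesis by (simp add: energy_def)
qed

text \<open>Taking \<open>w = 0\<close> gives the unconstrained minimum of the Rayleigh quotient. The minimizing
  sequence is Cauchy in \<open>L2\<close> by compactness, and then Cauchy in energy by the parallelogram law.\<close>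

lemma rayleigh_minimizer:
  assumes a: "coeff c C a" and c: "c > 0" and w: "w \<in> sq_int M"
    and ex: "\<exists>v\<in>H10 \<Omega>. mass v v > 0 \<and> mass v w = 0"
  obtains u where "u \<in> H10 \<Omega>" "mass u u = 1" "mass u w = 0"
    "\<And>v. v \<in> H10 \<Omega> \<Longrightarrow> mass v w = 0 \<Longrightarrow> energy a u u * mass v v \<le> energy a v v"
proof -
  interpret E: sym_form "H10 \<Omega>" "energy a" by (rule sym_form_energy[OF a])
  interpret I: sym_form "H10 \<Omega>" mass by (rule sym_form_mass)
  have mass_w: "mass (\<lambda>x. u x + d * v x) w = mass u w + d * mass v w" if "u \<in> H10 \<Omega>" "v \<in> H10 \<Omega>" for u v d
    using L2_inner_add_left[OF H10_sq_int(1)[OF that(1)] H10_sq_int(1)[OF that(2)] w, of d] by (simp add: mass_def)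
  have scale: "\<exists>v'. v' \<in> H10 \<Omega> \<and> mass v' w = 0 \<and> mass v' v' = 1 \<and> energy a v v = mass v v * energy a v' v'"
    if v: "v \<in> H10 \<Omega>" "mass v w = 0" "mass v v > 0" for v
  proof -
    \<comment> \<open>Normalisation of v, with the multiple written as v + s v to fit the closure
      property of the space.\<close>
    define s where "s = 1 / sqrt (mass v v) - 1"
    have s: "(1 + s)\<^sup>2 * mass v v = 1" using v(3) by (simp add: s_def power_divide)
    have "mass (\<lambda>x. v x + s * v x) (\<lambda>x. v x + s * v x) = (1 + s)\<^sup>2 * mass v v"
      using I.add_both[OF v(1,1), of s] by (simp add: power2_eq_square algebra_simps)
    moreover have "energy a (\<lambda>x. v x + s * v x) (\<lambda>x. v x + s * v x) = (1 + s)\<^sup>2 * energy a v v"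
      using E.add_both[OF v(1,1), of s] by (simp add: power2_eq_square algebra_simps)
    then have "mass v v * energy a (\<lambda>x. v x + s * v x) (\<lambda>x. v x + s * v x) = ((1 + s)\<^sup>2 * mass v v) * energy a v v"
      by simp
    ultimately show ?thesis
      using s mass_w[OF v(1,1), of s] v(2) H10_add(1)[OF v(1,1), of s] by (intro exI[of _ "\<lambda>x. v x + s * v x"]) simp
  qed
  define W where "W = {v \<in> H10 \<Omega>. mass v w = 0 \<and> mass v v = 1}"
  have E0: "0 \<le> energy a v v" if "v \<in> H10 \<Omega>" for v
    using energy_lower[OF a that] c by (smt (verit) mult_nonneg_nonneg zero_le_power2)
  define \<mu> where "\<mu> = Inf ((\<lambda>v. energy a v v) ` W)"
  have ne: "(\<lambda>v. energy a v v) ` W \<noteq> {}" using ex scale unfolding W_def by blast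
  have bdd: "bdd_below ((\<lambda>v. energy a v v) ` W)" by (rule bdd_belowI[of _ 0]) (auto simp: W_def E0)
  have \<mu>0: "\<mu> \<ge> 0" unfolding \<mu>_def using ne by (rule cInf_greatest) (auto simp: W_def E0)
  have \<mu>le: "\<mu> \<le> energy a v v" if "v \<in> W" for v unfolding \<mu>_def using that bdd by (intro cInf_lower) auto
  have ray: "\<mu> * mass v v \<le> energy a v v" if v: "v \<in> H10 \<Omega>" "mass v w = 0" for v
  proof (cases "mass v v > 0")
    case True
    from scale[OF v True] obtain v' where v': "v' \<in> W" "energy a v v = mass v v * energy a v' v'"
      unfolding W_def by blast
    from \<mu>le[OF v'(1)] True show ?thesis unfolding v'(2) by (simp add: mult.commute)
  next
    case False
    then have "mass v v = 0" using mass_nonneg[of v] by linarith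
    with E0[OF v(1)] show ?thesis by simp
  qed
  have "\<exists>v. v \<in> W \<and> energy a v v < \<mu> + 1 / real (Suc n)" for n
  proof -
    have "\<mu> < \<mu> + 1 / real (Suc n)" by simp
    then show ?thesis unfolding \<mu>_def using cInf_lessD[OF ne] by blast
  qed
  then obtain v where v: "\<And>n. v n \<in> W" "\<And>n. energy a (v n) (v n) < \<mu> + 1 / real (Suc n)" by metis
  have vH: "v n \<in> H10 \<Omega>" "mass (v n) w = 0" "mass (v n) (v n) = 1" for n using v(1)[of n] by (auto simp: W_def)
  have vK: "L2norm M (wgrad \<Omega> (v n)) \<le> sqrt ((\<mu> + 1) / c)" for n
  proof (rule real_le_rsqrt)
    have "1 / real (Suc n) \<le> 1" by simp
    with v(2)[of n] energy_lower[OF a vH(1), of n] have "c * (L2norm M (wgrad \<Omega> (v n)))\<^sup>2 \<le> \<mu> + 1" by linarith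
    with c show "(L2norm M (wgrad \<Omega> (v n)))\<^sup>2 \<le> (\<mu> + 1) / c" by (simp add: field_simps)
  qed
  obtain r :: "nat \<Rightarrow> nat" where r: "strict_mono r" "L2Cauchy M (\<lambda>n. v (r n))"
    by (rule rellich[of v "sqrt ((\<mu> + 1) / c)", OF vH(1) vK]) (rule that)
  define z where "z n = v (r n)" for n
  have zH: "z n \<in> H10 \<Omega>" "mass (z n) w = 0" "mass (z n) (z n) = 1" for n using vH by (auto simp: z_def)
  have zE: "energy a (z n) (z n) < \<mu> + 1 / real (Suc n)" for n
  proof -
    have "1 / real (Suc (r n)) \<le> 1 / real (Suc n)"
      using seq_suble[OF r(1), of n] by (intro divide_left_mono) auto
    with v(2)[of "r n"] show ?thesis by (simp add: z_def)
  qed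
  have zC: "L2Cauchy M z" using r(2) by (simp add: z_def[abs_def])
  \<comment> \<open>Parallelogram law: the energy of the difference is twice the two energies minus
    the energy of the sum, and the latter is at least \<mu> times the mass of the sum by
    \<open>ray\<close>. The excesses of the two energies over \<mu> are at most 1 / (m + 1) and 1 /
    (n + 1).\<close>
  have par: "energy a (\<lambda>x. z m x + (-1) * z n x) (\<lambda>x. z m x + (-1) * z n x)
      \<le> 2 / real (Suc m) + 2 / real (Suc n) + \<mu> * mass (\<lambda>x. z m x + (-1) * z n x) (\<lambda>x. z m x + (-1) * z n x)" for m n
  proof -
    have p: "\<mu> * mass (\<lambda>x. z m x + 1 * z n x) (\<lambda>x. z m x + 1 * z n x)
        \<le> energy a (\<lambda>x. z m x + 1 * z n x) (\<lambda>x. z m x + 1 * z n x)"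
      using zH mass_w[OF zH(1) zH(1), where d = 1] by (intro ray H10_add(1)) auto
    have "\<mu> * (2 + 2 * mass (z m) (z n)) \<le> energy a (z m) (z m) + 2 * energy a (z m) (z n) + energy a (z n) (z n)"
      using p unfolding I.add_both[OF zH(1) zH(1)] E.add_both[OF zH(1) zH(1)] using zH(3) by simp
    then have "energy a (z m) (z m) - 2 * energy a (z m) (z n) + energy a (z n) (z n)
        \<le> 2 * (energy a (z m) (z m) - \<mu>) + 2 * (energy a (z n) (z n) - \<mu>) + \<mu> * (2 - 2 * mass (z m) (z n))"
      by (simp add: algebra_simps)
    moreover have "2 * (energy a (z n) (z n) - \<mu>) \<le> 2 / real (Suc n)" for n
      using zE[of n] by simp
    from this[of m] this[of n] have "2 * (energy a (z m) (z m) - \<mu>) + 2 * (energy a (z n) (z n) - \<mu>) \<le> 2 / real (Suc m) + 2 / real (Suc n)"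
      by (rule add_mono)
    ultimately have "energy a (z m) (z m) - 2 * energy a (z m) (z n) + energy a (z n) (z n)
        \<le> 2 / real (Suc m) + 2 / real (Suc n) + \<mu> * (2 - 2 * mass (z m) (z n))" by linarith
    then show ?thesis
      unfolding I.add_both[OF zH(1) zH(1)] E.add_both[OF zH(1) zH(1)] using zH(3) by simp
  qed
  have gC: "L2Cauchy M (\<lambda>n. wgrad \<Omega> (z n))"
    unfolding L2Cauchy_def
  proof (intro allI impI)
    fix e :: real assume e: "e > 0"
    \<comment> \<open>Three contributions of at most d each give 3 * c * e^2 / 4, strictly below c *
      e^2.\<close>
    define d where "d = c * e\<^sup>2 / 4"
    have d: "d > 0" using c e by (simp add: d_def)
    have "sqrt (d / (\<mu> + 1)) > 0" using d \<mu>0 by simp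
    then obtain N1 where N1: "\<And>m n. m \<ge> N1 \<Longrightarrow> n \<ge> N1 \<Longrightarrow> L2norm M (\<lambda>x. z m x - z n x) < sqrt (d / (\<mu> + 1))"
      using zC unfolding L2Cauchy_def by blast
    obtain N2 where N2: "2 / d < real N2" using reals_Archimedean2 by blast
    have small: "2 / real (Suc n) \<le> d" if "n \<ge> N2" for n
    proof -
      have "2 / d < real (Suc n)" using N2 that by linarith
      then show ?thesis using d by (simp add: field_simps)
    qed
    have "L2norm M (\<lambda>x. wgrad \<Omega> (z m) x - wgrad \<Omega> (z n) x) < e" if mn: "m \<ge> max N1 N2" "n \<ge> max N1 N2" for m n
    proof -
      let ?y = "\<lambda>x. z m x + (-1) * z n x"
      have yH: "?y \<in> H10 \<Omega>" by (rule H10_add(1)[OF zH(1) zH(1)])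
      have "L2norm M (\<lambda>x. wgrad \<Omega> (z m) x - wgrad \<Omega> (z n) x) = L2norm M (wgrad \<Omega> ?y)"
        using H10_add(2)[OF zH(1)[of m] zH(1)[of n], of "-1"]
          sq_int_diff[OF H10_sq_int(2)[OF zH(1)[of m]] H10_sq_int(2)[OF zH(1)[of n]]] H10_sq_int(2)[OF yH]
        by (intro L2norm_cong_AE) (auto simp: sq_int_def)
      moreover have "L2norm M (wgrad \<Omega> ?y) < e"
      proof -
        have "mass ?y ?y \<le> d / (\<mu> + 1)"
        proof -
          have "(L2norm M ?y)\<^sup>2 \<le> (sqrt (d / (\<mu> + 1)))\<^sup>2"
            using N1[of m n] mn by (intro power_mono) auto
          then show ?thesis using d \<mu>0 by (simp add: mass_self)
        qed
        then have "\<mu> * mass ?y ?y \<le> \<mu> * (d / (\<mu> + 1))" using \<mu>0 by (rule mult_left_mono)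
        also have "\<dots> \<le> d" using d \<mu>0 by (simp add: field_simps)
        finally have "\<mu> * mass ?y ?y \<le> d" .
        moreover have "2 / real (Suc m) \<le> d" "2 / real (Suc n) \<le> d" using small mn by simp_all
        ultimately have "energy a ?y ?y \<le> d + d + d" using par[of m n] by linarith
        then have "c * (L2norm M (wgrad \<Omega> ?y))\<^sup>2 \<le> c * (3 * e\<^sup>2 / 4)"
          using energy_lower[OF a yH] by (simp add: d_def)
        then have "(L2norm M (wgrad \<Omega> ?y))\<^sup>2 \<le> 3 * e\<^sup>2 / 4" using c by (simp only: mult_le_cancel_left_pos)
        also have "\<dots> < e\<^sup>2" using e by simp
        finally have "(L2norm M (wgrad \<Omega> ?y))\<^sup>2 < e\<^sup>2" .
        then show ?thesis by (rule power2_less_imp_less) (use e in simp)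
      qed
      ultimately show ?thesis by simp
    qed
    then show "\<exists>N. \<forall>m\<ge>N. \<forall>n\<ge>N. L2norm M (\<lambda>x. wgrad \<Omega> (z m) x - wgrad \<Omega> (z n) x) < e" by blast
  qed
  obtain u where u: "u \<in> H10 \<Omega>" "L2conv M z u" "L2conv M (\<lambda>n. wgrad \<Omega> (z n)) (wgrad \<Omega> u)"
    by (rule H10_complete[of z, OF zH(1) zC gC]) (rule that)
  have m1: "mass u u = 1"
    using L2conv_inner[OF u(2,2)] zH(3) LIMSEQ_unique[OF _ tendsto_const[of 1 sequentially]]
    by (simp add: mass_def LIMSEQ_const_iff)
  have m0: "mass u w = 0"
    using L2conv_inner[OF u(2) L2conv_const[OF w]] zH(2) by (simp add: mass_def LIMSEQ_const_iff)
  have "energy a u u \<le> \<mu>"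
  proof (rule LIMSEQ_le[OF energy_limit[OF a u(3)]])
    show "(\<lambda>n. \<mu> + 1 / real (Suc n)) \<longlonglongrightarrow> \<mu>"
      using tendsto_add[OF tendsto_const LIMSEQ_inverse_real_of_nat, of \<mu>] by (simp add: inverse_eq_divide)
    show "\<exists>N. \<forall>n\<ge>N. energy a (z n) (z n) \<le> \<mu> + 1 / real (Suc n)" using zE less_imp_le by blast
  qed
  with \<mu>le[of u] u(1) m0 m1 have "energy a u u = \<mu>" by (simp add: W_def)
  with ray u(1) m0 m1 show thesis by (intro that[of u]) auto
qed

lemma eigenfunction_iff:
  "eigenfunction \<Omega> a \<mu> u \<longleftrightarrow> u \<in> H10 \<Omega> \<and> mass u u > 0 \<and> (\<forall>v\<in>H10 \<Omega>. energy a u v = \<mu> * mass u v)"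
  using mass_pos_iff[OF H10_sq_int(1)] by (auto simp: eigenfunction_def energy_def mass_def)

lemma minimizer_eigenfunction:
  assumes a: "coeff c C a" and u: "u \<in> H10 \<Omega>" "mass u u > 0" "energy a u u = \<mu> * mass u u"
    and min: "\<And>v. v \<in> H10 \<Omega> \<Longrightarrow> \<mu> * mass v v \<le> energy a v v"
  shows "eigenfunction \<Omega> a \<mu> u"
  unfolding eigenfunction_iff
proof (intro conjI ballI u)
  fix v assume v: "v \<in> H10 \<Omega>"
  interpret F: sym_form "H10 \<Omega>" "\<lambda>u v. energy a u v + (- \<mu>) * mass u v"
    by (rule sym_form_plus[OF sym_form_energy[OF a] sym_form_mass])
  have "energy a u v + (- \<mu>) * mass u v = 0"
    by (rule F.minimizer_stationary[OF _ u(1) _ v]) (use min u(3) in auto)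
  then show "energy a u v = \<mu> * mass u v" by simp
qed

text \<open>Every eigenvalue is the Rayleigh quotient of its own eigenfunction, hence not below the
  minimum, and the minimum is itself an eigenvalue. So the LEAST exists and is the minimum.\<close>

lemma first_eigenvalue_minimal:
  assumes a: "coeff c C a" and c: "c > 0" and ex: "\<exists>v\<in>H10 \<Omega>. mass v v > 0"
  shows "\<exists>u. eigenfunction \<Omega> a (first_eigenvalue \<Omega> a) u"
    and "v \<in> H10 \<Omega> \<Longrightarrow> first_eigenvalue \<Omega> a * mass v v \<le> energy a v v"
proof -
  have w: "(\<lambda>x. 0::real) \<in> sq_int M" by simp
  have m0: "mass v (\<lambda>x. 0) = 0" for v by (simp add: mass_def)
  obtain u where u: "u \<in> H10 \<Omega>" "mass u u = 1"
    and min: "\<And>v. v \<in> H10 \<Omega> \<Longrightarrow> energy a u u * mass v v \<le> energy a v v"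
  proof (rule rayleigh_minimizer[OF a c w])
    show "\<exists>v\<in>H10 \<Omega>. 0 < mass v v \<and> mass v (\<lambda>x. 0) = 0" using ex m0 by simp
  qed (simp add: m0)
  define \<mu> where "\<mu> = energy a u u"
  have e: "eigenfunction \<Omega> a \<mu> u"
    by (rule minimizer_eigenfunction[OF a u(1)]) (use u min in \<open>auto simp: \<mu>_def\<close>)
  have "first_eigenvalue \<Omega> a = \<mu>"
    unfolding first_eigenvalue_def
  proof (rule Least_equality)
    show "\<exists>u. eigenfunction \<Omega> a \<mu> u" using e by blast
    fix \<nu> assume "\<exists>u. eigenfunction \<Omega> a \<nu> u"
    then obtain v where v: "v \<in> H10 \<Omega>" "mass v v > 0" "energy a v v = \<nu> * mass v v"
      by (auto simp: eigenfunction_iff)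
    with min[OF v(1)] show "\<mu> \<le> \<nu>" by (simp add: \<mu>_def)
  qed
  with e min show "\<exists>u. eigenfunction \<Omega> a (first_eigenvalue \<Omega> a) u"
    "v \<in> H10 \<Omega> \<Longrightarrow> first_eigenvalue \<Omega> a * mass v v \<le> energy a v v" by (auto simp: \<mu>_def)
qed

end

subsection \<open>Positive parts\<close>

context bounded_open
begin

text \<open>Chain rule by approximation. A subsequence of the test functions converges almost
  everywhere; this is what makes the factor F' converge, about which L2 convergence alone says
  nothing pointwise.\<close>

lemma H10_compose:
  assumes u: "u \<in> H10 \<Omega>" and F: "derivatives F" and F0: "F 0 0 = 0" and C: "\<And>t. \<bar>F (Suc 0) t\<bar> \<le> C"
  shows "(\<lambda>x. F 0 (u x)) \<in> H10 \<Omega>"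
    and "AE x in M. wgrad \<Omega> (\<lambda>x. F 0 (u x)) x = F (Suc 0) (u x) *\<^sub>R wgrad \<Omega> u x"
proof -
  obtain \<phi>' where \<phi>': "H1_limit \<phi>' u (wgrad \<Omega> u)" by (rule H10_limit[OF u])
  then have "L2conv M \<phi>' u" by (simp add: H1_limit_def)
  then obtain r :: "nat \<Rightarrow> nat" where r: "strict_mono r" "AE x in M. (\<lambda>n. \<phi>' (r n) x) \<longlonglongrightarrow> u x"
    by (rule L2conv_AE_subseq)
  define \<phi> where "\<phi> n = \<phi>' (r n)" for n
  have \<phi>: "\<And>n. \<phi> n \<in> test_functions \<Omega>" and c1: "L2conv M \<phi> u" and c2: "L2conv M (\<lambda>n. grad (\<phi> n)) (wgrad \<Omega> u)"
    and ae: "AE x in M. (\<lambda>n. \<phi> n x) \<longlonglongrightarrow> u x"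
    using \<phi>' r by (auto simp: H1_limit_def \<phi>_def[abs_def] intro: L2conv_subseq)
  note U = H10_sq_int[OF u]
  have dF: "(F n has_real_derivative F (Suc n) t) (at t)" for n t using F by (simp add: derivatives_def)
  have cont: "continuous_on UNIV (F n)" for n
    using dF by (auto simp: continuous_on_eq_continuous_at intro: DERIV_isCont)
  have Fm: "F n \<in> borel_measurable borel" for n by (rule borel_measurable_continuous_onI[OF cont])
  have C0: "C \<ge> 0" using C[of 0] by linarith
  have lip: "\<bar>F 0 s - F 0 t\<bar> \<le> C * \<bar>s - t\<bar>" for s t
    using field_differentiable_bound[of UNIV "F 0" "F (Suc 0)" C s t] dF C by auto
  define \<psi> where "\<psi> n x = F 0 (\<phi> n x)" for n x
  have \<psi>: "\<psi> n \<in> test_functions \<Omega>" for n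
    unfolding \<psi>_def[abs_def] by (rule test_function_compose[OF \<phi> F F0])
  have g\<psi>: "grad (\<psi> n) x = F (Suc 0) (\<phi> n x) *\<^sub>R grad (\<phi> n) x" for n x
    unfolding \<psi>_def[abs_def] by (rule grad_test_function_compose[OF \<phi> dF])
  have um: "u \<in> borel_measurable M" using U(1) by (simp add: sq_int_def)
  have Fum: "(\<lambda>x. F n (u x)) \<in> borel_measurable M" for n by (rule measurable_compose[OF um Fm])
  have Fu: "(\<lambda>x. F 0 (u x)) \<in> sq_int M"
  proof (rule sq_int_bound[OF sq_int_mult[OF U(1), of C] Fum])
    show "AE x in M. norm (F 0 (u x)) \<le> norm (C * u x)"
      using lip[of _ 0] F0 C0 by (intro AE_I2) (auto simp: abs_mult)
  qed
  have "L2conv M \<psi> (\<lambda>x. F 0 (u x))"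
    unfolding L2conv_def
  proof (intro conjI allI test_function_sq_int(1)[OF \<psi>] Fu)
    have le: "L2norm M (\<lambda>x. \<psi> n x - F 0 (u x)) \<le> C * L2norm M (\<lambda>x. \<phi> n x - u x)" for n
    proof -
      have d: "(\<lambda>x. \<phi> n x - u x) \<in> sq_int M" by (rule sq_int_diff[OF test_function_sq_int(1)[OF \<phi>] U(1)])
      have "L2norm M (\<lambda>x. \<psi> n x - F 0 (u x)) \<le> L2norm M (\<lambda>x. C *\<^sub>R (\<phi> n x - u x))"
        by (rule L2norm_mono[OF sq_int_scaleR[OF d]
              sq_int_measurable[OF sq_int_diff[OF test_function_sq_int(1)[OF \<psi>] Fu]]])
          (use lip C0 in \<open>auto simp: \<psi>_def abs_mult\<close>)
      then show ?thesis using C0 by (simp only: L2norm_scaleR abs_of_nonneg)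
    qed
    have lim: "(\<lambda>n. C * L2norm M (\<lambda>x. \<phi> n x - u x)) \<longlonglongrightarrow> 0"
      using tendsto_mult[OF tendsto_const L2convD(3)[OF c1], of C] by simp
    show "(\<lambda>n. L2norm M (\<lambda>x. \<psi> n x - F 0 (u x))) \<longlonglongrightarrow> 0"
      by (rule tendsto_sandwich[OF always_eventually always_eventually tendsto_const lim])
        (use le in \<open>blast intro: L2norm_nonneg\<close>)+
  qed
  moreover have "L2conv M (\<lambda>n. grad (\<psi> n)) (\<lambda>x. F (Suc 0) (u x) *\<^sub>R wgrad \<Omega> u x)"
  proof (rule L2conv_close)
    have Fpm: "(\<lambda>x. F (Suc 0) (\<phi> n x)) \<in> borel_measurable M" for n
      by (rule measurable_compose[OF sq_int_measurable[OF test_function_sq_int(1)[OF \<phi>]] Fm])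
    have gm: "wgrad \<Omega> u \<in> borel_measurable M" using U(2) by (rule sq_int_measurable)
    have bd: "norm (F (Suc 0) t *\<^sub>R v) \<le> norm (C *\<^sub>R v)" for t and v :: 'a
      using C[of t] C0 by (simp add: mult_right_mono)
    \<comment> \<open>The gradient of the composition is compared with an intermediate expression
      whose outer factor is already approximated but whose gradient is the limit one. It converges
      by domination; the remaining difference is at most C times the error of the gradients.\<close>
    show mid: "L2conv M (\<lambda>n x. F (Suc 0) (\<phi> n x) *\<^sub>R wgrad \<Omega> u x) (\<lambda>x. F (Suc 0) (u x) *\<^sub>R wgrad \<Omega> u x)"
    proof (rule L2conv_dominated[OF _ _ sq_int_scaleR[OF U(2), of C]])
      show "AE x in M. (\<lambda>n. F (Suc 0) (\<phi> n x) *\<^sub>R wgrad \<Omega> u x) \<longlonglongrightarrow> F (Suc 0) (u x) *\<^sub>R wgrad \<Omega> u x"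
        using ae
      proof eventually_elim
        case (elim x)
        have "isCont (F (Suc 0)) (u x)" by (rule DERIV_isCont[OF dF])
        from isCont_tendsto_compose[OF this elim] show ?case by (intro tendsto_scaleR tendsto_const)
      qed
    qed (use bd Fpm Fum gm in auto)
    show "grad (\<psi> n) \<in> sq_int M" for n by (rule test_function_sq_int(2)[OF \<psi>])
    have le: "L2norm M (\<lambda>x. grad (\<psi> n) x - F (Suc 0) (\<phi> n x) *\<^sub>R wgrad \<Omega> u x)
        \<le> C * L2norm M (\<lambda>x. grad (\<phi> n) x - wgrad \<Omega> u x)" for n
    proof -
      have d: "(\<lambda>x. grad (\<phi> n) x - wgrad \<Omega> u x) \<in> sq_int M" by (rule sq_int_diff[OF test_function_sq_int(2)[OF \<phi>] U(2)])
      have "L2norm M (\<lambda>x. grad (\<psi> n) x - F (Suc 0) (\<phi> n x) *\<^sub>R wgrad \<Omega> u x)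
          \<le> L2norm M (\<lambda>x. C *\<^sub>R (grad (\<phi> n) x - wgrad \<Omega> u x))"
      proof (rule L2norm_mono[OF sq_int_scaleR[OF d]
              sq_int_measurable[OF sq_int_diff[OF test_function_sq_int(2)[OF \<psi>] L2convD(1)[OF mid]]]])
        show "AE x in M. norm (grad (\<psi> n) x - F (Suc 0) (\<phi> n x) *\<^sub>R wgrad \<Omega> u x)
            \<le> norm (C *\<^sub>R (grad (\<phi> n) x - wgrad \<Omega> u x))"
          unfolding g\<psi> scaleR_diff_right[symmetric] by (rule AE_I2) (rule bd)
      qed
      then show ?thesis using C0 by (simp only: L2norm_scaleR abs_of_nonneg)
    qed
    have lim: "(\<lambda>n. C * L2norm M (\<lambda>x. grad (\<phi> n) x - wgrad \<Omega> u x)) \<longlonglongrightarrow> 0"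
      using tendsto_mult[OF tendsto_const L2convD(3)[OF c2], of C] by simp
    show "(\<lambda>n. L2norm M (\<lambda>x. grad (\<psi> n) x - F (Suc 0) (\<phi> n x) *\<^sub>R wgrad \<Omega> u x)) \<longlonglongrightarrow> 0"
      by (rule tendsto_sandwich[OF always_eventually always_eventually tendsto_const lim])
        (use le in \<open>blast intro: L2norm_nonneg\<close>)+
  qed
  ultimately have "H1_limit \<psi> (\<lambda>x. F 0 (u x)) (\<lambda>x. F (Suc 0) (u x) *\<^sub>R wgrad \<Omega> u x)"
    using \<psi> by (simp add: H1_limit_def)
  then show "(\<lambda>x. F 0 (u x)) \<in> H10 \<Omega>"
    "AE x in M. wgrad \<Omega> (\<lambda>x. F 0 (u x)) x = F (Suc 0) (u x) *\<^sub>R wgrad \<Omega> u x"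
    by (rule H1_limit_H10)+
qed

end

text \<open>\<open>smooth_pos k n\<close> is the \<open>n\<close>-th derivative of \<open>t * flat 0 (k * t)\<close>, which tends to the positive
  part of \<open>t\<close> as \<open>k\<close> grows.\<close>

definition smooth_pos :: "real \<Rightarrow> nat \<Rightarrow> real \<Rightarrow> real" where
  "smooth_pos k n t = t * k ^ n * flat n (k * t) + (case n of 0 \<Rightarrow> 0 | Suc m \<Rightarrow> real n * k ^ m * flat m (k * t))"

lemma derivatives_smooth_pos: "derivatives (smooth_pos k)"
  unfolding derivatives_def
proof (intro allI)
  fix n t
  have d: "((\<lambda>t. flat m (k * t)) has_real_derivative k * flat (Suc m) (k * t)) (at t)" for m
    using DERIV_chain2[OF flat_has_derivative DERIV_cmult_Id, of m k t UNIV] by (simp add: mult.commute[of _ k])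
  show "(smooth_pos k n has_real_derivative smooth_pos k (Suc n) t) (at t)"
  proof (cases n)
    case 0
    show ?thesis unfolding 0 smooth_pos_def[abs_def] nat.case
      by (rule d derivative_eq_intros refl)+ (simp add: algebra_simps)
  next
    case (Suc m)
    show ?thesis unfolding Suc smooth_pos_def[abs_def] nat.case
      by (rule d derivative_eq_intros refl)+ (simp add: algebra_simps)
  qed
qed

lemma smooth_pos_0: "smooth_pos k 0 t = t * flat 0 (k * t)"
  by (simp add: smooth_pos_def)

lemma smooth_pos_0_bound: "\<bar>smooth_pos k 0 t\<bar> \<le> \<bar>t\<bar>"
proof -
  have "0 \<le> flat 0 (k * t)" "flat 0 (k * t) \<le> 1" by (auto simp: flat_0)
  then show ?thesis by (simp add: smooth_pos_0 abs_mult mult_left_le)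
qed

lemma smooth_pos_1:
  "smooth_pos k (Suc 0) t = (if 0 < k * t then exp (- (1 / (k * t))) * (1 + 1 / (k * t)) else 0)"
  by (simp add: smooth_pos_def flat_0 flat_1 power2_eq_square field_simps)

text \<open>This is 1 + s \<le> exp s at s = 1 / (k * t). The bound does not depend on k, so the
  gradient of u itself is a majorant in the limit.\<close>

lemma smooth_pos_1_bound: "\<bar>smooth_pos k (Suc 0) t\<bar> \<le> 1"
proof (cases "0 < k * t")
  case True
  have "exp (- (1 / (k * t))) * (1 + 1 / (k * t)) \<le> exp (- (1 / (k * t))) * exp (1 / (k * t))"
    by (intro mult_left_mono exp_ge_add_one_self) auto
  also have "\<dots> = 1" by (simp add: exp_minus)
  finally show ?thesis using True by (simp add: smooth_pos_1 abs_mult)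
qed (simp add: smooth_pos_1)

lemma smooth_pos_tendsto:
  "(\<lambda>n. smooth_pos (real (Suc n)) 0 t) \<longlonglongrightarrow> max 0 t"
  "(\<lambda>n. smooth_pos (real (Suc n)) (Suc 0) t) \<longlonglongrightarrow> (if 0 < t then 1 else 0)"
proof -
  have inv: "(\<lambda>n. 1 / (real (Suc n) * t)) \<longlonglongrightarrow> 0"
    using tendsto_mult[OF LIMSEQ_inverse_real_of_nat tendsto_const[of "1 / t"]]
    by (simp add: field_simps)
  have ex: "(\<lambda>n. exp (- (1 / (real (Suc n) * t)))) \<longlonglongrightarrow> 1"
    using tendsto_exp[OF tendsto_minus[OF inv]] by simp
  show "(\<lambda>n. smooth_pos (real (Suc n)) 0 t) \<longlonglongrightarrow> max 0 t"
  proof (cases "0 < t")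
    case True
    have "(\<lambda>n. t * exp (- (1 / (real (Suc n) * t)))) \<longlonglongrightarrow> t * 1"
      by (intro tendsto_mult tendsto_const ex)
    with True show ?thesis by (simp add: smooth_pos_0 flat_0)
  next
    case False
    then have "\<not> 0 < real (Suc n) * t" for n by (simp add: zero_less_mult_iff)
    with False show ?thesis by (simp add: smooth_pos_0 flat_0 max_def)
  qed
  show "(\<lambda>n. smooth_pos (real (Suc n)) (Suc 0) t) \<longlonglongrightarrow> (if 0 < t then 1 else 0)"
  proof (cases "0 < t")
    case True
    have "(\<lambda>n. exp (- (1 / (real (Suc n) * t))) * (1 + 1 / (real (Suc n) * t))) \<longlonglongrightarrow> 1 * (1 + 0)"
      by (intro tendsto_mult tendsto_add tendsto_const ex inv)
    with True show ?thesis by (simp add: smooth_pos_1)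
  next
    case False
    then have "\<not> 0 < real (Suc n) * t" for n by (simp add: zero_less_mult_iff)
    with False show ?thesis by (simp add: smooth_pos_1)
  qed
qed

context bounded_open
begin

text \<open>Both the compositions with \<open>smooth_pos\<close> and their gradients are dominated
  by u and its gradient and converge pointwise; closedness of the space finishes the
  argument.\<close>

lemma H10_positive_part:
  assumes u: "u \<in> H10 \<Omega>"
  shows "(\<lambda>x. max 0 (u x)) \<in> H10 \<Omega>"
    and "AE x in M. wgrad \<Omega> (\<lambda>x. max 0 (u x)) x = (if 0 < u x then wgrad \<Omega> u x else 0)"
proof -
  define f where "f n x = smooth_pos (real (Suc n)) 0 (u x)" for n x
  note U = H10_sq_int[OF u]
  note m = sq_int_measurable[OF U(1)] sq_int_measurable[OF U(2)]
  have fH: "f n \<in> H10 \<Omega>"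
    "AE x in M. wgrad \<Omega> (f n) x = smooth_pos (real (Suc n)) (Suc 0) (u x) *\<^sub>R wgrad \<Omega> u x" for n
    unfolding f_def[abs_def]
    by (rule H10_compose[OF u derivatives_smooth_pos _ smooth_pos_1_bound], simp add: smooth_pos_0)+
  have "L2conv M f (\<lambda>x. max 0 (u x))"
  proof (rule L2conv_dominated[OF _ _ U(1)])
    show "f n \<in> borel_measurable M" for n by (rule sq_int_measurable[OF H10_sq_int(1)[OF fH(1)]])
    show "(\<lambda>x. max 0 (u x)) \<in> borel_measurable M" using m by simp
    show "AE x in M. norm (f n x) \<le> norm (u x)" for n
      using smooth_pos_0_bound by (intro AE_I2) (simp add: f_def)
    show "AE x in M. (\<lambda>n. f n x) \<longlonglongrightarrow> max 0 (u x)"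
      unfolding f_def by (intro AE_I2 smooth_pos_tendsto)
  qed
  moreover have "L2conv M (\<lambda>n. wgrad \<Omega> (f n)) (\<lambda>x. if 0 < u x then wgrad \<Omega> u x else 0)"
  proof (rule L2conv_dominated[OF _ _ U(2)])
    show "wgrad \<Omega> (f n) \<in> borel_measurable M" for n by (rule sq_int_measurable[OF H10_sq_int(2)[OF fH(1)]])
    show "(\<lambda>x. if 0 < u x then wgrad \<Omega> u x else 0) \<in> borel_measurable M" using m by simp
    show "AE x in M. norm (wgrad \<Omega> (f n) x) \<le> norm (wgrad \<Omega> u x)" for n
      using fH(2)[of n]
    proof eventually_elim
      case (elim x)
      show ?case unfolding elim norm_scaleR
        using mult_right_mono[OF smooth_pos_1_bound[of "real (Suc n)" "u x"], of "norm (wgrad \<Omega> u x)"] by simp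
    qed
    have "AE x in M. \<forall>n. wgrad \<Omega> (f n) x = smooth_pos (real (Suc n)) (Suc 0) (u x) *\<^sub>R wgrad \<Omega> u x"
      using fH(2) unfolding AE_all_countable by blast
    then show "AE x in M. (\<lambda>n. wgrad \<Omega> (f n) x) \<longlonglongrightarrow> (if 0 < u x then wgrad \<Omega> u x else 0)"
    proof eventually_elim
      case (elim x)
      have "(\<lambda>n. smooth_pos (real (Suc n)) (Suc 0) (u x) *\<^sub>R wgrad \<Omega> u x)
          \<longlonglongrightarrow> (if 0 < u x then 1 else 0) *\<^sub>R wgrad \<Omega> u x"
        by (intro tendsto_scaleR tendsto_const smooth_pos_tendsto)
      with elim show ?case by (simp split: if_splits)
    qed
  qed
  ultimately show "(\<lambda>x. max 0 (u x)) \<in> H10 \<Omega>"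
    "AE x in M. wgrad \<Omega> (\<lambda>x. max 0 (u x)) x = (if 0 < u x then wgrad \<Omega> u x else 0)"
    by (rule H10_closed[of f, OF fH(1)])+
qed

text \<open>Testing the equation of u with its positive part shows that the positive part has
  Rayleigh quotient \<mu> as well. It is therefore another minimiser.\<close>

lemma positive_part_eigenfunction:
  assumes a: "coeff c C a" and e: "eigenfunction \<Omega> a \<mu> u"
    and min: "\<And>v. v \<in> H10 \<Omega> \<Longrightarrow> \<mu> * mass v v \<le> energy a v v"
    and pos: "mass (\<lambda>x. max 0 (u x)) (\<lambda>x. max 0 (u x)) > 0"
  shows "eigenfunction \<Omega> a \<mu> (\<lambda>x. max 0 (u x))"
proof -
  let ?v = "\<lambda>x. max 0 (u x)"
  have u: "u \<in> H10 \<Omega>" using e by (simp add: eigenfunction_iff)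
  note v = H10_positive_part[OF u]
  show ?thesis
  proof (rule minimizer_eigenfunction[OF a v(1) pos _ min])
    have "energy a ?v ?v = energy a u ?v"
      unfolding energy_def
    proof (rule integral_cong_AE)
      show "AE x in M. a x * (wgrad \<Omega> ?v x \<bullet> wgrad \<Omega> ?v x) = a x * (wgrad \<Omega> u x \<bullet> wgrad \<Omega> ?v x)"
        using v(2) by eventually_elim auto
    qed (use energy_integrable[OF a v(1,1)] energy_integrable[OF a u v(1)] in \<open>auto dest: borel_measurable_integrable\<close>)
    also have "\<dots> = \<mu> * mass u ?v" using e v(1) by (simp add: eigenfunction_iff)
    also have "mass u ?v = mass ?v ?v"
      unfolding mass_def by (intro Bochner_Integration.integral_cong refl) (auto simp: max_def)
    finally show "energy a ?v ?v = \<mu> * mass ?v ?v" .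
  qed
qed

end

section \<open>Differentiation under the integral sign\<close>

lemma has_real_derivative_integral:
  fixes f f' :: "real \<Rightarrow> 'a \<Rightarrow> real"
  assumes s: "s \<in> {a<..<b}"
    and int: "\<And>r. r \<in> {a<..<b} \<Longrightarrow> integrable N (f r)"
    and d: "\<And>r x. r \<in> {a<..<b} \<Longrightarrow> x \<in> space N \<Longrightarrow> ((\<lambda>r. f r x) has_real_derivative f' r x) (at r)"
    and m: "f' s \<in> borel_measurable N"
    and w: "integrable N w"
    and bd: "\<And>r x. r \<in> {a<..<b} \<Longrightarrow> x \<in> space N \<Longrightarrow> \<bar>f' r x\<bar> \<le> w x"
  shows "((\<lambda>r. LINT x|N. f r x) has_real_derivative (LINT x|N. f' s x)) (at s)"
  unfolding DERIV_def tendsto_at_iff_sequentially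
proof (intro allI impI)
  fix X :: "nat \<Rightarrow> real"
  assume X0: "\<forall>i. X i \<in> UNIV - {0}" and X: "X \<longlonglongrightarrow> 0"
  have "(\<lambda>i. s + X i) \<longlonglongrightarrow> s + 0" by (intro tendsto_intros X)
  then have "\<forall>\<^sub>F i in sequentially. s + X i \<in> {a<..<b}"
    using s by (intro topological_tendstoD) auto
  then obtain N0 where N0: "\<And>i. i \<ge> N0 \<Longrightarrow> s + X i \<in> {a<..<b}"
    unfolding eventually_sequentially by blast
  \<comment> \<open>Dropping the first \<open>N0\<close> terms keeps every point s + h i inside the
    interval where the hypotheses hold; the limit is unaffected.\<close>
  define h where "h i = X (i + N0)" for i
  have h: "s + h i \<in> {a<..<b}" "h i \<noteq> 0" for i using N0 X0 by (auto simp: h_def)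
  have hlim: "h \<longlonglongrightarrow> 0" unfolding h_def using X by (rule LIMSEQ_ignore_initial_segment)
  have "(\<lambda>i. LINT x|N. (f (s + h i) x - f s x) / h i) \<longlonglongrightarrow> (LINT x|N. f' s x)"
  proof (rule integral_dominated_convergence[OF m _ w])
    show "(\<lambda>x. (f (s + h i) x - f s x) / h i) \<in> borel_measurable N" for i
      using int[OF h(1)] int[OF s] by (intro borel_measurable_divide borel_measurable_diff) auto
    show "AE x in N. (\<lambda>i. (f (s + h i) x - f s x) / h i) \<longlonglongrightarrow> f' s x"
    proof (rule AE_I2)
      fix x assume x: "x \<in> space N"
      have "((\<lambda>h. (f (s + h) x - f s x) / h) \<longlongrightarrow> f' s x) (at 0)"
        using d[OF s x] by (simp add: DERIV_def)
      moreover have "filterlim h (at 0) sequentially"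
        unfolding filterlim_at using hlim h(2) by auto
      ultimately show "(\<lambda>i. (f (s + h i) x - f s x) / h i) \<longlonglongrightarrow> f' s x"
        by (rule filterlim_compose)
    qed
    show "AE x in N. norm ((f (s + h i) x - f s x) / h i) \<le> w x" for i
    proof (rule AE_I2)
      fix x assume x: "x \<in> space N"
      have "norm (f (s + h i) x - f s x) \<le> w x * norm (s + h i - s)"
      proof (rule field_differentiable_bound[of "{a<..<b}" "\<lambda>r. f r x" "\<lambda>r. f' r x"])
        show "((\<lambda>r. f r x) has_real_derivative f' r x) (at r within {a<..<b})" if "r \<in> {a<..<b}" for r
          using d[OF that x] by (rule has_field_derivative_at_within)
        show "norm (f' r x) \<le> w x" if "r \<in> {a<..<b}" for r using bd[OF that x] by simp
      qed (use h(1) s in auto)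
      then show "norm ((f (s + h i) x - f s x) / h i) \<le> w x"
        using h(2)[of i] by (simp add: abs_divide divide_le_eq)
    qed
  qed
  moreover have "(LINT x|N. (f (s + h i) x - f s x) / h i) = ((LINT x|N. f (s + h i) x) - (LINT x|N. f s x)) / h i" for i
    using int[OF h(1)] int[OF s] by simp
  ultimately have "(\<lambda>i. ((LINT x|N. f (s + h i) x) - (LINT x|N. f s x)) / h i) \<longlonglongrightarrow> (LINT x|N. f' s x)"
    by (simp only:)
  then have "(\<lambda>i. ((LINT x|N. f (s + X (i + N0)) x) - (LINT x|N. f s x)) / X (i + N0)) \<longlonglongrightarrow> (LINT x|N. f' s x)"
    by (simp only: h_def)
  then show "((\<lambda>h. ((LINT x|N. f (s + h) x) - (LINT x|N. f s x)) / h) \<circ> X) \<longlonglongrightarrow> (LINT x|N. f' s x)"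
    unfolding o_def by (rule LIMSEQ_offset)
qed

lemma flat_1_bound: "0 \<le> flat (Suc 0) t" "flat (Suc 0) t \<le> 2"
proof -
  show "0 \<le> flat (Suc 0) t" by (simp add: flat_1)
  show "flat (Suc 0) t \<le> 2"
  proof (cases "0 < t")
    case True
    define s where "s = 1 / t"
    have s: "s > 0" using True by (simp add: s_def)
    have "s\<^sup>2 / 2 \<le> exp s" using exp_lower_Taylor_quadratic[of s] s by simp
    then have "exp (- s) * s\<^sup>2 \<le> 2" by (simp add: exp_minus field_simps)
    then show ?thesis using True by (simp add: flat_1 s_def power_divide)
  qed (simp add: flat_1)
qed

subsection \<open>Radial bumps\<close>

text \<open>Positive exactly on the open ball of radius r about x, and a quadratic polynomial in y,
  so smooth at the centre and with explicit derivatives.\<close>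

definition radial :: "'a::euclidean_space \<Rightarrow> real \<Rightarrow> 'a \<Rightarrow> real" where
  "radial x r y = 1 - (norm (y - x))\<^sup>2 / r\<^sup>2"

lemma Ck_radial: "Ck k (radial x r)"
proof -
  have eq: "radial x r = (\<lambda>y. 1 - (1 / r\<^sup>2) * (norm (y - x))\<^sup>2)" by (simp add: radial_def fun_eq_iff)
  show ?thesis unfolding eq by (intro Ck_diff Ck_const Ck_scale Ck_norm_diff_square)
qed

lemma radial_pos_iff: "r > 0 \<Longrightarrow> 0 < radial x r y \<longleftrightarrow> norm (y - x) < r"
  using power_mono_iff[of r "norm (y - x)" 2] by (simp add: radial_def divide_less_eq flip: not_le)

lemma radial_has_derivative: "(radial x r has_derivative (\<lambda>h. - (2 / r\<^sup>2) * ((y - x) \<bullet> h))) (at y)"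
  unfolding radial_def[abs_def] power2_norm_eq_inner
  by (auto intro!: derivative_eq_intros simp: inner_commute divide_inverse)

lemma flat_radial_has_derivative:
  "((\<lambda>y. flat n (radial x r y)) has_derivative (\<lambda>h. flat (Suc n) (radial x r y) * (- (2 / r\<^sup>2) * ((y - x) \<bullet> h)))) (at y)"
  using has_derivative_compose[OF radial_has_derivative flat_has_derivative[unfolded has_field_derivative_def]] .

lemma flat_radial_test_function:
  assumes "r > 0" "cball x r \<subseteq> \<Omega>"
  shows "(\<lambda>y. flat n (radial x r y)) \<in> test_functions \<Omega>"
proof (rule test_functionI[OF _ compact_cball assms(2)])
  show "Ck k (\<lambda>y. flat n (radial x r y))" for k by (rule Ck_compose[OF derivatives_flat Ck_radial])
  show "flat n (radial x r y) = 0" if "y \<notin> cball x r" for y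
    using that radial_pos_iff[OF assms(1), of x y] by (intro flat_nonpos) (auto simp: dist_norm norm_minus_commute)
qed

text \<open>The Laplacian of F(p) is F'' |grad p|^2 + F' * Laplacian p; for the radial quadratic
  |grad p|^2 = 4 |y - x|^2 / r^4 and the Laplacian of p is - 2 DIM / r^2.\<close>

lemma laplacian_flat_radial:
  fixes x y :: "'a::euclidean_space" and r :: real
  defines "\<phi> \<equiv> \<lambda>y. flat 0 (radial x r y)"
  shows "(\<Sum>b\<in>Basis. pd (pd \<phi> b) b y)
    = 4 * (norm (y - x))\<^sup>2 / r ^ 4 * flat 2 (radial x r y) - 2 * DIM('a) / r\<^sup>2 * flat 1 (radial x r y)"
proof -
  have "pd (pd \<phi> b) b y = 4 / r ^ 4 * flat 2 (radial x r y) * ((y - x) \<bullet> b)\<^sup>2 - 2 / r\<^sup>2 * flat 1 (radial x r y)"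
    if b: "b \<in> Basis" for b
  proof -
    have "pd \<phi> b = (\<lambda>y. flat 1 (radial x r y) * (- (2 / r\<^sup>2) * ((y - x) \<bullet> b)))"
      unfolding \<phi>_def by (rule ext) (simp add: pd_eq[OF flat_radial_has_derivative])
    moreover have "((\<lambda>y. flat 1 (radial x r y) * (- (2 / r\<^sup>2) * ((y - x) \<bullet> b))) has_derivative
        (\<lambda>h. flat 1 (radial x r y) * (- (2 / r\<^sup>2) * (h \<bullet> b))
          + flat (Suc 1) (radial x r y) * (- (2 / r\<^sup>2) * ((y - x) \<bullet> h)) * (- (2 / r\<^sup>2) * ((y - x) \<bullet> b)))) (at y)"
    proof (rule has_derivative_mult[OF flat_radial_has_derivative])
      show "((\<lambda>y. - (2 / r\<^sup>2) * ((y - x) \<bullet> b)) has_derivative (\<lambda>h. - (2 / r\<^sup>2) * (h \<bullet> b))) (at y)"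
        by (intro has_derivative_mult_right has_derivative_inner_left) (auto intro!: derivative_eq_intros)
    qed
    ultimately have "pd (pd \<phi> b) b y = flat 1 (radial x r y) * (- (2 / r\<^sup>2) * (b \<bullet> b))
        + flat (Suc 1) (radial x r y) * (- (2 / r\<^sup>2) * ((y - x) \<bullet> b)) * (- (2 / r\<^sup>2) * ((y - x) \<bullet> b))"
      by (simp only: pd_eq)
    also have "Suc 1 = 2" by simp
    also have "flat 1 (radial x r y) * (- (2 / r\<^sup>2) * (b \<bullet> b))
        + flat 2 (radial x r y) * (- (2 / r\<^sup>2) * ((y - x) \<bullet> b)) * (- (2 / r\<^sup>2) * ((y - x) \<bullet> b))
        = 4 / r ^ 4 * flat 2 (radial x r y) * ((y - x) \<bullet> b)\<^sup>2 - 2 / r\<^sup>2 * flat 1 (radial x r y)"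
      using b by (simp add: power2_eq_square power4_eq_xxxx mult_ac)
    finally show ?thesis .
  qed
  then have "(\<Sum>b\<in>Basis. pd (pd \<phi> b) b y)
      = 4 / r ^ 4 * flat 2 (radial x r y) * (\<Sum>b\<in>Basis. ((y - x) \<bullet> b)\<^sup>2) - DIM('a) * (2 / r\<^sup>2 * flat 1 (radial x r y))"
    by (simp add: sum_subtractf sum_distrib_left)
  also have "(\<Sum>b\<in>Basis. ((y - x) \<bullet> b)\<^sup>2) = (norm (y - x))\<^sup>2"
    unfolding power2_norm_eq_inner by (subst euclidean_inner) (simp add: power2_eq_square)
  finally show ?thesis by (simp add: mult_ac)
qed

text \<open>The power of r makes the total integral invariant under scaling. The profile is the
  derivative of the flat function rather than the function itself, so that differentiating in r
  produces the second derivative that occurs in the Laplacian.\<close>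

definition bump :: "'a::euclidean_space \<Rightarrow> real \<Rightarrow> 'a \<Rightarrow> real" where
  "bump x r y = flat 1 (radial x r y) / r ^ DIM('a)"

text \<open>The scale derivative of the bump is a multiple of the Laplacian of a nonnegative test function;
  this makes the means against the bumps of a superharmonic function decreasing in the scale.\<close>

lemma bump_has_real_derivative:
  fixes x y :: "'a::euclidean_space"
  assumes r: "r > 0"
  shows "((\<lambda>r. bump x r y) has_real_derivative
    r / (2 * r ^ DIM('a)) * (4 * (norm (y - x))\<^sup>2 / r ^ 4 * flat 2 (radial x r y) - 2 * DIM('a) / r\<^sup>2 * flat 1 (radial x r y))) (at r)"
proof -
  let ?n = "DIM('a)" and ?q = "(norm (y - x))\<^sup>2"
  have "((\<lambda>r. radial x r y) has_real_derivative 2 * ?q / r ^ 3) (at r)"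
    unfolding radial_def using r
    by (auto intro!: derivative_eq_intros simp: power2_eq_square power3_eq_cube field_simps)
  from DERIV_chain2[OF flat_has_derivative this]
  have d1: "((\<lambda>r. flat 1 (radial x r y)) has_real_derivative flat 2 (radial x r y) * (2 * ?q / r ^ 3)) (at r)"
    by (simp add: numeral_2_eq_2)
  have n: "r ^ ?n = r * r ^ (?n - 1)" using DIM_positive[where 'a='a] by (cases "DIM('a)") auto
  have d2: "((\<lambda>r. r ^ ?n) has_real_derivative real ?n * r ^ (?n - 1)) (at r)"
    by (auto intro!: derivative_eq_intros)
  have "((\<lambda>r. bump x r y) has_real_derivative
      (flat 2 (radial x r y) * (2 * ?q / r ^ 3) * r ^ ?n - flat 1 (radial x r y) * (real ?n * r ^ (?n - 1))) / (r ^ ?n * r ^ ?n)) (at r)"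
    unfolding bump_def using r by (intro DERIV_divide d1 d2) simp
  also have "(flat 2 (radial x r y) * (2 * ?q / r ^ 3) * r ^ ?n - flat 1 (radial x r y) * (real ?n * r ^ (?n - 1))) / (r ^ ?n * r ^ ?n)
      = r / (2 * r ^ ?n) * (4 * ?q / r ^ 4 * flat 2 (radial x r y) - 2 * ?n / r\<^sup>2 * flat 1 (radial x r y))"
  proof -
    have "(A * (2 * q / r ^ 3) * (r * P) - B * (m * P)) / ((r * P) * (r * P))
        = r / (2 * (r * P)) * (4 * q / r ^ 4 * A - 2 * m / r\<^sup>2 * B)" if "P > 0" for A B q m P :: real
      using r that by (simp add: power2_eq_square power3_eq_cube power4_eq_xxxx field_simps)
    from this[of "r ^ (?n - 1)"] show ?thesis unfolding n using r by simp
  qed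
  finally show ?thesis .
qed

lemma bump_nonneg: "r > 0 \<Longrightarrow> 0 \<le> bump x r y"
  by (simp add: bump_def flat_1_bound)

lemma bump_pos: "r > 0 \<Longrightarrow> norm (y - x) < r \<Longrightarrow> 0 < bump x r y"
  using radial_pos_iff[of r x y] by (simp add: bump_def flat_1)

lemma bump_outside: "r > 0 \<Longrightarrow> r \<le> norm (y - x) \<Longrightarrow> bump x r y = 0"
  using radial_pos_iff[of r x y] by (simp add: bump_def flat_nonpos)

lemma bump_translate: "bump x r (x + z) = bump 0 r z"
  by (simp add: bump_def radial_def)

lemma bump_measurable [measurable]: "(\<lambda>y. bump x r y) \<in> borel_measurable borel"
proof -
  have "continuous_on UNIV (bump x r)"
    unfolding bump_def[abs_def] radial_def[abs_def] divide_inverse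
    by (intro continuous_on_mult continuous_on_compose2[OF continuous_flat] continuous_intros) auto
  then show ?thesis by (rule borel_measurable_continuous_onI)
qed

text \<open>Height at most 2 / r^DIM on a box of side 2 * r. What matters is that the bound is the
  same for all scales.\<close>

lemma nn_integral_bump_le:
  assumes r: "r > 0"
  shows "(\<integral>\<^sup>+z. ennreal (bump (0::'a::euclidean_space) r z) \<partial>lborel) \<le> ennreal (2 * 2 ^ DIM('a))"
proof -
  let ?B = "cbox (- (r *\<^sub>R One)) (r *\<^sub>R One) :: 'a set"
  have "(\<integral>\<^sup>+z. ennreal (bump (0::'a) r z) \<partial>lborel) \<le> (\<integral>\<^sup>+z. ennreal (2 / r ^ DIM('a)) * indicator ?B z \<partial>lborel)"
  proof (rule nn_integral_mono)
    fix z :: 'a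
    show "ennreal (bump 0 r z) \<le> ennreal (2 / r ^ DIM('a)) * indicator ?B z"
    proof (cases "z \<in> ?B")
      case True
      have "bump 0 r z \<le> 2 / r ^ DIM('a)"
        unfolding bump_def using flat_1_bound(2) r by (intro divide_right_mono) auto
      with True show ?thesis by (simp add: ennreal_leI)
    next
      case False
      then obtain b where b: "b \<in> Basis" "\<not> \<bar>z \<bullet> b\<bar> \<le> r" by (auto simp: mem_box abs_le_iff)
      with Basis_le_norm[OF b(1), of z] r show ?thesis by (simp add: bump_outside)
    qed
  qed
  also have "\<dots> = ennreal (2 / r ^ DIM('a)) * emeasure lborel ?B" by (rule nn_integral_cmult_indicator) simp
  also have "emeasure lborel ?B = ennreal ((2 * r) ^ DIM('a))"
  proof -
    have "(\<Prod>b\<in>Basis. (r *\<^sub>R One - - (r *\<^sub>R One)) \<bullet> (b::'a)) = (\<Prod>b\<in>(Basis::'a set). 2 * r)"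
      by (rule prod.cong) (auto simp: inner_add_left)
    then have "(\<Prod>b\<in>Basis. (r *\<^sub>R One - - (r *\<^sub>R One)) \<bullet> (b::'a)) = (2 * r) ^ DIM('a)" by (simp only: prod_constant)
    then show ?thesis using r by (subst emeasure_lborel_cbox_eq) (simp del: diff_minus_eq_add)
  qed
  also have "ennreal (2 / r ^ DIM('a)) * ennreal ((2 * r) ^ DIM('a)) = ennreal (2 * 2 ^ DIM('a))"
    using r by (simp add: ennreal_mult[symmetric] power_mult_distrib)
  finally show ?thesis .
qed

lemma nn_integral_lborel_translate:
  fixes f :: "'a::euclidean_space \<Rightarrow> ennreal"
  assumes "f \<in> borel_measurable borel"
  shows "(\<integral>\<^sup>+y. f y \<partial>lborel) = (\<integral>\<^sup>+z. f (x + z) \<partial>lborel)"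
proof -
  have "(\<integral>\<^sup>+y. f y \<partial>lborel) = (\<integral>\<^sup>+y. f y \<partial>distr lborel borel ((+) x))"
    by (simp only: lborel_distr_plus)
  also have "\<dots> = (\<integral>\<^sup>+z. f (x + z) \<partial>lborel)" using assms by (intro nn_integral_distr) auto
  finally show ?thesis .
qed

context bounded_open
begin

lemma test_function_H10:
  assumes "\<phi> \<in> test_functions \<Omega>"
  shows "\<phi> \<in> H10 \<Omega>" "AE x in M. wgrad \<Omega> \<phi> x = grad \<phi> x"
proof -
  have "H1_limit (\<lambda>_. \<phi>) \<phi> (grad \<phi>)"
    using assms test_function_sq_int by (simp add: H1_limit_def L2conv_const)
  then show "\<phi> \<in> H10 \<Omega>" "AE x in M. wgrad \<Omega> \<phi> x = grad \<phi> x" by (rule H1_limit_H10)+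
qed

text \<open>Each partial derivative of a test function is again a test function, so the defining
  identity of the weak gradient can be applied to it once.\<close>

lemma integral_laplacian:
  assumes u: "u \<in> H10 \<Omega>" and \<phi>: "\<phi> \<in> test_functions \<Omega>"
  shows "(LINT x|M. u x * (\<Sum>b\<in>Basis. pd (pd \<phi> b) b x)) = - energy (\<lambda>x. 1) u \<phi>"
proof -
  note U = H10_sq_int[OF u]
  have pdb: "pd \<phi> b \<in> test_functions \<Omega>" if "b \<in> Basis" for b by (rule test_function_pd[OF \<phi> that])
  have i1: "integrable M (\<lambda>x. u x * pd (pd \<phi> b) b x)" if b: "b \<in> Basis" for b
    by (rule integrable_mult_sq[OF U(1) test_function_sq_int(1)[OF test_function_pd[OF pdb[OF b] b]]])
  have i2: "integrable M (\<lambda>x. pd \<phi> b x * (wgrad \<Omega> u x \<bullet> b))" if b: "b \<in> Basis" for b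
    using integrable_inner_left[OF integrable_scaleR_sq[OF test_function_sq_int(1)[OF pdb[OF b]] U(2)], of b] by simp
  have "(LINT x|M. u x * pd (pd \<phi> b) b x) = - (LINT x|M. pd \<phi> b x * (wgrad \<Omega> u x \<bullet> b))" if b: "b \<in> Basis" for b
  proof -
    note T = test_function_sq_int[OF pdb[OF b]]
    have "(LINT x|M. u x * pd (pd \<phi> b) b x) = (LINT x|M. (u x *\<^sub>R grad (pd \<phi> b) x) \<bullet> b)"
      by (simp add: grad_inner_Basis[OF b])
    also have "\<dots> = (LINT x|M. u x *\<^sub>R grad (pd \<phi> b) x) \<bullet> b"
      by (rule integral_inner_left) (rule integrable_scaleR_sq[OF U(1) T(2)])
    also have "\<dots> = - ((LINT x|M. pd \<phi> b x *\<^sub>R wgrad \<Omega> u x) \<bullet> b)"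
      using U(3) pdb[OF b] by (simp add: has_weak_gradient_def)
    also have "(LINT x|M. pd \<phi> b x *\<^sub>R wgrad \<Omega> u x) \<bullet> b = (LINT x|M. (pd \<phi> b x *\<^sub>R wgrad \<Omega> u x) \<bullet> b)"
      by (rule integral_inner_left[symmetric]) (rule integrable_scaleR_sq[OF T(1) U(2)])
    finally show ?thesis by simp
  qed
  then have "(LINT x|M. u x * (\<Sum>b\<in>Basis. pd (pd \<phi> b) b x)) = - (LINT x|M. (\<Sum>b\<in>Basis. pd \<phi> b x * (wgrad \<Omega> u x \<bullet> b)))"
    using i1 i2 by (simp add: sum_distrib_left Bochner_Integration.integral_sum sum_negf)
  also have "(LINT x|M. (\<Sum>b\<in>Basis. pd \<phi> b x * (wgrad \<Omega> u x \<bullet> b))) = energy (\<lambda>x. 1) u \<phi>"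
    unfolding energy_def
  proof (rule integral_cong_AE)
    show "AE x in M. (\<Sum>b\<in>Basis. pd \<phi> b x * (wgrad \<Omega> u x \<bullet> b)) = 1 * (wgrad \<Omega> u x \<bullet> wgrad \<Omega> \<phi> x)"
      using test_function_H10(2)[OF \<phi>]
      by eventually_elim (simp add: grad_eq_pd inner_sum_right)
    show "(\<lambda>x. \<Sum>b\<in>Basis. pd \<phi> b x * (wgrad \<Omega> u x \<bullet> b)) \<in> borel_measurable M"
      using i2 by (intro borel_measurable_sum) (auto dest: borel_measurable_integrable)
    show "(\<lambda>x. 1 * (wgrad \<Omega> u x \<bullet> wgrad \<Omega> \<phi> x)) \<in> borel_measurable M"
      using energy_integrable[of 1 1 "\<lambda>x. 1", OF _ u test_function_H10(1)[OF \<phi>]] by (simp add: coeff_def borel_measurable_integrable)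
  qed
  finally show ?thesis .
qed

text \<open>The weak form of - Laplacian u \<ge> 0, together with nonnegativity and zero boundary
  values.\<close>

definition superharmonic :: "('a \<Rightarrow> real) \<Rightarrow> bool" where
  "superharmonic u \<longleftrightarrow> u \<in> H10 \<Omega> \<and> (AE x in M. 0 \<le> u x) \<and>
     (\<forall>\<phi>\<in>test_functions \<Omega>. (\<forall>x. 0 \<le> \<phi> x) \<longrightarrow> 0 \<le> energy (\<lambda>x. 1) u \<phi>)"

text \<open>The derivative of the mean in the scale is a positive factor times the integral of u
  against the Laplacian of a nonnegative test function, that is, minus an energy that is nonnegative
  for superharmonic u.\<close>

lemma bump_mean_antimono:
  assumes u: "superharmonic u" and st: "0 < s" "s \<le> t" and sub: "cball x t \<subseteq> \<Omega>"
  shows "(LINT y|M. u y * bump x t y) \<le> (LINT y|M. u y * bump x s y)"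
proof -
  have uH: "u \<in> H10 \<Omega>" using u by (simp add: superharmonic_def)
  note U = H10_sq_int[OF uH]
  define D where "D r y = r / (2 * r ^ DIM('a)) * (4 * (norm (y - x))\<^sup>2 / r ^ 4 * flat 2 (radial x r y) - 2 * DIM('a) / r\<^sup>2 * flat 1 (radial x r y))" for r y
  \<comment> \<open>The scale derivative is continuous on a compact set and hence bounded, which
    supplies the majorant. The range from s/2 to 2*t keeps both end scales in the interior.\<close>
  have cont: "continuous_on ({s/2..2*t} \<times> closure \<Omega>) (\<lambda>(r, y). D r y)"
    unfolding D_def radial_def case_prod_beta
    using st by (intro continuous_intros continuous_on_compose2[OF continuous_flat]) auto
  moreover have "compact ({s/2..2*t} \<times> closure \<Omega>)"
    using bounded_dom by (intro compact_Times) auto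
  ultimately have "compact ((\<lambda>(r, y). D r y) ` ({s/2..2*t} \<times> closure \<Omega>))" by (rule compact_continuous_image)
  then obtain C where C: "\<And>v. v \<in> (\<lambda>(r, y). D r y) ` ({s/2..2*t} \<times> closure \<Omega>) \<Longrightarrow> norm v \<le> C"
    using compact_imp_bounded bounded_iff by metis
  have Cb: "\<bar>D r y\<bar> \<le> C" if "r \<in> {s/2..2*t}" "y \<in> \<Omega>" for r y
  proof -
    have "(r, y) \<in> {s/2..2*t} \<times> closure \<Omega>" using that closure_subset by auto
    then have "D r y \<in> (\<lambda>(r, y). D r y) ` ({s/2..2*t} \<times> closure \<Omega>)" by (rule image_eqI[rotated]) simp
    from C[OF this] show ?thesis by simp
  qed
  have Dm: "D r \<in> borel_measurable borel" if "r > 0" for r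
  proof (rule borel_measurable_continuous_onI)
    show "continuous_on UNIV (D r)"
      unfolding D_def radial_def using that by (intro continuous_intros continuous_on_compose2[OF continuous_flat]) auto
  qed
  have ui: "integrable M u"
    using integrable_mult_sq[OF U(1), of "\<lambda>x. 1"] by (simp add: sq_int_def)
  have bi: "integrable M (\<lambda>y. u y * bump x r y)" if "r > 0" for r
  proof (rule Bochner_Integration.integrable_bound)
    show "integrable M (\<lambda>y. u y * (2 / r ^ DIM('a)))" using ui by (rule integrable_mult_left)
    show "(\<lambda>y. u y * bump x r y) \<in> borel_measurable M"
      using ui by (intro borel_measurable_times borel_measurable_lebesgue_on[OF bump_measurable]) auto
    show "AE y in M. norm (u y * bump x r y) \<le> norm (u y * (2 / r ^ DIM('a)))"
    proof (rule AE_I2)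
      fix y
      have "bump x r y \<le> 2 / r ^ DIM('a)"
        unfolding bump_def using flat_1_bound(2) that by (intro divide_right_mono) auto
      then have "\<bar>u y\<bar> * bump x r y \<le> \<bar>u y\<bar> * (2 / r ^ DIM('a))" by (intro mult_left_mono) auto
      then show "norm (u y * bump x r y) \<le> norm (u y * (2 / r ^ DIM('a)))"
        using bump_nonneg[OF that, of x y] that by (simp add: abs_mult)
    qed
  qed
  have deriv: "((\<lambda>r. LINT y|M. u y * bump x r y) has_real_derivative (LINT y|M. u y * D r y)) (at r)"
    if r: "s \<le> r" "r \<le> t" for r
  proof (rule has_real_derivative_integral[where a = "s/2" and b = "2*t" and w = "\<lambda>y. \<bar>u y\<bar> * C"])
    show "integrable M (\<lambda>y. \<bar>u y\<bar> * C)" using ui by (intro integrable_mult_left integrable_abs)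
    show "(\<lambda>y. u y * D r y) \<in> borel_measurable M"
      using ui r st by (intro borel_measurable_times borel_measurable_lebesgue_on[OF Dm]) auto
    show "((\<lambda>r. u y * bump x r y) has_real_derivative u y * D r y) (at r)" if "r \<in> {s/2<..<2*t}" for r y
      unfolding D_def using that st by (intro DERIV_cmult bump_has_real_derivative) auto
    show "\<bar>u y * D r y\<bar> \<le> \<bar>u y\<bar> * C" if "r \<in> {s/2<..<2*t}" "y \<in> space M" for r y
      unfolding abs_mult using that by (intro mult_left_mono Cb) auto
    show "integrable M (\<lambda>y. u y * bump x r y)" if "r \<in> {s/2<..<2*t}" for r using that st by (intro bi) auto
  qed (use r st in auto)
  have neg: "(LINT y|M. u y * D r y) \<le> 0" if r: "s \<le> r" "r \<le> t" for r
  proof -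
    let ?\<phi> = "\<lambda>y. flat 0 (radial x r y)"
    have r0: "r > 0" using r st by simp
    have "cball x r \<subseteq> \<Omega>" using sub r by (meson order_trans subset_cball)
    then have \<phi>: "?\<phi> \<in> test_functions \<Omega>" using r0 by (intro flat_radial_test_function)
    have "(LINT y|M. u y * D r y) = (LINT y|M. r / (2 * r ^ DIM('a)) * (u y * (\<Sum>b\<in>Basis. pd (pd ?\<phi> b) b y)))"
      unfolding laplacian_flat_radial by (simp add: D_def mult_ac)
    also have "\<dots> = r / (2 * r ^ DIM('a)) * - energy (\<lambda>x. 1) u ?\<phi>"
      by (simp only: integral_mult_right_zero integral_laplacian[OF uH \<phi>])
    also have "\<dots> \<le> 0"
    proof -
      have "0 \<le> energy (\<lambda>x. 1) u ?\<phi>" using u \<phi> by (simp add: superharmonic_def flat_0)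
      then show ?thesis using r0 by (simp add: mult_nonneg_nonpos)
    qed
    finally show ?thesis .
  qed
  show ?thesis
    using st(2)
  proof (rule DERIV_nonpos_imp_nonincreasing)
    fix r assume "s \<le> r" "r \<le> t"
    with deriv neg show "\<exists>y. ((\<lambda>r. LINT y|M. u y * bump x r y) has_real_derivative y) (at r) \<and> y \<le> 0" by blast
  qed
qed

end

subsection \<open>The strong maximum principle\<close>

context bounded_open
begin

text \<open>Translations and Tonelli for \<open>lborel\<close> need a Borel function on the whole
  space, nonnegative everywhere and zero off the domain; such a function agrees with u almost
  everywhere.\<close>

lemma borel_representative:
  fixes u :: "'a \<Rightarrow> real"
  assumes u: "u \<in> sq_int M" and pos: "AE x in M. 0 \<le> u x"
  obtains g where "g \<in> borel_measurable borel" "\<And>x. 0 \<le> g x" "\<And>x. x \<notin> \<Omega> \<Longrightarrow> g x = 0"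
    "AE x in M. u x = g x"
proof -
  have "(\<lambda>x. if x \<in> \<Omega> then u x else 0) \<in> borel_measurable lebesgue"
    using sq_int_measurable[OF u] borel_measurable_if[OF dom_sets, of u] by simp
  then obtain g where g: "g \<in> borel_measurable lborel" "AE x in lborel. (if x \<in> \<Omega> then u x else 0) = g x"
    using completion_ex_borel_measurable_real by blast
  define f where "f x = indicator \<Omega> x * max 0 (g x)" for x
  have "AE x in lebesgue. x \<in> \<Omega> \<longrightarrow> u x = g x"
    using AE_completion[OF g(2)] by eventually_elim auto
  then have "AE x in M. u x = g x" using dom_sets by (simp add: AE_restrict_space_iff)
  moreover have "AE x in M. x \<in> \<Omega>" by (rule AE_I2) simp
  ultimately have "AE x in M. u x = f x" using pos by eventually_elim (simp add: f_def)
  moreover have "f \<in> borel_measurable borel"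
    unfolding f_def[abs_def] using g(1) open_dom
    by (intro borel_measurable_times borel_measurable_indicator borel_measurable_max) auto
  ultimately show thesis by (intro that[of f]) (auto simp: f_def)
qed

context
  fixes u g :: "'a \<Rightarrow> real"
  assumes u: "superharmonic u"
    and g [measurable]: "g \<in> borel_measurable borel"
    and g0: "\<And>x. 0 \<le> g x" and g_out: "\<And>x. x \<notin> \<Omega> \<Longrightarrow> g x = 0"
    and ug: "AE x in M. u x = g x"
begin

lemma uH: "u \<in> H10 \<Omega>"
  using u by (simp add: superharmonic_def)

lemma g_sq_int: "g \<in> sq_int lborel"
proof -
  have "g \<in> sq_int M"
    by (rule sq_int_bound[OF H10_sq_int(1)[OF uH] borel_measurable_lebesgue_on[OF g]])
      (use ug in eventually_elim, simp)
  then have "integrable lebesgue (\<lambda>x. indicator \<Omega> x *\<^sub>R (norm (g x))\<^sup>2)"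
    using dom_sets by (simp add: sq_int_def integrable_restrict_space)
  also have "(\<lambda>x. indicator \<Omega> x *\<^sub>R (norm (g x))\<^sup>2) = (\<lambda>x. (norm (g x))\<^sup>2)"
    using g_out by (auto simp: indicator_def fun_eq_iff)
  finally show ?thesis by (simp add: sq_int_def integrable_completion)
qed

lemma g_translate: "L2norm lborel (\<lambda>x. g (x + z) - g x) \<le> norm z * L2norm M (wgrad \<Omega> u)"
proof (rule field_le_epsilon)
  fix e :: real assume e: "e > 0"
  \<comment> \<open>The three approximation errors add up to d + norm z * d + d, which is e.\<close>
  define d where "d = e / (2 + norm z)"
  have d: "d > 0" using e by (simp add: d_def add_pos_nonneg)
  obtain \<phi> where \<phi>: "\<phi> \<in> test_functions \<Omega>" "L2norm M (\<lambda>x. \<phi> x - u x) < d"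
    "L2norm M (\<lambda>x. grad \<phi> x - wgrad \<Omega> u x) < d"
    by (rule H10_approx[OF uH d])
  note T = test_function_sq_int_lborel[OF \<phi>(1)] and Tm = test_function_sq_int[OF \<phi>(1)]
  have [measurable]: "\<phi> \<in> borel_measurable borel" by (rule test_function_measurable[OF \<phi>(1)])
  have "L2norm lborel (\<lambda>x. \<phi> x - g x) = L2norm M (\<lambda>x. \<phi> x - g x)"
    using dom_sets g_out test_function_outside[OF \<phi>(1)] by (intro L2norm_lebesgue_on_eq_lborel[symmetric]) auto
  also have "\<dots> = L2norm M (\<lambda>x. \<phi> x - u x)"
  proof (rule L2norm_cong_AE)
    show "(\<lambda>x. \<phi> x - g x) \<in> borel_measurable M" by (rule borel_measurable_lebesgue_on) simp
    show "(\<lambda>x. \<phi> x - u x) \<in> borel_measurable M"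
      by (rule sq_int_measurable[OF sq_int_diff[OF Tm(1) H10_sq_int(1)[OF uH]]])
    show "AE x in M. \<phi> x - g x = \<phi> x - u x" using ug by eventually_elim simp
  qed
  finally have 1: "L2norm lborel (\<lambda>x. \<phi> x - g x) < d" using \<phi>(2) by simp
  have 2: "L2norm lborel (\<lambda>x. g (x + z) - \<phi> (x + z)) < d"
    using L2norm_lborel_translate[of "\<lambda>x. g x - \<phi> x" z] 1 L2norm_minus_commute[of lborel g \<phi>] by simp
  have "L2norm lborel (\<lambda>x. g (x + z) - g x)
      \<le> L2norm lborel (\<lambda>x. g (x + z) - \<phi> (x + z)) + L2norm lborel (\<lambda>x. \<phi> (x + z) - g x)"
    by (intro L2norm_triangle_diff sq_int_lborel_translate g_sq_int T)
  also have "L2norm lborel (\<lambda>x. \<phi> (x + z) - g x)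
      \<le> L2norm lborel (\<lambda>x. \<phi> (x + z) - \<phi> x) + L2norm lborel (\<lambda>x. \<phi> x - g x)"
    by (intro L2norm_triangle_diff sq_int_lborel_translate g_sq_int T)
  also have "L2norm lborel (\<lambda>x. \<phi> (x + z) - \<phi> x) \<le> norm z * L2norm lborel (grad \<phi>)"
    by (rule test_function_translate[OF \<phi>(1)])
  also have "L2norm lborel (grad \<phi>) \<le> L2norm M (wgrad \<Omega> u) + d"
    using L2norm_diff_abs[OF Tm(2) H10_sq_int(2)[OF uH]] \<phi>(3) test_function_L2norm(2)[OF \<phi>(1)] by simp
  finally have "L2norm lborel (\<lambda>x. g (x + z) - g x) \<le> d + (norm z * (L2norm M (wgrad \<Omega> u) + d) + d)"
    using 1 2 by (simp add: mult_left_mono)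
  also have "\<dots> = norm z * L2norm M (wgrad \<Omega> u) + d * (2 + norm z)" by (simp add: algebra_simps)
  also have "d * (2 + norm z) = e"
  proof -
    have "2 + norm z > 0" using norm_ge_zero[of z] by linarith
    then show ?thesis by (simp add: d_def)
  qed
  finally show "L2norm lborel (\<lambda>x. g (x + z) - g x) \<le> norm z * L2norm M (wgrad \<Omega> u) + e" .
qed

text \<open>A nonnegative integral, so that Tonelli applies at all points, including those whose
  ball leaves the domain.\<close>

definition g_mean :: "real \<Rightarrow> 'a \<Rightarrow> ennreal" where
  "g_mean r x = (\<integral>\<^sup>+y. ennreal (g y * bump x r y) \<partial>lborel)"

lemma g_mean_eq:
  assumes "r > 0" "cball x r \<subseteq> \<Omega>"
  shows "g_mean r x = ennreal (LINT y|M. u y * bump x r y)"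
proof -
  have b: "(\<lambda>y. flat 1 (radial x r y)) \<in> sq_int lborel"
    by (rule test_function_sq_int_lborel(1)[OF flat_radial_test_function[OF assms]])
  have "integrable lborel (\<lambda>y. g y * flat 1 (radial x r y) / r ^ DIM('a))"
    by (intro integrable_divide integrable_mult_sq[OF g_sq_int b])
  then have i: "integrable lborel (\<lambda>y. g y * bump x r y)" by (simp add: bump_def)
  have "g_mean r x = ennreal (LINT y|lborel. g y * bump x r y)"
    unfolding g_mean_def using g0 bump_nonneg[OF assms(1)] by (intro nn_integral_eq_integral[OF i] AE_I2 mult_nonneg_nonneg)
  also have "(LINT y|lborel. g y * bump x r y) = (LINT y|M. g y * bump x r y)"
    using dom_sets g_out by (intro integral_lebesgue_on_eq_lborel[symmetric]) auto
  also have "\<dots> = (LINT y|M. u y * bump x r y)"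
  proof (rule integral_cong_AE)
    show "(\<lambda>y. g y * bump x r y) \<in> borel_measurable M" by (rule borel_measurable_lebesgue_on) simp
    show "(\<lambda>y. u y * bump x r y) \<in> borel_measurable M"
      by (intro borel_measurable_times sq_int_measurable[OF H10_sq_int(1)[OF uH]] borel_measurable_lebesgue_on[OF bump_measurable])
    show "AE y in M. g y * bump x r y = u y * bump x r y" using ug by eventually_elim simp
  qed
  finally show ?thesis .
qed

lemma g_mean_antimono:
  assumes "0 < s" "s \<le> t" "cball x t \<subseteq> \<Omega>"
  shows "g_mean t x \<le> g_mean s x"
proof -
  have "cball x s \<subseteq> \<Omega>" using assms by (meson order_trans subset_cball)
  with assms bump_mean_antimono[OF u assms] show ?thesis
    by (subst (1 2) g_mean_eq) (auto intro: ennreal_leI)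
qed

text \<open>The heart of the maximum principle. On the zero set, g(x + z) is an increment of g, so
  the translation estimate makes the integral over the zero set of the means at scale s of order s,
  with a constant not depending on s.\<close>

lemma g_mean_integral_le:
  assumes Z [measurable]: "Z \<in> sets borel" and bZ: "bounded Z" and gZ: "\<And>x. x \<in> Z \<Longrightarrow> g x = 0"
  obtains c where "0 \<le> c" "\<And>s. s > 0 \<Longrightarrow> (\<integral>\<^sup>+x. indicator Z x * g_mean s x \<partial>lborel) \<le> ennreal (c * s)"
proof -
  have eZ: "emeasure lborel Z < \<infinity>" by (rule emeasure_bounded_finite[OF bZ])
  have sqZ: "(\<lambda>x. (norm (indicat_real Z x))\<^sup>2) = indicat_real Z" by (auto simp: indicator_def)
  have Zsq: "indicat_real Z \<in> sq_int lborel"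
    unfolding sq_int_def mem_Collect_eq sqZ using eZ by (auto intro!: integrable_real_indicator)
  define V where "V = L2norm lborel (indicat_real Z) * L2norm M (wgrad \<Omega> u)"
  have V0: "V \<ge> 0" by (simp add: V_def)
  have inner: "(\<integral>\<^sup>+x. ennreal (indicator Z x * g (x + z)) \<partial>lborel) \<le> ennreal (V * norm z)" for z
  proof -
    have d: "(\<lambda>x. g (x + z) - g x) \<in> sq_int lborel"
      by (intro sq_int_diff sq_int_lborel_translate g_sq_int)
    have i: "integrable lborel (\<lambda>x. indicator Z x * (g (x + z) - g x))"
      by (rule integrable_mult_sq[OF Zsq d])
    \<comment> \<open>Subtracting g x costs nothing on \<open>Z\<close> and turns the value into an
      increment.\<close>
    have eq: "indicator Z x * g (x + z) = indicator Z x * (g (x + z) - g x)" for x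
      using gZ by (auto simp: indicator_def)
    have "(\<integral>\<^sup>+x. ennreal (indicator Z x * g (x + z)) \<partial>lborel)
        = ennreal (LINT x|lborel. indicator Z x * (g (x + z) - g x))"
      unfolding eq by (rule nn_integral_eq_integral[OF i]) (use g0 in \<open>simp flip: eq\<close>)
    also have "(LINT x|lborel. indicator Z x * (g (x + z) - g x))
        \<le> L2norm lborel (indicat_real Z) * L2norm lborel (\<lambda>x. g (x + z) - g x)"
      using L2_Cauchy_Schwarz[OF Zsq d] by simp
    also have "\<dots> \<le> L2norm lborel (indicat_real Z) * (norm z * L2norm M (wgrad \<Omega> u))"
      by (intro mult_left_mono g_translate) simp
    also have "\<dots> = V * norm z" by (simp add: V_def)
    finally show ?thesis by (simp add: ennreal_leI)
  qed
  have "(\<integral>\<^sup>+x. indicator Z x * g_mean s x \<partial>lborel) \<le> ennreal ((V * (2 * 2 ^ DIM('a))) * s)" if s: "s > 0" for s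
  proof -
    have "(\<integral>\<^sup>+x. indicator Z x * g_mean s x \<partial>lborel)
        = (\<integral>\<^sup>+x. (\<integral>\<^sup>+z. ennreal (indicator Z x * g (x + z)) * ennreal (bump 0 s z) \<partial>lborel) \<partial>lborel)"
    proof (rule nn_integral_cong)
      fix x
      have "g_mean s x = (\<integral>\<^sup>+z. ennreal (g (x + z) * bump 0 s z) \<partial>lborel)"
        unfolding g_mean_def by (subst nn_integral_lborel_translate[of _ x]) (simp_all add: bump_translate)
      also have "indicator Z x * \<dots> = (\<integral>\<^sup>+z. indicator Z x * ennreal (g (x + z) * bump 0 s z) \<partial>lborel)"
        by (rule nn_integral_cmult[symmetric]) simp
      finally show "indicator Z x * g_mean s x
          = (\<integral>\<^sup>+z. ennreal (indicator Z x * g (x + z)) * ennreal (bump 0 s z) \<partial>lborel)"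
        by (simp add: indicator_def ennreal_mult[OF g0 bump_nonneg[OF s]])
    qed
    also have "\<dots> = (\<integral>\<^sup>+z. (\<integral>\<^sup>+x. ennreal (indicator Z x * g (x + z)) * ennreal (bump 0 s z) \<partial>lborel) \<partial>lborel)"
      by (rule lborel_pair.Fubini') measurable
    also have "\<dots> \<le> (\<integral>\<^sup>+z. ennreal (V * s) * ennreal (bump (0::'a) s z) \<partial>lborel)"
    proof (rule nn_integral_mono)
      fix z :: 'a
      have "(\<integral>\<^sup>+x. ennreal (indicator Z x * g (x + z)) * ennreal (bump 0 s z) \<partial>lborel)
          = (\<integral>\<^sup>+x. ennreal (indicator Z x * g (x + z)) \<partial>lborel) * ennreal (bump 0 s z)"
        by (rule nn_integral_multc) simp
      also have "\<dots> \<le> ennreal (V * s) * ennreal (bump 0 s z)"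
      proof (cases "norm z < s")
        case True
        then have "V * norm z \<le> V * s" using V0 by (intro mult_left_mono) auto
        with inner[of z] show ?thesis by (intro mult_right_mono) (auto intro: order_trans ennreal_leI)
      next
        case False
        then show ?thesis using s by (simp add: bump_outside)
      qed
      finally show "(\<integral>\<^sup>+x. ennreal (indicator Z x * g (x + z)) * ennreal (bump 0 s z) \<partial>lborel)
          \<le> ennreal (V * s) * ennreal (bump 0 s z)" .
    qed
    also have "\<dots> = ennreal (V * s) * (\<integral>\<^sup>+z. ennreal (bump (0::'a) s z) \<partial>lborel)"
      by (rule nn_integral_cmult) simp
    also have "\<dots> \<le> ennreal (V * s) * ennreal (2 * 2 ^ DIM('a))"
      by (rule mult_left_mono[OF nn_integral_bump_le[OF s]]) simp
    also have "\<dots> = ennreal ((V * (2 * 2 ^ DIM('a))) * s)"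
      using V0 s by (simp add: ennreal_mult[symmetric] mult_ac)
    finally show ?thesis .
  qed
  with V0 show thesis by (intro that[of "V * (2 * 2 ^ DIM('a))"]) auto
qed

text \<open>On the zero set the mean at scale t is at most the mean at any smaller scale s, whose
  integral is O(s). So the mean at scale t vanishes at almost every zero, and positivity of the bump
  makes g vanish almost everywhere on the ball.\<close>

lemma g_zero_spreads:
  assumes t: "t > 0"
  shows "AE x in lborel. cball x (2 * t) \<subseteq> \<Omega> \<and> g x = 0 \<longrightarrow> (AE y in lborel. y \<in> ball x t \<longrightarrow> g y = 0)"
proof -
  have ne: "- \<Omega> \<noteq> {}"
  proof
    assume "- \<Omega> = {}"
    then have "\<Omega> = UNIV" by blast
    with bounded_dom not_bounded_UNIV show False by blast
  qed
  \<comment> \<open>The strict inequality for the distance defines an open set, so \<open>Z\<close>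
    is Borel. It still contains the zeros whose closed ball of radius 2 * t lies in the domain, and
    keeps the ball of radius t inside for the monotonicity.\<close>
  define Z where "Z = {x. infdist x (- \<Omega>) > t} \<inter> {x. g x = 0}"
  have sub: "cball x t \<subseteq> \<Omega>" if "x \<in> Z" for x
  proof
    fix y assume y: "y \<in> cball x t"
    show "y \<in> \<Omega>"
    proof (rule ccontr)
      assume "y \<notin> \<Omega>"
      then have "infdist x (- \<Omega>) \<le> dist x y" by (intro infdist_le) simp
      with y that show False by (simp add: Z_def)
    qed
  qed
  have inZ: "x \<in> Z" if "cball x (2 * t) \<subseteq> \<Omega>" "g x = 0" for x
  proof -
    have "2 * t \<le> infdist x (- \<Omega>)"
      unfolding infdist_notempty[OF ne]
    proof (rule cINF_greatest[OF ne])
      fix y assume "y \<in> - \<Omega>"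
      with that(1) have "y \<notin> cball x (2 * t)" by blast
      then show "2 * t \<le> dist x y" by simp
    qed
    with t that(2) show ?thesis by (simp add: Z_def)
  qed
  have "open {x. infdist x (- \<Omega>) > t}"
    by (rule open_Collect_less) (intro continuous_intros)+
  then have [measurable]: "{x. infdist x (- \<Omega>) > t} \<in> sets borel" by (rule borel_open)
  have Zm [measurable]: "Z \<in> sets borel"
    unfolding Z_def by (intro sets.Int) measurable
  have "Z \<subseteq> \<Omega>" using sub t by (meson centre_in_cball less_imp_le subset_iff)
  then have bZ: "bounded Z" using bounded_dom bounded_subset by blast
  obtain c where c: "0 \<le> c" "\<And>s. s > 0 \<Longrightarrow> (\<integral>\<^sup>+x. indicator Z x * g_mean s x \<partial>lborel) \<le> ennreal (c * s)"
    by (rule g_mean_integral_le[OF Zm bZ]) (auto simp: Z_def)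
  have gm [measurable]: "(\<lambda>x. g_mean t x) \<in> borel_measurable borel"
  proof -
    have eq: "g_mean t x = (\<integral>\<^sup>+z. ennreal (g (x + z) * bump 0 t z) \<partial>lborel)" for x
      unfolding g_mean_def by (subst nn_integral_lborel_translate[of _ x]) (simp_all add: bump_translate)
    show ?thesis unfolding eq by measurable
  qed
  have le: "(\<integral>\<^sup>+x. indicator Z x * g_mean t x \<partial>lborel) \<le> ennreal (c * s)" if s: "0 < s" "s \<le> t" for s
  proof -
    have "(\<integral>\<^sup>+x. indicator Z x * g_mean t x \<partial>lborel) \<le> (\<integral>\<^sup>+x. indicator Z x * g_mean s x \<partial>lborel)"
    proof (rule nn_integral_mono)
      fix x
      show "indicator Z x * g_mean t x \<le> indicator Z x * g_mean s x"
        using g_mean_antimono[OF s sub] by (cases "x \<in> Z") auto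
    qed
    also have "\<dots> \<le> ennreal (c * s)" by (rule c(2)[OF s(1)])
    finally show ?thesis .
  qed
  have "(\<integral>\<^sup>+x. indicator Z x * g_mean t x \<partial>lborel) \<le> 0"
  proof (rule ennreal_le_epsilon)
    fix e :: real assume e: "e > 0"
    define s where "s = min t (e / (c + 1))"
    have s: "0 < s" "s \<le> t" using t e c(1) by (auto simp: s_def)
    have "c * s \<le> c * (e / (c + 1))" using c(1) by (intro mult_left_mono) (auto simp: s_def)
    also have "\<dots> \<le> e" using c(1) e by (simp add: field_simps)
    finally show "(\<integral>\<^sup>+x. indicator Z x * g_mean t x \<partial>lborel) \<le> 0 + ennreal e"
      using le[OF s] by (auto intro: order_trans ennreal_leI)
  qed
  then have "AE x in lborel. indicator Z x * g_mean t x = 0"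
    by (subst (asm) le_zero_eq) (simp add: nn_integral_0_iff_AE)
  then show ?thesis
  proof eventually_elim
    case (elim x)
    show ?case
    proof
      assume "cball x (2 * t) \<subseteq> \<Omega> \<and> g x = 0"
      then have "x \<in> Z" using inZ by blast
      with elim have "g_mean t x = 0" by simp
      then have "AE y in lborel. ennreal (g y * bump x t y) = 0"
        unfolding g_mean_def by (subst (asm) nn_integral_0_iff_AE) auto
      then show "AE y in lborel. y \<in> ball x t \<longrightarrow> g y = 0"
      proof eventually_elim
        case (elim y)
        show ?case
        proof
          assume "y \<in> ball x t"
          then have "bump x t y > 0" using t by (intro bump_pos) (auto simp: dist_norm norm_minus_commute)
          moreover have "g y * bump x t y \<le> 0" using elim by (simp add: ennreal_eq_0_iff)
          ultimately show "g y = 0" using g0[of y] by (simp add: mult_le_0_iff)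
        qed
      qed
    qed
  qed
qed

text \<open>The points near which g vanishes almost everywhere. Unlike the zero set, it is
  unaffected by changes on null sets and is open, as a connectedness argument demands.\<close>

definition g_flat :: "'a set" where
  "g_flat = {x \<in> \<Omega>. \<exists>r>0. AE y in lborel. y \<in> ball x r \<longrightarrow> g y = 0}"

text \<open>The complement is open too: a flat point close to y has almost everywhere zeros around
  it, and from one of these the vanishing spreads over a ball of fixed size that reaches y.\<close>

lemma g_flat_eq:
  assumes conn: "connected \<Omega>" and ne: "g_flat \<noteq> {}"
  shows "g_flat = \<Omega>"
proof -
  have sub: "g_flat \<subseteq> \<Omega>" by (auto simp: g_flat_def)
  have shift: "AE y in lborel. y \<in> ball x r' \<longrightarrow> g y = 0"
    if "AE y in lborel. y \<in> ball x0 r \<longrightarrow> g y = 0" "dist x0 x + r' \<le> r" for x x0 r r'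
    using that(1)
  proof eventually_elim
    case (elim y)
    have "dist x0 y \<le> dist x0 x + dist x y" by (rule dist_triangle)
    with that(2) have "dist x y < r' \<longrightarrow> dist x0 y < r" by linarith
    with elim show ?case by simp
  qed
  have "open g_flat"
    unfolding open_contains_ball
  proof
    fix x assume "x \<in> g_flat"
    then obtain r where x: "x \<in> \<Omega>" and r: "r > 0" "AE y in lborel. y \<in> ball x r \<longrightarrow> g y = 0"
      by (auto simp: g_flat_def)
    obtain e where e: "e > 0" "ball x e \<subseteq> \<Omega>" using open_dom x open_contains_ball by metis
    have "ball x (min (r / 2) e) \<subseteq> g_flat"
    proof
      fix y assume y: "y \<in> ball x (min (r / 2) e)"
      then have "AE z in lborel. z \<in> ball y (r / 2) \<longrightarrow> g z = 0" by (intro shift[OF r(2)]) simp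
      with y e r(1) show "y \<in> g_flat" unfolding g_flat_def by (auto intro!: exI[of _ "r / 2"])
    qed
    with e r show "\<exists>e>0. ball x e \<subseteq> g_flat" by (intro exI[of _ "min (r / 2) e"]) auto
  qed
  moreover have "open (\<Omega> - g_flat)"
    unfolding open_contains_ball
  proof
    fix y assume y: "y \<in> \<Omega> - g_flat"
    obtain e where e: "e > 0" "ball y e \<subseteq> \<Omega>" using open_dom y open_contains_ball by (metis DiffD1)
    \<comment> \<open>The balls used below reach at most 2 * t + t + 6 * t from y, which is less
      than e = 16 * t.\<close>
    define t where "t = e / 16"
    have t: "t > 0" using e by (simp add: t_def)
    have "ball y (2 * t) \<inter> g_flat = {}"
    proof (rule ccontr)
      assume "ball y (2 * t) \<inter> g_flat \<noteq> {}"
      then obtain x where x: "dist y x < 2 * t" "x \<in> g_flat" by auto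
      then obtain r where r: "r > 0" "AE z in lborel. z \<in> ball x r \<longrightarrow> g z = 0" by (auto simp: g_flat_def)
      define \<rho> where "\<rho> = min r t"
      have \<rho>: "\<rho> > 0" using r t by (simp add: \<rho>_def)
      have ae: "AE z in lborel. z \<in> ball x \<rho> \<longrightarrow> (AE w in lborel. w \<in> ball z (3 * t) \<longrightarrow> g w = 0)"
        using r(2) g_zero_spreads[of "3 * t"] t
      proof (elim eventually_elim2)
        fix z
        assume z: "z \<in> ball x r \<longrightarrow> g z = 0"
          "cball z (2 * (3 * t)) \<subseteq> \<Omega> \<and> g z = 0 \<longrightarrow> (AE w in lborel. w \<in> ball z (3 * t) \<longrightarrow> g w = 0)"
        show "z \<in> ball x \<rho> \<longrightarrow> (AE w in lborel. w \<in> ball z (3 * t) \<longrightarrow> g w = 0)"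
        proof
          assume zx: "z \<in> ball x \<rho>"
          have "cball z (2 * (3 * t)) \<subseteq> ball y e"
          proof
            fix w assume w: "w \<in> cball z (2 * (3 * t))"
            have "dist y w \<le> dist y x + dist x z + dist z w"
              using dist_triangle[of y w x] dist_triangle[of x w z] by linarith
            then show "w \<in> ball y e" using x(1) zx w t by (simp add: \<rho>_def t_def)
          qed
          with e zx z show "AE w in lborel. w \<in> ball z (3 * t) \<longrightarrow> g w = 0" by (auto simp: \<rho>_def)
        qed
      qed simp
      \<comment> \<open>Spreading is known for almost every centre only, so x itself may fail; its
        small ball has positive measure and contains a good centre. That centre is closer than 3 * t
        to y.\<close>
      have "\<exists>z. z \<in> ball x \<rho> \<and> (AE w in lborel. w \<in> ball z (3 * t) \<longrightarrow> g w = 0)"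
      proof (rule ccontr)
        assume "\<not> ?thesis"
        with ae have "AE z in lborel. z \<notin> ball x \<rho>" by (elim eventually_mono) blast
        then have "ball x \<rho> \<in> null_sets lborel" by (subst AE_iff_null_sets) auto
        then have "negligible (ball x \<rho>)" unfolding negligible_iff_null_sets by (rule null_sets_completionI)
        with \<rho> show False using open_not_negligible[of "ball x \<rho>"] by simp
      qed
      then obtain z where z: "z \<in> ball x \<rho>" "AE w in lborel. w \<in> ball z (3 * t) \<longrightarrow> g w = 0" by blast
      have "dist z y \<le> dist x z + dist y x" using dist_triangle[of z y x] by (simp add: dist_commute)
      then have "dist z y < 3 * t" using z(1) x(1) by (simp add: \<rho>_def)
      then have "AE w in lborel. w \<in> ball y (3 * t - dist z y) \<longrightarrow> g w = 0" by (intro shift[OF z(2)]) simp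
      with y \<open>dist z y < 3 * t\<close> have "y \<in> g_flat" unfolding g_flat_def by (auto intro!: exI[of _ "3 * t - dist z y"])
      with y show False by simp
    qed
    moreover have "ball y (2 * t) \<subseteq> ball y e" using e by (intro subset_ball) (simp add: t_def)
    ultimately have "ball y (2 * t) \<subseteq> \<Omega> - g_flat" using e(2) by blast
    with t show "\<exists>e>0. ball y e \<subseteq> \<Omega> - g_flat" by (intro exI[of _ "2 * t"]) simp
  qed
  ultimately show ?thesis
    using connectedD[OF conn, of g_flat "\<Omega> - g_flat"] ne sub by blast
qed

text \<open>Lindelof reduces the local statements to countably many, so that their exceptional sets
  still form a null set.\<close>

lemma g_flat_all_zero:
  assumes "g_flat = \<Omega>"
  shows "AE x in lborel. g x = 0"
proof -
  have "\<forall>x\<in>\<Omega>. \<exists>r>0. AE y in lborel. y \<in> ball x r \<longrightarrow> g y = 0" using assms unfolding g_flat_def by blast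
  then obtain r where r: "\<And>x. x \<in> \<Omega> \<Longrightarrow> r x > 0"
    "\<And>x. x \<in> \<Omega> \<Longrightarrow> AE y in lborel. y \<in> ball x (r x) \<longrightarrow> g y = 0" by metis
  obtain \<F> where \<F>: "\<F> \<subseteq> (\<lambda>x. ball x (r x)) ` \<Omega>" "countable \<F>" "\<Union>\<F> = (\<Union>x\<in>\<Omega>. ball x (r x))"
    by (rule Lindelof[of "(\<lambda>x. ball x (r x)) ` \<Omega>"]) auto
  have "\<forall>B\<in>\<F>. AE y in lborel. y \<in> B \<longrightarrow> g y = 0" using \<F>(1) r(2) by blast
  then have "AE y in lborel. \<forall>B\<in>\<F>. y \<in> B \<longrightarrow> g y = 0" unfolding AE_ball_countable[OF \<F>(2)] .
  then show ?thesis
  proof eventually_elim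
    case (elim y)
    show ?case
    proof (cases "y \<in> \<Omega>")
      case True
      then have "y \<in> \<Union>\<F>" unfolding \<F>(3) using r(1) by force
      with elim show ?thesis by blast
    qed (rule g_out)
  qed
qed

text \<open>If there are no flat points, almost no point can be a zero: spreading with some radius 1
  / (n + 1) would make it flat. Restricting to these countably many radii leaves a single
  exceptional null set.\<close>

lemma g_positive_or_zero:
  assumes conn: "connected \<Omega>"
  shows "(AE x in M. u x = 0) \<or> (AE x in M. 0 < u x)"
proof (cases "g_flat = {}")
  case False
  have "AE x in lborel. g x = 0" by (rule g_flat_all_zero[OF g_flat_eq[OF conn False]])
  then have "AE x in lebesgue. x \<in> \<Omega> \<longrightarrow> g x = 0" by (intro AE_completion) auto
  then have "AE x in M. g x = 0" using dom_sets by (simp add: AE_restrict_space_iff)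
  with ug have "AE x in M. u x = 0" by eventually_elim simp
  then show ?thesis ..
next
  case True
  have "AE x in lborel. \<forall>n. cball x (2 * (1 / real (Suc n))) \<subseteq> \<Omega> \<and> g x = 0
      \<longrightarrow> (AE y in lborel. y \<in> ball x (1 / real (Suc n)) \<longrightarrow> g y = 0)"
    unfolding AE_all_countable by (intro allI g_zero_spreads) simp
  then have "AE x in lborel. x \<in> \<Omega> \<longrightarrow> 0 < g x"
  proof eventually_elim
    case (elim x)
    show ?case
    proof
      assume x: "x \<in> \<Omega>"
      obtain e where e: "e > 0" "cball x e \<subseteq> \<Omega>" using open_dom x open_contains_cball by metis
      obtain n where n: "1 / real (Suc n) < e / 2" using nat_approx_posE[of "e / 2"] e by auto
      have "cball x (2 * (1 / real (Suc n))) \<subseteq> cball x e" using n by (intro subset_cball) linarith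
      with e have s: "cball x (2 * (1 / real (Suc n))) \<subseteq> \<Omega>" by blast
      have "g x \<noteq> 0"
      proof
        assume "g x = 0"
        with elim s have "AE y in lborel. y \<in> ball x (1 / real (Suc n)) \<longrightarrow> g y = 0" by blast
        with x have "x \<in> g_flat" unfolding g_flat_def by (auto intro!: exI[of _ "1 / real (Suc n)"])
        with True show False by blast
      qed
      with g0[of x] show "0 < g x" by linarith
    qed
  qed
  then have "AE x in lebesgue. x \<in> \<Omega> \<longrightarrow> 0 < g x" by (intro AE_completion) auto
  then have "AE x in M. 0 < g x" using dom_sets by (simp add: AE_restrict_space_iff)
  with ug have "AE x in M. 0 < u x" by eventually_elim simp
  then show ?thesis ..
qed

end

lemma strong_maximum_principle:
  assumes conn: "connected \<Omega>" and u: "superharmonic u"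
  shows "(AE x in M. u x = 0) \<or> (AE x in M. 0 < u x)"
proof -
  have "u \<in> sq_int M" "AE x in M. 0 \<le> u x" using u H10_sq_int(1) by (auto simp: superharmonic_def)
  then obtain g where "g \<in> borel_measurable borel" "\<And>x. 0 \<le> g x" "\<And>x. x \<notin> \<Omega> \<Longrightarrow> g x = 0" "AE x in M. u x = g x"
    by (rule borel_representative) (rule that)
  from g_positive_or_zero[OF u this conn] show ?thesis .
qed

end

subsection \<open>The spectral gap\<close>

context bounded_open
begin

lemma AE_zero_of_mass_zero:
  assumes u: "u \<in> sq_int M" and v: "v \<in> sq_int M" and "mass u v = 0"
    and uv: "AE x in M. 0 \<le> u x * v x" and v0: "AE x in M. 0 < v x"
  shows "AE x in M. u x = 0"
proof -
  have "AE x in M. u x * v x = 0"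
    using assms(3) integral_nonneg_eq_0_iff_AE[OF integrable_mult_sq[OF u v] uv] by (simp add: mass_def)
  with v0 show ?thesis by eventually_elim simp
qed

lemma superharmonic_eigenfunction:
  assumes "\<alpha> > 0" "\<mu> \<ge> 0" "eigenfunction \<Omega> (\<lambda>x. \<alpha>) \<mu> u" "AE x in M. 0 \<le> u x"
  shows "superharmonic u"
  unfolding superharmonic_def
proof (intro conjI ballI impI)
  show uH: "u \<in> H10 \<Omega>" using assms(3) by (simp add: eigenfunction_iff)
  fix \<phi> assume \<phi>: "\<phi> \<in> test_functions \<Omega>" "\<forall>x. 0 \<le> \<phi> x"
  have "0 \<le> mass u \<phi>"
    unfolding mass_def
    by (rule integral_nonneg_AE) (use assms(4) in eventually_elim, use \<phi>(2) in simp)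
  moreover have "\<alpha> * energy (\<lambda>x. 1) u \<phi> = \<mu> * mass u \<phi>"
    using assms(3) test_function_H10(1)[OF \<phi>(1)] by (simp add: eigenfunction_iff energy_def)
  ultimately have "0 \<le> \<alpha> * energy (\<lambda>x. 1) u \<phi>" using assms(2) by simp
  then show "0 \<le> energy (\<lambda>x. 1) u \<phi>" using assms(1) by (simp add: zero_le_mult_iff)
qed (rule assms(4))

context
  fixes \<alpha> :: real and u0 :: "'a \<Rightarrow> real"
  assumes conn: "connected \<Omega>" and \<alpha>: "\<alpha> > 0" and u0: "is_u0 \<Omega> \<alpha> u0"
begin

lemma coeff_const: "coeff \<alpha> \<alpha> (\<lambda>x. \<alpha>)"
  by (simp add: coeff_def)

lemma u0_facts:
  shows "u0 \<in> H10 \<Omega>" "mass u0 u0 = 1" "AE x in M. 0 < u0 x"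
    and "eigenfunction \<Omega> (\<lambda>x. \<alpha>) (lambda0 \<Omega> \<alpha>) u0"
    and "v \<in> H10 \<Omega> \<Longrightarrow> energy (\<lambda>x. \<alpha>) u0 v = lambda0 \<Omega> \<alpha> * mass u0 v"
  using u0 unfolding is_u0_def eigenfunction_iff by (auto simp: mass_def power2_eq_square)

lemma H10_nontrivial: "\<exists>v\<in>H10 \<Omega>. mass v v > 0"
  using u0_facts(1,2) by (intro bexI[of _ u0]) auto

lemma lambda0_le: "v \<in> H10 \<Omega> \<Longrightarrow> lambda0 \<Omega> \<alpha> * mass v v \<le> energy (\<lambda>x. \<alpha>) v v"
  unfolding lambda0_def by (rule first_eigenvalue_minimal(2)[OF coeff_const \<alpha> H10_nontrivial])

text \<open>The Poincare inequality forbids a vanishing gradient for a function of mass 1.\<close>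

lemma lambda0_pos: "lambda0 \<Omega> \<alpha> > 0"
proof -
  obtain P where P: "P > 0" "\<And>u. u \<in> H10 \<Omega> \<Longrightarrow> L2norm M u \<le> P * L2norm M (wgrad \<Omega> u)"
    by (rule poincare) (rule that)
  have "1 = (L2norm M u0)\<^sup>2" using u0_facts(2) by (simp add: mass_self)
  also have "\<dots> \<le> (P * L2norm M (wgrad \<Omega> u0))\<^sup>2" by (intro power_mono P u0_facts) simp
  finally have "L2norm M (wgrad \<Omega> u0) \<noteq> 0" by auto
  then have "0 < \<alpha> * (L2norm M (wgrad \<Omega> u0))\<^sup>2" using \<alpha> by simp
  also have "\<dots> \<le> energy (\<lambda>x. \<alpha>) u0 u0" by (rule energy_lower[OF coeff_const u0_facts(1)])
  also have "\<dots> = lambda0 \<Omega> \<alpha>" using u0_facts(5)[OF u0_facts(1)] u0_facts(2) by simp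
  finally show ?thesis .
qed

text \<open>By the maximum principle the positive part of w is zero or positive almost everywhere,
  so w has one sign. Its product with the positive u0 then has one sign as well, and integral zero
  forces w = 0.\<close>

lemma lambda0_simple:
  assumes w: "eigenfunction \<Omega> (\<lambda>x. \<alpha>) (lambda0 \<Omega> \<alpha>) w"
  shows "mass w u0 \<noteq> 0"
proof
  assume orth: "mass w u0 = 0"
  have wH: "w \<in> H10 \<Omega>" "mass w w > 0" using w by (auto simp: eigenfunction_iff)
  note sq = H10_sq_int(1)[OF wH(1)] H10_sq_int(1)[OF u0_facts(1)]
  let ?v = "\<lambda>x. max 0 (w x)"
  have vH: "?v \<in> H10 \<Omega>" by (rule H10_positive_part[OF wH(1)])
  \<comment> \<open>The second disjunct rebinds x and is a fixed proposition; carrying it inside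
    lets both cases prove the same formula.\<close>
  have "AE x in M. 0 \<le> w x * u0 x \<and> 0 < u0 x \<or> (AE x in M. w x \<le> 0)"
  proof (cases "mass ?v ?v > 0")
    case True
    have e: "eigenfunction \<Omega> (\<lambda>x. \<alpha>) (lambda0 \<Omega> \<alpha>) ?v"
      by (rule positive_part_eigenfunction[OF coeff_const w lambda0_le True])
    have "superharmonic ?v"
      by (rule superharmonic_eigenfunction[OF \<alpha> less_imp_le[OF lambda0_pos] e]) simp
    from strong_maximum_principle[OF conn this] True mass_pos_iff[OF H10_sq_int(1)[OF vH]]
    have "AE x in M. 0 < ?v x" by blast
    with u0_facts(3) show ?thesis by eventually_elim (simp add: max_def split: if_splits)
  next
    case False
    then have "AE x in M. ?v x = 0" using mass_pos_iff[OF H10_sq_int(1)[OF vH]] by blast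
    then have "AE x in M. w x \<le> 0" by eventually_elim (simp add: max_def split: if_splits)
    then show ?thesis by simp
  qed
  then consider "AE x in M. 0 \<le> w x * u0 x" | "AE x in M. w x \<le> 0"
    by (cases "AE x in M. w x \<le> 0") auto
  then have "AE x in M. w x = 0"
  proof cases
    case 1
    then show ?thesis by (rule AE_zero_of_mass_zero[OF sq orth _ u0_facts(3)])
  next
    case 2
    have "AE x in M. - w x = 0"
    proof (rule AE_zero_of_mass_zero[OF sq_int_uminus[OF sq(1)] sq(2) _ _ u0_facts(3)])
      show "mass (\<lambda>x. - w x) u0 = 0" using orth by (simp add: mass_def)
      show "AE x in M. 0 \<le> - w x * u0 x"
        using 2 u0_facts(3) by eventually_elim (simp add: mult_nonpos_nonneg)
    qed
    then show ?thesis by eventually_elim simp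
  qed
  with wH(2) mass_pos_iff[OF sq(1)] show False by blast
qed

text \<open>The minimum of the Rayleigh quotient on the orthogonal complement of u0 is attained.
  Were it equal to \<lambda>0, the minimiser would also minimise without the constraint and so be an
  eigenfunction orthogonal to u0.\<close>

lemma spectral_gap:
  obtains \<gamma> where "lambda0 \<Omega> \<alpha> < \<gamma>"
    "\<And>w. w \<in> H10 \<Omega> \<Longrightarrow> mass w u0 = 0 \<Longrightarrow> \<gamma> * mass w w \<le> energy (\<lambda>x. \<alpha>) w w"
proof (cases "\<exists>v\<in>H10 \<Omega>. mass v v > 0 \<and> mass v u0 = 0")
  case True
  obtain u where u: "u \<in> H10 \<Omega>" "mass u u = 1" "mass u u0 = 0"
    "\<And>v. v \<in> H10 \<Omega> \<Longrightarrow> mass v u0 = 0 \<Longrightarrow> energy (\<lambda>x. \<alpha>) u u * mass v v \<le> energy (\<lambda>x. \<alpha>) v v"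
    by (rule rayleigh_minimizer[OF coeff_const \<alpha> H10_sq_int(1)[OF u0_facts(1)] True]) (rule that)
  have "energy (\<lambda>x. \<alpha>) u u \<noteq> lambda0 \<Omega> \<alpha>"
  proof
    assume "energy (\<lambda>x. \<alpha>) u u = lambda0 \<Omega> \<alpha>"
    then have "eigenfunction \<Omega> (\<lambda>x. \<alpha>) (lambda0 \<Omega> \<alpha>) u"
      by (intro minimizer_eigenfunction[OF coeff_const u(1)] lambda0_le) (simp_all add: u(2))
    from lambda0_simple[OF this] u(3) show False by simp
  qed
  with lambda0_le[OF u(1)] u(2) have "lambda0 \<Omega> \<alpha> < energy (\<lambda>x. \<alpha>) u u" by simp
  then show thesis using u(4) by (rule that)
next
  case False
  \<comment> \<open>Only functions of mass zero are orthogonal to u0 here, so any number above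
    \<lambda>0 serves as the gap.\<close>
  have "(lambda0 \<Omega> \<alpha> + 1) * mass w w \<le> energy (\<lambda>x. \<alpha>) w w" if "w \<in> H10 \<Omega>" "mass w u0 = 0" for w
  proof -
    have "mass w w = 0" using False that mass_nonneg[of w] by force
    with lambda0_le[OF that(1)] show ?thesis by simp
  qed
  then show thesis by (intro that[of "lambda0 \<Omega> \<alpha> + 1"]) auto
qed

lemma coeff_indicator:
  assumes "B \<in> sets lebesgue" "0 \<le> \<epsilon>"
  shows "coeff 0 \<alpha> (\<lambda>x. \<alpha> * indicator B x)" "coeff \<alpha> (\<alpha> * (1 + \<epsilon>)) (\<lambda>x. \<alpha> * (1 + \<epsilon> * indicator B x))"
proof -
  have "indicat_real B \<in> borel_measurable M"
    using assms(1) by (intro measurable_restrict_space1 borel_measurable_indicator) auto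
  then have "(\<lambda>x. \<alpha> * indicat_real B x) \<in> borel_measurable M"
    "(\<lambda>x. \<alpha> * (1 + \<epsilon> * indicat_real B x)) \<in> borel_measurable M"
    by (intro borel_measurable_times borel_measurable_add borel_measurable_const; assumption)+
  moreover have "0 \<le> \<alpha> * indicat_real B x" "\<alpha> * indicat_real B x \<le> \<alpha>"
    "\<alpha> \<le> \<alpha> * (1 + \<epsilon> * indicat_real B x)" "\<alpha> * (1 + \<epsilon> * indicat_real B x) \<le> \<alpha> * (1 + \<epsilon>)" for x
    using assms(2) \<alpha> by (auto simp: indicator_def)
  ultimately show "coeff 0 \<alpha> (\<lambda>x. \<alpha> * indicator B x)" "coeff \<alpha> (\<alpha> * (1 + \<epsilon>)) (\<lambda>x. \<alpha> * (1 + \<epsilon> * indicator B x))"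
    unfolding coeff_def by blast+
qed

lemma integral_indicator_lebesgue_on:
  assumes "B \<in> sets lebesgue" "B \<subseteq> \<Omega>"
  shows "(LINT x|lebesgue_on B. f x) = (LINT x|M. indicator B x * (f x :: real))"
proof -
  have "(LINT x|lebesgue_on B. f x) = (LINT x|lebesgue. indicator B x *\<^sub>R f x)"
    using assms(1) by (intro integral_restrict_space) auto
  also have "(\<lambda>x. indicator B x *\<^sub>R f x) = (\<lambda>x. indicator \<Omega> x *\<^sub>R (indicator B x * f x))"
    using assms(2) by (auto simp: indicator_def fun_eq_iff)
  also have "(LINT x|lebesgue. indicator \<Omega> x *\<^sub>R (indicator B x * f x)) = (LINT x|M. indicator B x * f x)"
    using dom_sets by (intro integral_restrict_space[symmetric]) auto
  finally show ?thesis .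
qed

text \<open>C and the threshold for \<epsilon> are built from \<lambda>0 and the gap before B and u1
  are fixed. What remains is to recognise \<lambda>1(B) and \<lambda>2(B) as values of the form
  weighted by the indicator of B.\<close>

lemma eigenvalue_expansion:
  "\<exists>C>0. \<exists>\<epsilon>0>0. \<forall>B u1. B \<in> sets lebesgue \<and> B \<subseteq> \<Omega> \<and> is_u1 \<Omega> \<alpha> u0 B u1 \<longrightarrow>
     (\<forall>\<epsilon>. 0 < \<epsilon> \<and> \<epsilon> < \<epsilon>0 \<longrightarrow>
        \<bar>lambda_eps \<Omega> \<alpha> \<epsilon> B
          - (lambda0 \<Omega> \<alpha> + \<epsilon> * lambda1 \<Omega> \<alpha> u0 B + \<epsilon>\<^sup>2 * lambda2 \<Omega> \<alpha> u0 u1 B)\<bar>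
        \<le> 2 * C * \<epsilon> ^ 3 * sqrt (lambda0 \<Omega> \<alpha> / \<alpha>))"
proof -
  obtain \<gamma> where \<gamma>: "lambda0 \<Omega> \<alpha> < \<gamma>"
    "\<And>w. w \<in> H10 \<Omega> \<Longrightarrow> mass w u0 = 0 \<Longrightarrow> \<gamma> * mass w w \<le> energy (\<lambda>x. \<alpha>) w w"
    by (rule spectral_gap) (rule that)
  define C where "C = upper_const (lambda0 \<Omega> \<alpha>) \<gamma> + lower_const (lambda0 \<Omega> \<alpha>) \<gamma>"
  have C: "0 < C"
    using upper_const_pos[OF lambda0_pos \<gamma>(1)] lower_const_nonneg[OF lambda0_pos \<gamma>(1)] by (simp add: C_def)
  define \<epsilon>0 where "\<epsilon>0 = contrast_bound (lambda0 \<Omega> \<alpha>) \<gamma>"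
  have \<epsilon>0: "0 < \<epsilon>0" unfolding \<epsilon>0_def by (rule contrast_bound_pos[OF lambda0_pos \<gamma>(1)])
  let ?D = "energy (\<lambda>x. \<alpha>)" and ?s = "sqrt (lambda0 \<Omega> \<alpha> / \<alpha>)"
  have s: "?s > 0" using lambda0_pos \<alpha> by simp
  have bound: "\<bar>lambda_eps \<Omega> \<alpha> \<epsilon> B
      - (lambda0 \<Omega> \<alpha> + \<epsilon> * lambda1 \<Omega> \<alpha> u0 B + \<epsilon>\<^sup>2 * lambda2 \<Omega> \<alpha> u0 u1 B)\<bar> \<le> C * \<epsilon> ^ 3"
    if B: "B \<in> sets lebesgue" "B \<subseteq> \<Omega>" and u1: "is_u1 \<Omega> \<alpha> u0 B u1" and \<epsilon>: "0 < \<epsilon>" "\<epsilon> < \<epsilon>0" for B u1 \<epsilon>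
  proof -
    let ?b = "energy (\<lambda>x. \<alpha> * indicator B x)" and ?a = "\<lambda>x. \<alpha> * (1 + \<epsilon> * indicator B x)"
    note cb = coeff_indicator(1)[OF B(1) order_refl] and ca = coeff_indicator(2)[OF B(1) less_imp_le[OF \<epsilon>(1)]]
    have l1: "lambda1 \<Omega> \<alpha> u0 B = ?b u0 u0"
      unfolding lambda1_def integral_indicator_lebesgue_on[OF B] energy_def
      by (simp add: power2_norm_eq_inner mult_ac)
    have l2: "lambda2 \<Omega> \<alpha> u0 u1 B = ?b u0 u1"
      unfolding lambda2_def integral_indicator_lebesgue_on[OF B] energy_def by (simp add: mult_ac)
    have split: "energy ?a v v = ?D v v + \<epsilon> * ?b v v" if v: "v \<in> H10 \<Omega>" for v
    proof -
      have "energy ?a v v = (LINT x|M. \<alpha> * (wgrad \<Omega> v x \<bullet> wgrad \<Omega> v x)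
          + \<epsilon> * (\<alpha> * indicator B x * (wgrad \<Omega> v x \<bullet> wgrad \<Omega> v x)))"
        unfolding energy_def by (simp add: algebra_simps)
      also have "\<dots> = ?D v v + \<epsilon> * ?b v v"
        unfolding energy_def
        using energy_integrable[OF coeff_const v v] energy_integrable[OF cb v v]
        by (subst Bochner_Integration.integral_add) (auto intro: integrable_mult_right)
      finally show ?thesis .
    qed
    show ?thesis
      unfolding l1 l2 lambda_eps_def C_def
    proof (rule simple_eigenvalue_expansion[OF lambda0_pos \<gamma>(1) sym_form_energy[OF coeff_const]
            sym_form_energy[OF cb] sym_form_mass])
      show "0 \<le> ?b v v" if "v \<in> H10 \<Omega>" for v using energy_lower[OF cb that] by simp
      show "?b v v \<le> ?D v v" if "v \<in> H10 \<Omega>" for v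
        using \<alpha> by (intro energy_mono[OF cb coeff_const _ that]) (simp add: indicator_def)
      show "u1 \<in> H10 \<Omega>" "mass u0 u1 = 0"
        using u1 by (auto simp: is_u1_def mass_def)
      show "?D u1 v - lambda0 \<Omega> \<alpha> * mass u1 v = - ?b u0 v + ?b u0 u0 * mass u0 v" if "v \<in> H10 \<Omega>" for v
        using u1 that by (simp add: is_u1_def l1 energy_def mass_def)
      show "first_eigenvalue \<Omega> ?a * mass v v \<le> ?D v v + \<epsilon> * ?b v v" if "v \<in> H10 \<Omega>" for v
        using first_eigenvalue_minimal(2)[OF ca \<alpha> H10_nontrivial that] split[OF that] by simp
      obtain v where "eigenfunction \<Omega> ?a (first_eigenvalue \<Omega> ?a) v"
        using first_eigenvalue_minimal(1)[OF ca \<alpha> H10_nontrivial] by blast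
      then have "v \<in> H10 \<Omega>" "mass v v > 0" "energy ?a v v = first_eigenvalue \<Omega> ?a * mass v v"
        by (auto simp: eigenfunction_iff)
      with split show "\<exists>v\<in>H10 \<Omega>. mass v v > 0 \<and> ?D v v + \<epsilon> * ?b v v = first_eigenvalue \<Omega> ?a * mass v v"
        by (intro bexI[of _ v]) auto
      show "0 \<le> mass v v" for v by (rule mass_nonneg)
      show "u0 \<in> H10 \<Omega>" "mass u0 u0 = 1" by (rule u0_facts)+
      show "?D u0 v = lambda0 \<Omega> \<alpha> * mass u0 v" if "v \<in> H10 \<Omega>" for v using that by (rule u0_facts(5))
      show "\<gamma> * mass w w \<le> ?D w w" if "w \<in> H10 \<Omega>" "mass w u0 = 0" for w using that by (rule \<gamma>(2))
      show "0 < \<epsilon>" "\<epsilon> < contrast_bound (lambda0 \<Omega> \<alpha>) \<gamma>" using \<epsilon> by (simp_all add: \<epsilon>0_def)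
    qed
  qed
  \<comment> \<open>Dividing the constant by 2 * sqrt(\<lambda>0 / \<alpha>) brings the bound C *
    \<epsilon>^3 into the required shape.\<close>
  have "2 * (C / (2 * t)) * c * t = C * c" if "t > 0" for c t :: real using that by simp
  from this[OF s] have eq: "2 * (C / (2 * ?s)) * \<epsilon> ^ 3 * ?s = C * \<epsilon> ^ 3" for \<epsilon> .
  show ?thesis
  proof (intro exI conjI allI impI)
    show "C / (2 * ?s) > 0" using C s by simp
    show "\<epsilon>0 > 0" by (rule \<epsilon>0)
    fix B u1 \<epsilon>
    assume "B \<in> sets lebesgue \<and> B \<subseteq> \<Omega> \<and> is_u1 \<Omega> \<alpha> u0 B u1" "0 < \<epsilon> \<and> \<epsilon> < \<epsilon>0"
    then show "\<bar>lambda_eps \<Omega> \<alpha> \<epsilon> B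
        - (lambda0 \<Omega> \<alpha> + \<epsilon> * lambda1 \<Omega> \<alpha> u0 B + \<epsilon>\<^sup>2 * lambda2 \<Omega> \<alpha> u0 u1 B)\<bar>
      \<le> 2 * (C / (2 * ?s)) * \<epsilon> ^ 3 * ?s"
      unfolding eq by (intro bound) auto
  qed
qed

end

end

theorem proposition2p2:
  fixes \<Omega> :: "'a::euclidean_space set" and \<alpha> :: real and u0 :: "'a \<Rightarrow> real"
  assumes "open \<Omega>" and "connected \<Omega>" and "bounded \<Omega>" and "\<Omega> \<noteq> {}"
    and "\<alpha> > 0"
    and "is_u0 \<Omega> \<alpha> u0"
  shows "\<exists>C>0. \<exists>\<epsilon>0>0. \<forall>B u1. B \<in> sets lebesgue \<and> B \<subseteq> \<Omega> \<and> is_u1 \<Omega> \<alpha> u0 B u1 \<longrightarrow>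
           (\<forall>\<epsilon>. 0 < \<epsilon> \<and> \<epsilon> < \<epsilon>0 \<longrightarrow>
              \<bar>lambda_eps \<Omega> \<alpha> \<epsilon> B
                - (lambda0 \<Omega> \<alpha> + \<epsilon> * lambda1 \<Omega> \<alpha> u0 B + \<epsilon>\<^sup>2 * lambda2 \<Omega> \<alpha> u0 u1 B)\<bar>
              \<le> 2 * C * \<epsilon> ^ 3 * sqrt (lambda0 \<Omega> \<alpha> / \<alpha>))"
proof -
  interpret bounded_open \<Omega>
    using assms(1,3) by unfold_locales
  show ?thesis
    using assms(2,5,6) by (rule eigenvalue_expansion)
qed

end
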